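(* Assume that Assumption 1 and Assumption 2 (both stated in the context) hold. Then there is an algorithm which, given any $N$ and any tangle $X\in\mathcal{B}_N$ as input, outputs a minimal factorization of $X$ in time $\mathcal{O}(N^4)$.
   Context: For an integer $N\ge 0$, take upper nodes $1,\dots,N$ and lower nodes $1',\dots,N'$ arranged in two rows. A tangle is a set of $N$ edges such that each node is in exactly one edge (a perfect matching of the $2N$ nodes). The composition $X\circ Y$ is obtained by stacking $X$ on top of $Y$, identifying lower node $i'$ of $X$ with upper node $i$ of $Y$, tracing paths, and discarding internal loops. The Brauer monoid $\mathcal{B}_N$ is the monoid of all tangles, with identity $I_N=\{(i,i'):1\le i\le N\}$. It is generated by the primes, for $1\le i\le N-1$: the $T$-prime $T_i$, obtained from $I_N$ by replacing $(i,i'),(i+1,(i+1)')$ with $(i,(i+1)'),(i+1,i')$; and the $U$-prime $U_i$, obtained from $I_N$ by replacing these two edges with $(i,i+1),(i',(i+1)')$. A factorization of $X$ is a word in the primes whose composition is $X$ (the empty word is a factorization of $I_N$); it is minimal if no shorter word has the same composition. Two edges cross if they intersect in the diagram of the tangle drawn inside the rectangle with the minimum number of crossings (equivalently, their endpoints interleave in the cyclic order $1,\dots,N,N',\dots,1'$); the number of crossings of a tangle is the number of crossing pairs of edges. Rewriting rules on words. Delete rules (applied left to right): $T_iT_i\to$ empty word; $U_iU_i\to U_i$; $T_iU_i\to U_i$; $U_iT_i\to U_i$; and for $|i-j|=1$: $U_iU_jU_i\to U_i$; $U_iT_jU_i\to U_i$; $T_iU_jU_i\to T_jU_i$; $U_iU_jT_i\to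 U_iT_j$; $U_iT_jT_i\to U_iU_j$; $T_iT_jU_i\to U_jU_i$. Braid rules, for $|i-j|=1$: $T_iT_jT_i= T_jT_iT_j$; $T_iU_jT_i= T_jU_iT_j$. Swap rules, for $|i-j|>1$: any prime of index $i$ commutes with any prime of index $j$. Assumption 1: for every $N$, every factorization in $\mathcal{B}_N$ can be transformed into a minimal one by a sequence of delete, braid and swap rules (the length never needs to be increased). Assumption 2: if a tangle $X$ has $k$ crossings, then there exists a minimal factorization of $X$ with exactly $k$ $T$-primes, and no factorization of $X$ has fewer $T$-primes. Running time counts elementary operations on node labels as constant time. *)

theory Defs
  imports Complex_Main "HOL-Library.Landau_Symbols"
begin

section \<open>Tangles and their composition\<close>

datatype node = Upper nat | Lower nat

definition nodes :: "nat \<Rightarrow> node set" where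
  "nodes N = Upper ` {1..N} \<union> Lower ` {1..N}"

type_synonym tangle = "node set set"

definition is_tangle :: "nat \<Rightarrow> tangle \<Rightarrow> bool" where
  "is_tangle N X \<longleftrightarrow>
     (\<forall>e\<in>X. e \<subseteq> nodes N \<and> card e = 2) \<and> (\<forall>v\<in>nodes N. \<exists>!e. e \<in> X \<and> v \<in> e)"

definition id_tangle :: "nat \<Rightarrow> tangle" where
  "id_tangle N = {{Upper i, Lower i} | i. 1 \<le> i \<and> i \<le> N}"

text \<open>
  Stacking \<open>X\<close> on top of \<open>Y\<close> gives a diagram with three rows of points, \<open>(r, i)\<close> being the
  \<open>i\<close>-th point of row \<open>r\<close>. The rows of \<open>X\<close> are 0 and 1, the rows of \<open>Y\<close> are 1 and 2, so that
  row 1 consists of the identified nodes. The function \<open>place r q\<close> puts the upper nodes of a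
  tangle in row \<open>r\<close> and its lower nodes in row \<open>q\<close>.
\<close>

fun place :: "nat \<Rightarrow> nat \<Rightarrow> node \<Rightarrow> nat \<times> nat" where
  "place r q (Upper i) = (r, i)"
| "place r q (Lower i) = (q, i)"

definition stacked_links :: "tangle \<Rightarrow> tangle \<Rightarrow> ((nat \<times> nat) \<times> (nat \<times> nat)) set" where
  "stacked_links X Y =
     {(place 0 1 u, place 0 1 v) | u v. {u, v} \<in> X} \<union>
     {(place 1 2 u, place 1 2 v) | u v. {u, v} \<in> Y}"

text \<open>
  Every point of the stacked diagram has at most one edge of \<open>X\<close> and one edge of \<open>Y\<close>, and the
  outer points (rows 0 and 2) have only one edge. Hence the diagram splits into paths between two
  outer points and internal loops, and the edges of the composition are the pairs of distinct
  outer points joined by a path.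
\<close>

definition compose :: "tangle \<Rightarrow> tangle \<Rightarrow> tangle" where
  "compose X Y =
     {{u, v} | u v. u \<noteq> v \<and> (place 0 2 u, place 0 2 v) \<in> (stacked_links X Y)\<^sup>*}"


section \<open>Primes and factorizations\<close>

datatype prime = T (index: nat) | U (index: nat)

fun is_T :: "prime \<Rightarrow> bool" where
  "is_T (T i) = True"
| "is_T (U i) = False"

fun prime_tangle :: "nat \<Rightarrow> prime \<Rightarrow> tangle" where
  "prime_tangle N (T i) =
     (id_tangle N - {{Upper i, Lower i}, {Upper (i + 1), Lower (i + 1)}})
       \<union> {{Upper i, Lower (i + 1)}, {Upper (i + 1), Lower i}}"
| "prime_tangle N (U i) =
     (id_tangle N - {{Upper i, Lower i}, {Upper (i + 1), Lower (i + 1)}})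
       \<union> {{Upper i, Upper (i + 1)}, {Lower i, Lower (i + 1)}}"

definition is_word :: "nat \<Rightarrow> prime list \<Rightarrow> bool" where
  "is_word N w \<longleftrightarrow> (\<forall>p\<in>set w. 1 \<le> index p \<and> index p + 1 \<le> N)"

definition word_tangle :: "nat \<Rightarrow> prime list \<Rightarrow> tangle" where
  "word_tangle N w = foldr (\<lambda>p X. compose (prime_tangle N p) X) w (id_tangle N)"

definition factorization :: "nat \<Rightarrow> prime list \<Rightarrow> tangle \<Rightarrow> bool" where
  "factorization N w X \<longleftrightarrow> is_word N w \<and> word_tangle N w = X"

definition minimal_factorization :: "nat \<Rightarrow> prime list \<Rightarrow> tangle \<Rightarrow> bool" where
  "minimal_factorization N w X \<longleftrightarrow>
     factorization N w X \<and> (\<forall>w'. factorization N w' X \<longrightarrow> length w \<le> length w')"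

definition num_T :: "prime list \<Rightarrow> nat" where
  "num_T w = length (filter is_T w)"


section \<open>Crossings\<close>

text \<open>Positions in the cyclic order 1, ..., N, N', ..., 1'.\<close>

fun pos :: "nat \<Rightarrow> node \<Rightarrow> nat" where
  "pos N (Upper i) = i"
| "pos N (Lower i) = 2 * N + 1 - i"

definition cross :: "nat \<Rightarrow> node set \<Rightarrow> node set \<Rightarrow> bool" where
  "cross N e f \<longleftrightarrow>
     (\<exists>a b c d. e = {a, b} \<and> f = {c, d} \<and>
        (pos N a < pos N c \<and> pos N c < pos N b \<and> pos N b < pos N d \<or>
         pos N c < pos N a \<and> pos N a < pos N d \<and> pos N d < pos N b))"

definition crossings :: "nat \<Rightarrow> tangle \<Rightarrow> nat" where
  "crossings N X = card {{e, f} | e f. e \<in> X \<and> f \<in> X \<and> cross N e f}"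


section \<open>Rewriting rules\<close>

inductive delete_rule :: "prime list \<Rightarrow> prime list \<Rightarrow> bool" where
  "delete_rule [T i, T i] []"
| "delete_rule [U i, U i] [U i]"
| "delete_rule [T i, U i] [U i]"
| "delete_rule [U i, T i] [U i]"
| "\<bar>int i - int j\<bar> = 1 \<Longrightarrow> delete_rule [U i, U j, U i] [U i]"
| "\<bar>int i - int j\<bar> = 1 \<Longrightarrow> delete_rule [U i, T j, U i] [U i]"
| "\<bar>int i - int j\<bar> = 1 \<Longrightarrow> delete_rule [T i, U j, U i] [T j, U i]"
| "\<bar>int i - int j\<bar> = 1 \<Longrightarrow> delete_rule [U i, U j, T i] [U i, T j]"
| "\<bar>int i - int j\<bar> = 1 \<Longrightarrow> delete_rule [U i, T j, T i] [U i, U j]"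
| "\<bar>int i - int j\<bar> = 1 \<Longrightarrow> delete_rule [T i, T j, U i] [U j, U i]"

text \<open>
  Both braid rules are invariant under exchanging \<open>i\<close> and \<open>j\<close>, so the following relation
  contains both directions of each rule; the same holds for the swap rules below.
\<close>

inductive braid_rule :: "prime list \<Rightarrow> prime list \<Rightarrow> bool" where
  "\<bar>int i - int j\<bar> = 1 \<Longrightarrow> braid_rule [T i, T j, T i] [T j, T i, T j]"
| "\<bar>int i - int j\<bar> = 1 \<Longrightarrow> braid_rule [T i, U j, T i] [T j, U i, T j]"

inductive swap_rule :: "prime list \<Rightarrow> prime list \<Rightarrow> bool" where
  "\<bar>int (index p) - int (index q)\<bar> > 1 \<Longrightarrow> swap_rule [p, q] [q, p]"

inductive rewrite_step :: "prime list \<Rightarrow> prime list \<Rightarrow> bool" where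
  "delete_rule l r \<or> braid_rule l r \<or> swap_rule l r \<Longrightarrow> rewrite_step (x @ l @ y) (x @ r @ y)"


section \<open>Programs and their running time\<close>

text \<open>
  Algorithms are programs of a structured random access machine with scalar variables and arrays
  holding natural numbers; a program mentions only finitely many of them. Every operation takes
  one time unit. The only arithmetic operations are successor and predecessor, so that a run of
  length \<open>t\<close> produces only numbers exceeding those in the input and in the program text by at
  most \<open>t\<close>: unit cost cannot be abused by computing with huge numbers.
\<close>

record state =
  scalar :: "string \<Rightarrow> nat"
  arr :: "string \<Rightarrow> nat \<Rightarrow> nat"

datatype exp =
    Const nat
  | Var string
  | Read string exp
  | Succ exp
  | Pred exp

datatype test =
    Equal exp exp
  | Less exp exp
  | Neg test
  | Conj test test

datatype com =
    Skip
  | Assign string exp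
  | Write string exp exp
  | Seq com com
  | Cond test com com
  | While test com

primrec exp_val :: "exp \<Rightarrow> state \<Rightarrow> nat" where
  "exp_val (Const n) s = n"
| "exp_val (Var x) s = scalar s x"
| "exp_val (Read a e) s = arr s a (exp_val e s)"
| "exp_val (Succ e) s = exp_val e s + 1"
| "exp_val (Pred e) s = exp_val e s - 1"

primrec exp_time :: "exp \<Rightarrow> nat" where
  "exp_time (Const n) = 1"
| "exp_time (Var x) = 1"
| "exp_time (Read a e) = exp_time e + 1"
| "exp_time (Succ e) = exp_time e + 1"
| "exp_time (Pred e) = exp_time e + 1"

primrec test_val :: "test \<Rightarrow> state \<Rightarrow> bool" where
  "test_val (Equal e f) s \<longleftrightarrow> exp_val e s = exp_val f s"
| "test_val (Less e f) s \<longleftrightarrow> exp_val e s < exp_val f s"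
| "test_val (Neg b) s \<longleftrightarrow> \<not> test_val b s"
| "test_val (Conj b c) s \<longleftrightarrow> test_val b s \<and> test_val c s"

primrec test_time :: "test \<Rightarrow> nat" where
  "test_time (Equal e f) = exp_time e + exp_time f + 1"
| "test_time (Less e f) = exp_time e + exp_time f + 1"
| "test_time (Neg b) = test_time b + 1"
| "test_time (Conj b c) = test_time b + test_time c + 1"

definition set_scalar :: "string \<Rightarrow> nat \<Rightarrow> state \<Rightarrow> state" where
  "set_scalar x n s = s\<lparr>scalar := (scalar s)(x := n)\<rparr>"

definition set_arr :: "string \<Rightarrow> nat \<Rightarrow> nat \<Rightarrow> state \<Rightarrow> state" where
  "set_arr a k n s = s\<lparr>arr := (arr s)(a := (arr s a)(k := n))\<rparr>"

text \<open>\<open>run c s t s'\<close>: started in state \<open>s\<close>, program \<open>c\<close> halts in state \<open>s'\<close> after \<open>t\<close> time units.\<close>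

inductive run :: "com \<Rightarrow> state \<Rightarrow> nat \<Rightarrow> state \<Rightarrow> bool" where
  Skip: "run Skip s 1 s"
| Assign: "run (Assign x e) s (exp_time e + 1) (set_scalar x (exp_val e s) s)"
| Write: "run (Write a e f) s (exp_time e + exp_time f + 1)
            (set_arr a (exp_val e s) (exp_val f s) s)"
| Seq: "run c s t s' \<Longrightarrow> run d s' t' s'' \<Longrightarrow> run (Seq c d) s (t + t') s''"
| Cond_True: "test_val b s \<Longrightarrow> run c s t s' \<Longrightarrow> run (Cond b c d) s (test_time b + t) s'"
| Cond_False: "\<not> test_val b s \<Longrightarrow> run d s t s' \<Longrightarrow> run (Cond b c d) s (test_time b + t) s'"
| While_True: "test_val b s \<Longrightarrow> run c s t s' \<Longrightarrow> run (While b c) s' t' s'' \<Longrightarrow>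
    run (While b c) s (test_time b + t + t') s''"
| While_False: "\<not> test_val b s \<Longrightarrow> run (While b c) s (test_time b) s"


section \<open>Input and output conventions\<close>

text \<open>
  The nodes of a tangle are represented by the labels 1, ..., 2N: node \<open>i\<close> by \<open>i\<close> and node \<open>i'\<close>
  by \<open>N + i\<close>. The input consists of \<open>N\<close> and of the table sending each label to the label of the
  node at the other end of its edge; everything else is initially 0.
\<close>

fun label :: "nat \<Rightarrow> node \<Rightarrow> nat" where
  "label N (Upper i) = i"
| "label N (Lower i) = N + i"

definition node_of :: "nat \<Rightarrow> nat \<Rightarrow> node" where
  "node_of N k = (if k \<le> N then Upper k else Lower (k - N))"

definition partner :: "tangle \<Rightarrow> node \<Rightarrow> node" where
  "partner X v = (THE u. {v, u} \<in> X)"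

definition input_state :: "nat \<Rightarrow> tangle \<Rightarrow> state" where
  "input_state N X =
     \<lparr>scalar = (\<lambda>x. if x = ''N'' then N else 0),
      arr = (\<lambda>a k. if a = ''mate'' \<and> 1 \<le> k \<and> k \<le> 2 * N
                   then label N (partner X (node_of N k)) else 0)\<rparr>"

text \<open>
  The output is a word, given by its length and two arrays (with first position 0) containing the
  kinds (0 for a T-prime, 1 for a U-prime) and the indices of its letters.
\<close>

definition outputs :: "state \<Rightarrow> prime list \<Rightarrow> bool" where
  "outputs s w \<longleftrightarrow> scalar s ''length'' = length w \<and>
     (\<forall>k < length w. arr s ''kind'' k = (if is_T (w ! k) then 0 else 1) \<and>
                     arr s ''index'' k = index (w ! k))"

end

theory Submission
  imports Defs "HOL-Combinatorics.Transposition"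
begin

text \<open>
  The minimal length of a factorization of \<open>X\<close> is half the sum over the edges \<open>e\<close> of
  \<open>max (width e) (crossings of e)\<close>, where the width is the distance between the columns of the two
  ends. Composing with one prime increases this sum by at most 2, since a T-prime moves and
  crosses only two edges by one unit, and a U-prime merges two edges and creates one of width 1;
  this is the lower bound.

  Conversely, let \<open>i\<close> be the first upper node such that the edge at \<open>i\<close> does not go left and the
  edge at \<open>i + 1\<close> does not go right, but not both are vertical. If none exists, all edges are
  vertical and the tangle is the identity. If the edges differ, they cross, and splitting off \<open>T i\<close>
  decreases the sum by 2. If they are the same edge, then splitting off \<open>U i\<close> with the edge chosen
  as follows decreases the sum by 2: among the edges of the nodes left of \<open>i\<close> and the edge of the
  leftmost lower node not joined to a node left of \<open>i\<close>, take the one whose far end comes first in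
  the cyclic order after \<open>i + 1\<close>. It can be drawn up to the cup at \<open>i\<close> without new crossings, and
  both resulting edges are at least as wide as they are crossed. Every step takes time \<open>O(N)\<close> and
  is followed by a new search for \<open>i\<close>, so \<open>O(N ^ 2)\<close> steps stay within the bound.
\<close>

section \<open>Tangles as involutions of the positions 1, ..., 2N\<close>

text \<open>The maximum of width and crossings is the obstacle. Splitting off a T-prime removes a
  crossing, but a vertical edge at \<open>i\<close> or \<open>i + 1\<close> becomes wider, so its
  maximum would not drop if it were crossed only once. Parity excludes this: on each side of a
  vertical edge the number of nodes is even, so the number of edges crossing it is even, and a
  crossed vertical edge has at least two crossings. For a U-prime the drop is as large as required
  only if no edge crosses both pieces of the rerouted edge and if the width of each piece dominates
  its crossings. Choosing the first \<open>i\<close> forces every edge from the left of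
  \<open>i\<close> to end beyond \<open>i + 1\<close>, and choosing the earliest far end turns both
  demands into a count: the positions already occupied by these edges are just as many as needed to
  bound the crossings by the width. Both kinds of step re-pair four nodes, so one piece of code and
  one invariant serve both. The machine can only add or subtract 1, so positions and columns come
  from tables.\<close>

definition matching :: "nat \<Rightarrow> (nat \<Rightarrow> nat) \<Rightarrow> bool" where
  "matching N m \<longleftrightarrow> (\<forall>q\<in>{1..2 * N}. m q \<in> {1..2 * N} \<and> m (m q) = q \<and> m q \<noteq> q)"

text \<open>
  Node \<open>v\<close> is identified with its position \<open>pos N v\<close> in the cyclic order, in which \<open>i\<close> and \<open>Suc i\<close> are
  adjacent for both rows; \<open>col\<close> recovers the column of a position.
\<close>

definition col :: "nat \<Rightarrow> nat \<Rightarrow> nat" where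
  "col N q = (if q \<le> N then q else 2 * N + 1 - q)"

definition between :: "nat \<Rightarrow> nat \<Rightarrow> nat \<Rightarrow> bool" where
  "between a b u \<longleftrightarrow> a < u \<and> u < b \<or> b < u \<and> u < a"

definition sep :: "(nat \<Rightarrow> nat) \<Rightarrow> nat \<Rightarrow> nat \<Rightarrow> bool" where
  "sep m v u \<longleftrightarrow> between v (m v) u \<noteq> between v (m v) (m u)"

text \<open>
  \<open>deg\<close> counts both ends of every edge crossing the edge at \<open>v\<close>, and \<open>potential\<close> counts every edge from
  both of its ends. Hence the potential is eight times the claimed minimal length.
\<close>

definition deg :: "nat \<Rightarrow> (nat \<Rightarrow> nat) \<Rightarrow> nat \<Rightarrow> int" where
  "deg N m v = (\<Sum>u\<in>{1..2 * N}. of_bool (sep m v u))"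

definition width :: "nat \<Rightarrow> (nat \<Rightarrow> nat) \<Rightarrow> nat \<Rightarrow> int" where
  "width N m v = \<bar>int (col N v) - int (col N (m v))\<bar>"

definition cost :: "nat \<Rightarrow> (nat \<Rightarrow> nat) \<Rightarrow> nat \<Rightarrow> int" where
  "cost N m v = max (2 * width N m v) (deg N m v)"

definition potential :: "nat \<Rightarrow> (nat \<Rightarrow> nat) \<Rightarrow> int" where
  "potential N m = (\<Sum>v\<in>{1..2 * N}. cost N m v)"

text \<open>These four updates are the array writes of the program; the same function also describes
  how a U-prime joins edges.\<close>

definition repair :: "nat \<Rightarrow> nat \<Rightarrow> nat \<Rightarrow> nat \<Rightarrow> (nat \<Rightarrow> nat) \<Rightarrow> nat \<Rightarrow> nat" where
  "repair p q r s m = m(p := q, q := p, r := s, s := r)"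

text \<open>A prime stacked on top touches only the upper positions \<open>i\<close> and
  \<open>Suc i\<close>. If these are already joined, a U-prime closes a loop, which is discarded;
  the updates then reproduce \<open>m\<close>.\<close>

fun act :: "prime \<Rightarrow> (nat \<Rightarrow> nat) \<Rightarrow> nat \<Rightarrow> nat" where
  "act (T i) m = transpose i (Suc i) \<circ> m \<circ> transpose i (Suc i)"
| "act (U i) m = repair (m i) (m (Suc i)) i (Suc i) m"

declare act.simps(2) [simp del]

lemma matchingD:
  assumes "matching N m" "1 \<le> q" "q \<le> 2 * N"
  shows "1 \<le> m q" "m q \<le> 2 * N" "m (m q) = q" "m q \<noteq> q"
  using assms by (auto simp: matching_def)

lemma matching_eq_iff:
  assumes "matching N m" "1 \<le> p" "p \<le> 2 * N" "1 \<le> q" "q \<le> 2 * N"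
  shows "m p = m q \<longleftrightarrow> p = q" "m p = q \<longleftrightarrow> m q = p"
  using assms matchingD(3) by metis+

lemma transpose_Suc_range:
  assumes "1 \<le> i" "Suc i \<le> n"
  shows "1 \<le> transpose i (Suc i) q \<and> transpose i (Suc i) q \<le> n \<longleftrightarrow> 1 \<le> q \<and> q \<le> n"
  using assms by (auto simp: transpose_def)

lemma repair_simps:
  assumes "distinct [p, q, r, s]"
  shows "repair p q r s m p = q" "repair p q r s m q = p" "repair p q r s m r = s"
    "repair p q r s m s = r" "x \<notin> {p, q, r, s} \<Longrightarrow> repair p q r s m x = m x"
  using assms by (auto simp: repair_def)

lemma matching_repair:
  assumes m: "matching N m" and d: "distinct [p, q, r, s]"
    and sub: "{p, q, r, s} \<subseteq> {1..2 * N}" and cl: "m ` {p, q, r, s} \<subseteq> {p, q, r, s}"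
  shows "matching N (repair p q r s m)"
proof -
  have "repair p q r s m x \<in> {1..2 * N} \<and> repair p q r s m (repair p q r s m x) = x \<and> repair p q r s m x \<noteq> x"
    if x: "x \<in> {1..2 * N}" for x
  proof (cases "x \<in> {p, q, r, s}")
    case True
    then consider "x = p" | "x = q" | "x = r" | "x = s" by blast
    then show ?thesis
      by cases (use d sub in \<open>simp_all add: repair_simps[OF d]\<close>)
  next
    case False
    have mx: "m x \<in> {1..2 * N}" "m (m x) = x" "m x \<noteq> x"
      using x m by (auto simp: matching_def)
    then have "m x \<notin> {p, q, r, s}" using cl False by (metis image_subset_iff)
    then show ?thesis
      using False mx by (simp add: repair_simps(5)[OF d])
  qed
  then show ?thesis unfolding matching_def by blast
qed

lemma matching_act:
  assumes m: "matching N m" and p: "1 \<le> index p" "index p + 1 \<le> N"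
  shows "matching N (act p m)"
proof (cases p)
  case (T i)
  define t where "t = transpose i (Suc i)"
  have i: "1 \<le> i" "Suc i \<le> 2 * N" using p T by auto
  have "act p m q \<in> {1..2 * N} \<and> act p m (act p m q) = q \<and> act p m q \<noteq> q"
    if "q \<in> {1..2 * N}" for q
  proof -
    have r: "1 \<le> t q" "t q \<le> 2 * N" "t (t q) = q"
      using that transpose_Suc_range[OF i, of q] by (auto simp: t_def)
    have "t (m (t q)) \<in> {1..2 * N}"
      using matchingD(1,2)[OF m r(1,2)] transpose_Suc_range[OF i, of "m (t q)"] by (simp add: t_def)
    moreover have "t (m (t q)) \<noteq> q"
      using matchingD(4)[OF m r(1,2)] by (metis t_def transpose_involutory)
    ultimately show ?thesis
      using T matchingD(3)[OF m r(1,2)] r by (simp add: t_def)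
  qed
  then show ?thesis unfolding matching_def by blast
next
  case (U i)
  have i: "1 \<le> i" "Suc i \<le> 2 * N" "i \<le> 2 * N" "1 \<le> Suc i" using p U by auto
  note A = matchingD[OF m i(1,3)] and B = matchingD[OF m i(4,2)]
  show ?thesis
  proof (cases "m i = Suc i")
    case True
    then have "m (Suc i) = i" using A by simp
    then have "act p m = m" using True U by (auto simp: repair_def act.simps(2))
    then show ?thesis using m by simp
  next
    case False
    have "m (Suc i) \<noteq> i" "m i \<noteq> m (Suc i)" using False A B by force+
    then have "matching N (repair (m i) (m (Suc i)) i (Suc i) m)"
      using A B i False by (intro matching_repair[OF m]) auto
    then show ?thesis using U by (simp add: act.simps(2))
  qed
qed

lemma sep_mate: "matching N m \<Longrightarrow> 1 \<le> v \<Longrightarrow> v \<le> 2 * N \<Longrightarrow> sep m (m v) u = sep m v u"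
  by (auto simp: sep_def between_def matchingD(3))

lemma sep_mate2: "matching N m \<Longrightarrow> 1 \<le> u \<Longrightarrow> u \<le> 2 * N \<Longrightarrow> sep m v (m u) = sep m v u"
  by (auto simp: sep_def between_def matchingD(3))

lemma cost_mate:
  assumes "matching N m" "1 \<le> v" "v \<le> 2 * N"
  shows "width N m (m v) = width N m v" "deg N m (m v) = deg N m v" "cost N m (m v) = cost N m v"
proof -
  show 1: "width N m (m v) = width N m v"
    using assms by (simp add: width_def matchingD(3) abs_minus_commute)
  show 2: "deg N m (m v) = deg N m v"
    unfolding deg_def sep_mate[OF assms] ..
  show "cost N m (m v) = cost N m v"
    unfolding cost_def 1 2 ..
qed

lemma cost_nonneg [simp]: "0 \<le> cost N m v"
  by (simp add: cost_def width_def le_max_iff_disj)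

lemma deg_card: "deg N m v = int (card {u\<in>{1..2 * N}. sep m v u})"
  unfolding deg_def by (simp add: sum_of_bool_eq Int_def)

text \<open>Marking one end of each crossing edge suffices, while \<open>deg\<close> counts both
  ends; the factor 2 matches the one before \<open>width\<close> in \<open>cost\<close>.\<close>

lemma deg_le_card:
  assumes m: "matching N m" and A: "finite A"
    and sub: "\<And>u. 1 \<le> u \<Longrightarrow> u \<le> 2 * N \<Longrightarrow> sep m v u \<Longrightarrow> u \<in> A \<or> m u \<in> A"
  shows "deg N m v \<le> 2 * int (card A)"
proof -
  have "{u\<in>{1..2 * N}. sep m v u} \<subseteq> A \<union> m ` A"
    using sub matchingD[OF m] by (auto simp: image_iff) metis
  then have "card {u\<in>{1..2 * N}. sep m v u} \<le> card (A \<union> m ` A)"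
    using A by (intro card_mono) auto
  also have "\<dots> \<le> card A + card (m ` A)" by (rule card_Un_le)
  also have "\<dots> \<le> 2 * card A" using card_image_le[OF A, of m] by simp
  finally show ?thesis unfolding deg_card by linarith
qed

lemma sum_split4:
  fixes f :: "nat \<Rightarrow> int"
  assumes "finite S" "{a, b, c, d} \<subseteq> S" "distinct [a, b, c, d]"
  shows "sum f S = f a + f b + f c + f d + sum f (S - {a, b, c, d})"
proof -
  have "sum f S = sum f (S - {a, b, c, d}) + sum f {a, b, c, d}"
    using assms by (intro sum.subset_diff) auto
  then show ?thesis using assms by simp
qed

section \<open>Composition with a T-prime\<close>

text \<open>An adjacent transposition reverses the order of \<open>i\<close> and
  \<open>Suc i\<close> and of no other pair. Betweenness is the exclusive or of two comparisons, so
  it flips exactly when \<open>u\<close> and one of \<open>a\<close>, \<open>b\<close> form this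
  pair.\<close>

lemma between_transpose:
  assumes "a \<noteq> b" "u \<noteq> a" "u \<noteq> b"
  shows "between (transpose i (Suc i) a) (transpose i (Suc i) b) (transpose i (Suc i) u) \<longleftrightarrow>
    (between a b u \<noteq> (u = i \<and> (a = Suc i \<or> b = Suc i) \<or> u = Suc i \<and> (a = i \<or> b = i)))"
proof -
  have less: "transpose i (Suc i) x < transpose i (Suc i) y \<longleftrightarrow> (x < y) \<noteq> ({x, y} = {i, Suc i})" if "x \<noteq> y" for x y
    using that by (cases "x = i"; cases "x = Suc i"; cases "y = i"; cases "y = Suc i") (auto simp: transpose_def doubleton_eq_iff)
  have iff: "between a b u \<longleftrightarrow> (a < u) \<noteq> (b < u)" if "u \<noteq> a" "u \<noteq> b" for a b u :: nat
    using that by (auto simp: between_def)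
  have xor: "((P \<noteq> R) \<noteq> (Q \<noteq> S)) \<longleftrightarrow> ((P \<noteq> Q) \<noteq> W)" if "R \<noteq> S \<longleftrightarrow> W" for P Q R S W :: bool
    using that by blast
  have ne: "transpose i (Suc i) u \<noteq> transpose i (Suc i) a" "transpose i (Suc i) u \<noteq> transpose i (Suc i) b"
    using assms by (metis transpose_involutory)+
  show ?thesis
    unfolding iff[OF ne] iff[OF assms(2,3)] less[OF assms(2)[symmetric]] less[OF assms(3)[symmetric]]
    by (rule xor) (use assms in \<open>auto simp: doubleton_eq_iff\<close>)
qed

text \<open>Interleaving of four distinct points is symmetric; for two ends of one edge both sides
  are false.\<close>

lemma sep_commute:
  assumes "matching N m" "1 \<le> u" "u \<le> 2 * N" "1 \<le> v" "v \<le> 2 * N"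
  shows "sep m v u \<longleftrightarrow> sep m u v"
proof (cases "u = v \<or> u = m v")
  case True
  then have "\<not> sep m v u" "\<not> sep m u v"
    using matchingD(3)[OF assms(1,4,5)] by (auto simp: sep_def between_def)
  then show ?thesis by simp
next
  case False
  then have "m u \<noteq> v" "m u \<noteq> m v" "m u \<noteq> u" "m v \<noteq> v"
    using matchingD[OF assms(1)] assms by metis+
  moreover have "(between v b u \<noteq> between v b w) \<longleftrightarrow> (between u w v \<noteq> between u w b)"
    if "u \<noteq> v" "u \<noteq> b" "w \<noteq> v" "w \<noteq> b" "w \<noteq> u" "b \<noteq> v" for b w
    using that unfolding between_def by linarith
  ultimately show ?thesis using False unfolding sep_def by blast
qed

lemma sum_transpose:
  fixes f :: "nat \<Rightarrow> int"
  assumes "1 \<le> i" "Suc i \<le> n"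
  shows "(\<Sum>v\<in>{1..n}. f (transpose i (Suc i) v)) = sum f {1..n}"
proof (rule sum.reindex_bij_witness[of _ "transpose i (Suc i)" "transpose i (Suc i)"])
qed (use transpose_Suc_range[OF assms] in \<open>simp_all only: transpose_involutory atLeastAtMost_iff\<close>)

text \<open>A matching is constrained on the positions 1 to \<open>2 * N\<close> only, so functions
  describing the same tangle may differ elsewhere; the potential must not see this.\<close>

lemma potential_cong:
  assumes "matching N m" "\<And>q. 1 \<le> q \<Longrightarrow> q \<le> 2 * N \<Longrightarrow> m' q = m q"
  shows "potential N m' = potential N m"
proof -
  have "sep m' v u \<longleftrightarrow> sep m v u" "width N m' v = width N m v" if "v \<in> {1..2 * N}" "u \<in> {1..2 * N}" for v u
    using that assms(2) by (auto simp: sep_def width_def)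
  moreover from this have "deg N m' v = deg N m v" if "v \<in> {1..2 * N}" for v
    unfolding deg_def using that by (intro sum.cong) auto
  ultimately show ?thesis
    unfolding potential_def cost_def by (intro sum.cong) auto
qed

text \<open>Here \<open>{v, b}\<close> and \<open>{u, w}\<close> are two disjoint edges, neither
  equal to \<open>{i, j}\<close>. At most one of \<open>u\<close>, \<open>w\<close> toggles
  betweenness, and one does exactly when one edge contains \<open>i\<close> and the other contains
  \<open>j\<close>.\<close>

lemma toggle_cancel:
  fixes u v w b i j :: nat
  assumes "b \<noteq> v" "u \<noteq> v" "u \<noteq> b" "w \<noteq> v" "w \<noteq> b" "w \<noteq> u" "i \<noteq> j"
    "\<not> (u = i \<and> w = j)" "\<not> (u = j \<and> w = i)" "\<not> (v = i \<and> b = j)" "\<not> (v = j \<and> b = i)"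
  shows "((P \<noteq> (u = i \<and> (v = j \<or> b = j) \<or> u = j \<and> (v = i \<or> b = i))) \<noteq>
      (Q \<noteq> (w = i \<and> (v = j \<or> b = j) \<or> w = j \<and> (v = i \<or> b = i)))) \<longleftrightarrow>
    ((P \<noteq> Q) \<noteq> ((v = i \<or> b = i) \<and> (u = j \<or> w = j) \<or> (v = j \<or> b = j) \<and> (u = i \<or> w = i)))"
proof (cases "u = i \<or> w = i"; cases "u = j \<or> w = j")
qed (use assms in auto)

context
  fixes N i :: nat and m :: "nat \<Rightarrow> nat"
  assumes m: "matching N m" and i: "1 \<le> i" "Suc i \<le> N" and ne: "m i \<noteq> Suc i"
begin

text \<open>Swapping adjacent ends of two different edges creates or removes only the crossing of
  these two edges; every other crossing is carried along by the transposition.\<close>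

lemma sep_act_T:
  assumes "1 \<le> v" "v \<le> 2 * N" "1 \<le> u" "u \<le> 2 * N"
  shows "sep (act (T i) m) (transpose i (Suc i) v) (transpose i (Suc i) u) \<longleftrightarrow>
    (sep m v u \<noteq> ((v \<in> {i, m i} \<and> u \<in> {Suc i, m (Suc i)}) \<or> (v \<in> {Suc i, m (Suc i)} \<and> u \<in> {i, m i})))"
proof -
  have r: "1 \<le> i" "i \<le> 2 * N" "1 \<le> Suc i" "Suc i \<le> 2 * N" using i by auto
  note V = matchingD[OF m assms(1,2)] and U = matchingD[OF m assms(3,4)]
    and I = matchingD[OF m r(1,2)] and J = matchingD[OF m r(3,4)]
  have X: "act (T i) m (transpose i (Suc i) x) = transpose i (Suc i) (m x)" for x
    by simp
  have mi: "m (Suc i) \<noteq> i" using ne J by force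
  have eqs: "v = m i \<longleftrightarrow> m v = i" "v = m (Suc i) \<longleftrightarrow> m v = Suc i"
     "u = m i \<longleftrightarrow> m u = i" "u = m (Suc i) \<longleftrightarrow> m u = Suc i"
    using V U I J by auto
  show ?thesis
  proof (cases "u = v \<or> u = m v")
    case True
    then have "m u = m v \<or> m u = v" using V by auto
    then have "\<not> sep (act (T i) m) (transpose i (Suc i) v) (transpose i (Suc i) u)" "\<not> sep m v u"
      using True V by (auto simp: sep_def X between_def)
    moreover have "\<not> (v \<in> {i, m i} \<and> u \<in> {Suc i, m (Suc i)})" "\<not> (v \<in> {Suc i, m (Suc i)} \<and> u \<in> {i, m i})"
      using True V I J mi ne by auto
    ultimately show ?thesis by blast
  next
    case False
    then have d: "m v \<noteq> v" "u \<noteq> v" "u \<noteq> m v" "m u \<noteq> v" "m u \<noteq> m v"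
      using V U by metis+
    have iu: "\<not> (u = i \<and> m u = Suc i)" "\<not> (u = Suc i \<and> m u = i)" "\<not> (v = i \<and> m v = Suc i)" "\<not> (v = Suc i \<and> m v = i)"
      using mi ne by auto
    from toggle_cancel[OF d U(4) n_not_Suc_n[of i] iu, of "between v (m v) u" "between v (m v) (m u)"]
    show ?thesis
      unfolding sep_def X between_transpose[OF d(1)[symmetric] d(2,3)] between_transpose[OF d(1)[symmetric] d(4,5)]
      by (simp only: insert_iff eqs empty_iff HOL.simp_thms)
  qed
qed

text \<open>The edges at \<open>i\<close> and \<open>Suc i\<close> gain or lose each other, and
  \<open>deg\<close> sees both ends of the other edge: hence the 2.\<close>

lemma deg_act_T:
  assumes v: "1 \<le> v" "v \<le> 2 * N"
  shows "v \<notin> {i, Suc i, m i, m (Suc i)} \<Longrightarrow> deg N (act (T i) m) (transpose i (Suc i) v) = deg N m v"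
    and "v \<in> {i, Suc i, m i, m (Suc i)} \<Longrightarrow>
      deg N (act (T i) m) (transpose i (Suc i) v) = deg N m v + (if sep m i (Suc i) then - 2 else 2)"
proof -
  have r: "1 \<le> i" "i \<le> 2 * N" "1 \<le> Suc i" "Suc i \<le> 2 * N" using i by auto
  note I = matchingD[OF m r(1,2)] and J = matchingD[OF m r(3,4)]
  have mi: "m (Suc i) \<noteq> i" "m i \<noteq> m (Suc i)" using ne I J by force+
  let ?X = "act (T i) m" and ?t = "transpose i (Suc i)"
  have D: "deg N ?X (?t v) = (\<Sum>u\<in>{1..2 * N}. of_bool (sep ?X (?t v) (?t u)))"
    unfolding deg_def by (subst sum_transpose[OF r(1,4)]) (rule refl)
  show "deg N ?X (?t v) = deg N m v" if "v \<notin> {i, Suc i, m i, m (Suc i)}"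
    unfolding D unfolding deg_def
  proof (rule sum.cong[OF refl])
    fix u assume "u \<in> {1..2 * N}"
    then have "sep ?X (?t v) (?t u) \<longleftrightarrow> sep m v u" using sep_act_T[OF v, of u] that by auto
    then show "of_bool (sep ?X (?t v) (?t u)) = of_bool (sep m v u)" by simp
  qed
  \<comment> \<open>\<open>u\<close> is an end of the opposite edge. Both \<open>u\<close> and
    \<open>m u\<close> toggle, in the same direction, because \<open>sep\<close> agrees on the two
    ends of an edge.\<close>
  have part: "deg N ?X (?t v) = deg N m v + (if sep m i (Suc i) then - 2 else 2)"
    if u: "{u, m u} \<subseteq> {1..2 * N}" "u \<noteq> m u" and f: "\<And>x. x \<in> {1..2 * N} \<Longrightarrow> sep ?X (?t v) (?t x) \<longleftrightarrow> (sep m v x \<noteq> (x \<in> {u, m u}))"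
      and s: "sep m v u = sep m i (Suc i)" for u
  proof -
    have su: "sep m v (m u) = sep m v u" using u by (simp add: sep_mate2[OF m])
    have "deg N ?X (?t v) = (\<Sum>x\<in>{1..2 * N}. of_bool (sep m v x) + (if x \<in> {u, m u} then (if sep m i (Suc i) then - 1 else 1) else 0))"
      unfolding D by (rule sum.cong[OF refl]) (use f s su in auto)
    also have "\<dots> = deg N m v + (\<Sum>x\<in>{1..2 * N}. if x \<in> {u, m u} then (if sep m i (Suc i) then - 1 else 1) else 0)"
      unfolding sum.distrib deg_def ..
    also have "(\<Sum>x\<in>{1..2 * N}. if x \<in> {u, m u} then (if sep m i (Suc i) then - 1 else (1::int)) else 0)
        = (\<Sum>x\<in>{1..2 * N} \<inter> {u, m u}. if sep m i (Suc i) then - 1 else 1)"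
      by (rule sum.inter_restrict[symmetric]) simp
    also have "{1..2 * N} \<inter> {u, m u} = {u, m u}" using u by blast
    also have "(\<Sum>x\<in>{u, m u}. if sep m i (Suc i) then - 1 else (1::int)) = (if sep m i (Suc i) then - 2 else 2)"
      using u by simp
    finally show ?thesis .
  qed
  assume "v \<in> {i, Suc i, m i, m (Suc i)}"
  then consider "v \<in> {i, m i}" | "v \<in> {Suc i, m (Suc i)}" by blast
  then show "deg N ?X (?t v) = deg N m v + (if sep m i (Suc i) then - 2 else 2)"
  proof cases
    case 1
    then have s: "sep m v (Suc i) = sep m i (Suc i)" using sep_mate[OF m r(1,2)] by auto
    have v': "v \<notin> {Suc i, m (Suc i)}" using 1 mi ne by auto
    show ?thesis
    proof (rule part[OF _ _ _ s])
      show "sep ?X (?t v) (?t x) \<longleftrightarrow> (sep m v x \<noteq> (x \<in> {Suc i, m (Suc i)}))" if "x \<in> {1..2 * N}" for x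
        using sep_act_T[of v x] v v' 1 that by (auto simp del: act.simps)
    qed (use J r in auto)
  next
    case 2
    then have s: "sep m v i = sep m i (Suc i)"
      using sep_mate[OF m r(3,4)] sep_commute[OF m r(1,2) r(3,4)] by auto
    have v': "v \<notin> {i, m i}" using 2 mi ne by auto
    show ?thesis
    proof (rule part[OF _ _ _ s])
      show "sep ?X (?t v) (?t x) \<longleftrightarrow> (sep m v x \<noteq> (x \<in> {i, m i}))" if "x \<in> {1..2 * N}" for x
        using sep_act_T[of v x] v v' 2 that by (auto simp del: act.simps)
    qed (use I r in auto)
  qed
qed

lemma width_act_T:
  assumes v: "1 \<le> v" "v \<le> 2 * N"
  shows "v \<notin> {i, Suc i, m i, m (Suc i)} \<Longrightarrow> width N (act (T i) m) (transpose i (Suc i) v) = width N m v"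
    and "width N (act (T i) m) (transpose i (Suc i) v) \<le> width N m v + 1"
proof -
  have r: "1 \<le> i" "i \<le> 2 * N" "1 \<le> Suc i" "Suc i \<le> 2 * N" using i by auto
  note I = matchingD[OF m r(1,2)] and J = matchingD[OF m r(3,4)] and V = matchingD[OF m v]
  have mi: "m (Suc i) \<noteq> i" using ne I J by force
  show "width N (act (T i) m) (transpose i (Suc i) v) = width N m v" if "v \<notin> {i, Suc i, m i, m (Suc i)}"
    using that V by (auto simp: width_def transpose_def)
  have c: "\<bar>int (col N (transpose i (Suc i) x)) - int (col N x)\<bar> \<le> (if x \<in> {i, Suc i} then 1 else 0)" for x
    using i by (simp add: transpose_def col_def)
  \<comment> \<open>No edge contains both moved positions, so at most one of its ends moves, and
    that by one column.\<close>
  have nb: "\<not> (v \<in> {i, Suc i} \<and> m v \<in> {i, Suc i})" using V ne mi by auto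
  have if_le: "(if P then 1 else 0) + (if Q then 1 else 0) \<le> (1::int)" if "\<not> (P \<and> Q)" for P Q
    using that by simp
  have move: "\<bar>int (col N (transpose i (Suc i) v)) - int (col N v)\<bar>
      + \<bar>int (col N (transpose i (Suc i) (m v))) - int (col N (m v))\<bar> \<le> 1"
    by (rule order_trans[OF add_mono[OF c[of v] c[of "m v"]] if_le[OF nb]])
  have eq: "act (T i) m (transpose i (Suc i) v) = transpose i (Suc i) (m v)" by simp
  have tri: "\<bar>x - y\<bar> \<le> \<bar>x' - y'\<bar> + 1" if "\<bar>x - x'\<bar> + \<bar>y - y'\<bar> \<le> 1" for x y x' y' :: int
    using that by linarith
  show "width N (act (T i) m) (transpose i (Suc i) v) \<le> width N m v + 1"
    unfolding width_def eq by (rule tri[OF move])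
qed

text \<open>Reindexing the new sum by the transposition aligns it with the old one; edges other than
  the two at \<open>i\<close> and \<open>Suc i\<close> keep width and degree and cancel.\<close>

lemma potential_act_T_split:
  "potential N (act (T i) m) - potential N m =
    (\<Sum>v\<in>{i, Suc i, m i, m (Suc i)}. cost N (act (T i) m) (transpose i (Suc i) v) - cost N m v)"
proof -
  have r: "1 \<le> i" "i \<le> 2 * N" "1 \<le> Suc i" "Suc i \<le> 2 * N" using i by auto
  have "potential N (act (T i) m) - potential N m =
      (\<Sum>v\<in>{1..2 * N}. cost N (act (T i) m) (transpose i (Suc i) v) - cost N m v)"
    unfolding potential_def sum_subtractf sum_transpose[OF r(1,4)] ..
  also have "\<dots> = (\<Sum>v\<in>{i, Suc i, m i, m (Suc i)}. cost N (act (T i) m) (transpose i (Suc i) v) - cost N m v)"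
  proof (rule sum.mono_neutral_right)
    show "\<forall>v\<in>{1..2 * N} - {i, Suc i, m i, m (Suc i)}. cost N (act (T i) m) (transpose i (Suc i) v) - cost N m v = 0"
    proof
      fix v assume v: "v \<in> {1..2 * N} - {i, Suc i, m i, m (Suc i)}"
      then have "1 \<le> v" "v \<le> 2 * N" "v \<notin> {i, Suc i, m i, m (Suc i)}" by auto
      from deg_act_T(1)[OF this] width_act_T(1)[OF this]
      show "cost N (act (T i) m) (transpose i (Suc i) v) - cost N m v = 0"
        unfolding cost_def by linarith
    qed
  qed (use r matchingD[OF m] in auto)
  finally show ?thesis .
qed

end

text \<open>Four ends change, each by at most 2. If \<open>i\<close> and \<open>Suc i\<close> are
  joined, the T-prime only twists their edge and the matching is unchanged.\<close>

lemma potential_act_T_le: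
  assumes m: "matching N m" and i: "1 \<le> i" "Suc i \<le> N"
  shows "potential N (act (T i) m) \<le> potential N m + 8"
proof (cases "m i = Suc i")
  case True
  have r: "1 \<le> i" "i \<le> 2 * N" "1 \<le> Suc i" "Suc i \<le> 2 * N" using i by auto
  have mi: "m (Suc i) = i" using True matchingD(3)[OF m r(1,2)] by simp
  have "potential N (act (T i) m) = potential N m"
  proof (rule potential_cong[OF m])
    fix q assume q: "1 \<le> q" "q \<le> 2 * N"
    have "m q = i \<longleftrightarrow> q = Suc i" "m q = Suc i \<longleftrightarrow> q = i"
      using matching_eq_iff(2)[OF m q] r True mi by auto
    then show "act (T i) m q = m q" using True mi by (auto simp: transpose_def)
  qed
  then show ?thesis by simp
next
  case False
  have r: "1 \<le> i" "i \<le> 2 * N" "1 \<le> Suc i" "Suc i \<le> 2 * N" using i by auto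
  have "cost N (act (T i) m) (transpose i (Suc i) v) - cost N m v \<le> 2" if "1 \<le> v" "v \<le> 2 * N" for v
  proof -
    have "deg N (act (T i) m) (transpose i (Suc i) v) \<le> deg N m v + 2"
      using deg_act_T[OF m i False that] by (cases "v \<in> {i, Suc i, m i, m (Suc i)}") (simp_all split: if_splits)
    then show ?thesis using width_act_T(2)[OF m i False that] unfolding cost_def by linarith
  qed
  then have "(\<Sum>v\<in>{i, Suc i, m i, m (Suc i)}. cost N (act (T i) m) (transpose i (Suc i) v) - cost N m v)
      \<le> of_nat (card {i, Suc i, m i, m (Suc i)}) * 2"
    using r matchingD[OF m r(1,2)] matchingD[OF m r(3,4)] by (intro sum_bounded_above) (auto simp del: act.simps transpose_apply_first transpose_apply_second)
  moreover have "card {i, Suc i, m i, m (Suc i)} \<le> 4"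
    using card_length[of "[i, Suc i, m i, m (Suc i)]"] by simp
  ultimately show ?thesis using potential_act_T_split[OF m i False] by linarith
qed

section \<open>Parity of the crossings of a vertical edge\<close>

lemma even_card_involution:
  assumes "finite A" "\<And>x. x \<in> A \<Longrightarrow> f x \<in> A \<and> f (f x) = x \<and> f x \<noteq> x"
  shows "even (card A)"
  using assms
proof (induction "card A" arbitrary: A rule: less_induct)
  case less
  show ?case
  proof (cases "A = {}")
    case False
    then obtain x where x: "x \<in> A" by blast
    define B where "B = A - {x, f x}"
    have sub: "{x, f x} \<subseteq> A" using less.prems(2)[OF x] x by auto
    have c: "card {x, f x} = 2" using less.prems(2)[OF x] by auto
    have "card B = card A - 2" unfolding B_def using c card_Diff_subset[OF _ sub] by simp
    moreover have "card A \<ge> 2" using card_mono[OF less.prems(1) sub] c by simp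
    moreover have "even (card B)"
    proof (rule less.hyps)
      show "card B < card A" using calculation by simp
      show "finite B" using less.prems(1) by (simp add: B_def)
      show "f y \<in> B \<and> f (f y) = y \<and> f y \<noteq> y" if "y \<in> B" for y
      proof -
        have y: "y \<in> A" "y \<noteq> x" "y \<noteq> f x" using that by (auto simp: B_def)
        then have "f y \<noteq> x" "f y \<noteq> f x"
          using less.prems(2)[OF y(1)] less.prems(2)[OF x] by metis+
        then show ?thesis using less.prems(2)[OF y(1)] by (simp add: B_def)
      qed
    qed
    ultimately show ?thesis by simp
  qed simp
qed

text \<open>There are \<open>2 * (v - 1)\<close> nodes left of a vertical edge. Those matched among
  themselves come in pairs, so an even number of edges leaves, and one crossing edge implies a
  second one.\<close>

lemma deg_vertical_ge:
  assumes m: "matching N m" and v: "1 \<le> v" "v \<le> N" "m v = 2 * N + 1 - v"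
    and u: "1 \<le> u" "u \<le> 2 * N" "sep m v u"
  shows "4 \<le> deg N m v"
proof -
  \<comment> \<open>\<open>S\<close> holds the nodes in the columns left of \<open>v\<close>, and
    \<open>C\<close> those of them joined to the other side.\<close>
  define S where "S = {1..<v} \<union> {m v<..2 * N}"
  define C where "C = {x \<in> S. m x \<notin> S}"
  have S: "finite S" "S \<subseteq> {1..2 * N}" using v by (auto simp: S_def)
  have "card S = (v - 1) + (2 * N - m v)"
    unfolding S_def using v by (subst card_Un_disjoint) auto
  then have "even (card S)" using v by simp
  moreover have "even (card {x \<in> S. m x \<in> S})"
    by (rule even_card_involution[of _ m]) (use S matchingD[OF m] in auto)
  moreover have "card S = card {x \<in> S. m x \<in> S} + card C"
    unfolding C_def using S(1) by (subst card_Un_disjoint[symmetric]) (auto intro: arg_cong[of _ _ card])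
  ultimately have "even (card C)" by simp
  have range: "1 \<le> v" "v \<le> 2 * N" using v by auto
  note V = matchingD[OF m range] and U = matchingD[OF m u(1,2)]
  have out: "x \<in> S \<longleftrightarrow> \<not> between v (m v) x" if "1 \<le> x" "x \<le> 2 * N" "x \<noteq> v" "x \<noteq> m v" for x
    using that v by (auto simp: S_def between_def)
  have nb: "\<not> between v (m v) v" "\<not> between v (m v) (m v)" by (auto simp: between_def)
  have "u \<noteq> v" "u \<noteq> m v" using u(3) nb V unfolding sep_def by auto
  then have "m u \<noteq> v" "m u \<noteq> m v" using U V by auto
  have "u \<in> C \<or> m u \<in> C"
    using u(3) out[OF u(1,2) \<open>u \<noteq> v\<close> \<open>u \<noteq> m v\<close>] out[OF U(1,2) \<open>m u \<noteq> v\<close> \<open>m u \<noteq> m v\<close>] U(3)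
    unfolding C_def sep_def by auto
  then have "C \<noteq> {}" by blast
  moreover have fC: "finite C" using S(1) by (simp add: C_def)
  ultimately have "2 \<le> card C"
    using \<open>even (card C)\<close> by (metis One_nat_def Suc_1 card_gt_0_iff dvd_imp_le)
  have CD: "x \<in> C \<Longrightarrow> x \<in> S \<and> m x \<notin> S \<and> 1 \<le> x \<and> x \<le> 2 * N" for x
    using S(2) by (auto simp: C_def)
  have inj: "inj_on m C"
    by (rule inj_on_inverseI[of _ m]) (use CD matchingD(3)[OF m] in blast)
  have disj: "C \<inter> m ` C = {}" using CD by blast
  have "card (C \<union> m ` C) = 2 * card C"
    using card_Un_disjoint[OF fC _ disj] fC card_image[OF inj] by simp
  moreover have sepC: "sep m v x" if "x \<in> C" for x
  proof -
    note x = CD[OF that]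
    have "x \<noteq> v" "x \<noteq> m v" using x v by (auto simp: S_def)
    moreover from this have "m x \<noteq> v" "m x \<noteq> m v" using x V matchingD(3)[OF m, of x] by auto
    moreover have "1 \<le> m x" "m x \<le> 2 * N" using x matchingD[OF m] by auto
    ultimately show ?thesis using out[of x] out[of "m x"] x unfolding sep_def by blast
  qed
  have "C \<union> m ` C \<subseteq> {x\<in>{1..2 * N}. sep m v x}"
    using sepC CD matchingD[OF m] sep_mate2[OF m] by auto
  then have "card (C \<union> m ` C) \<le> card {x\<in>{1..2 * N}. sep m v x}"
    by (intro card_mono) auto
  ultimately show ?thesis unfolding deg_card using \<open>2 \<le> card C\<close> by linarith
qed

text \<open>Each of the two edges loses 2 at both ends. A slanted edge loses a unit of width along
  with the crossing. A vertical edge gets width 1, but by parity a degree of at least 2 remains, so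
  the maximum is still the degree.\<close>

lemma potential_act_T_drop:
  assumes m: "matching N m" and i: "1 \<le> i" "Suc i \<le> N" and ne: "m i \<noteq> Suc i"
    and left: "i \<le> col N (m i)" and right: "col N (m (Suc i)) \<le> Suc i"
    and nv: "\<not> (col N (m i) = i \<and> col N (m (Suc i)) = Suc i)"
  shows "potential N (act (T i) m) + 8 \<le> potential N m"
proof -
  let ?X = "act (T i) m" and ?t = "transpose i (Suc i)"
  have r: "1 \<le> i" "i \<le> 2 * N" "1 \<le> Suc i" "Suc i \<le> 2 * N" using i by auto
  note I = matchingD[OF m r(1,2)] and J = matchingD[OF m r(3,4)]
  have X: "matching N ?X" using matching_act[OF m, of "T i"] i by simp
  have mi: "m (Suc i) \<noteq> i" "m i \<noteq> m (Suc i)" using ne I J by force+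
  have b: "Suc i < m i" using left I ne i by (auto simp: col_def split: if_splits)
  \<comment> \<open>If both far ends are lower nodes, avoiding a crossing would need exactly the
    columns \<open>i\<close> and \<open>Suc i\<close>, which \<open>nv\<close> excludes.\<close>
  have c: "m (Suc i) < i \<or> m i < m (Suc i)"
    using right left nv mi J I i by (auto simp: col_def split: if_splits)
  have sep: "sep m i (Suc i)" using b c by (auto simp: sep_def between_def)
  then have sep': "sep m (Suc i) i" using sep_commute[OF m r(1,2,3,4)] by simp
  have ti: "?t i = Suc i" "?t (Suc i) = i" "?t (m i) = m i" "?t (m (Suc i)) = m (Suc i)"
    using I J ne mi by (auto simp: transpose_def)
  have Xe: "?X (Suc i) = m i" "?X i = m (Suc i)" using ti by auto
  have d: "deg N ?X (Suc i) = deg N m i - 2" "deg N ?X i = deg N m (Suc i) - 2"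
    using deg_act_T(2)[OF m i ne r(1,2)] deg_act_T(2)[OF m i ne r(3,4)] sep ti by (simp_all del: act.simps)
  have "cost N ?X (Suc i) \<le> cost N m i - 2"
  proof (cases "col N (m i) = i")
    case True
    then have "m i = 2 * N + 1 - i" using b I by (auto simp: col_def split: if_splits)
    then have "4 \<le> deg N m i" using deg_vertical_ge[OF m i(1) _ _ r(3,4) sep] i by simp
    moreover have "width N ?X (Suc i) = 1"
      unfolding width_def Xe True using i by (simp add: col_def)
    ultimately show ?thesis using d unfolding cost_def by linarith
  next
    case False
    then have "width N ?X (Suc i) = width N m i - 1"
      using left i unfolding width_def Xe by (simp add: col_def[of N i] col_def[of N "Suc i"])
    then show ?thesis using d unfolding cost_def by linarith
  qed
  moreover have "cost N ?X i \<le> cost N m (Suc i) - 2"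
  proof (cases "col N (m (Suc i)) = Suc i")
    case True
    then have "m (Suc i) = 2 * N + 1 - Suc i" using J by (auto simp: col_def split: if_splits)
    then have "4 \<le> deg N m (Suc i)" using deg_vertical_ge[OF m r(3) i(2) _ r(1,2) sep'] by simp
    moreover have "width N ?X (i) = 1"
      unfolding width_def Xe True using i by (simp add: col_def)
    ultimately show ?thesis using d unfolding cost_def by linarith
  next
    case False
    then have "width N ?X i = width N m (Suc i) - 1"
      using right i unfolding width_def Xe by (simp add: col_def[of N i] col_def[of N "Suc i"])
    then show ?thesis using d unfolding cost_def by linarith
  qed
  moreover have "cost N ?X (m i) = cost N ?X (Suc i)" "cost N ?X (m (Suc i)) = cost N ?X i"
    using cost_mate(3)[OF X r(1,2)] cost_mate(3)[OF X r(3,4)] unfolding Xe by simp_all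
  moreover have "cost N m (m i) = cost N m i" "cost N m (m (Suc i)) = cost N m (Suc i)"
    using cost_mate(3)[OF m r(1,2)] cost_mate(3)[OF m r(3,4)] by simp_all
  moreover have "(\<Sum>v\<in>{i, Suc i, m i, m (Suc i)}. cost N ?X (?t v) - cost N m v) =
      (cost N ?X (Suc i) - cost N m i) + (cost N ?X i - cost N m (Suc i)) +
      (cost N ?X (m i) - cost N m (m i)) + (cost N ?X (m (Suc i)) - cost N m (m (Suc i)))"
    using ti ne mi I J by (subst sum.insert; simp del: act.simps)+
  ultimately show ?thesis using potential_act_T_split[OF m i ne] by linarith
qed

section \<open>Composition with a U-prime\<close>

context
  fixes N i a b :: nat and m :: "nat \<Rightarrow> nat"
  assumes m: "matching N m" and i: "1 \<le> i" "Suc i \<le> N"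
    and a: "m i = a" and b: "m (Suc i) = b" and ne: "a \<noteq> Suc i"
begin

lemma nodes_act_U:
  shows "distinct [a, b, i, Suc i]" "{a, b, i, Suc i} \<subseteq> {1..2 * N}" "m a = i" "m b = Suc i"
    "act (U i) m = repair a b i (Suc i) m"
proof -
  have r: "1 \<le> i" "i \<le> 2 * N" "1 \<le> Suc i" "Suc i \<le> 2 * N" using i by auto
  note I = matchingD[OF m r(1,2)] and J = matchingD[OF m r(3,4)]
  have "b \<noteq> i" "a \<noteq> b" using ne I J a b by force+
  then show "distinct [a, b, i, Suc i]" using I J ne a b by auto
  show "{a, b, i, Suc i} \<subseteq> {1..2 * N}" "m a = i" "m b = Suc i"
    "act (U i) m = repair a b i (Suc i) m"
    using I J a b r by (auto simp: act.simps(2))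
qed

lemma act_U_apply:
  shows "act (U i) m a = b" "act (U i) m b = a" "act (U i) m i = Suc i" "act (U i) m (Suc i) = i"
    "x \<notin> {a, b, i, Suc i} \<Longrightarrow> act (U i) m x = m x"
  unfolding nodes_act_U(5) by (rule repair_simps[OF nodes_act_U(1)]; assumption?)+

lemma mate_act_U_other:
  assumes "1 \<le> g" "g \<le> 2 * N" "g \<notin> {a, b, i, Suc i}"
  shows "m g \<notin> {a, b, i, Suc i}"
  using assms matchingD(3)[OF m assms(1,2)] nodes_act_U(3,4) a b by auto

lemma between_Suc:
  assumes "g \<notin> {i, Suc i}" "h \<notin> {i, Suc i}"
  shows "between g h (Suc i) \<longleftrightarrow> between g h i"
  using assms by (auto simp: between_def)

text \<open>Modulo 2, the merged edge crosses the edge at \<open>g\<close> as often as the two old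
  edges together. So the count is kept if \<open>g\<close> crosses at most one of them, and
  otherwise two crossings disappear.\<close>

lemma deg_act_U_other:
  assumes g: "1 \<le> g" "g \<le> 2 * N" "g \<notin> {a, b, i, Suc i}"
  shows "deg N (act (U i) m) g \<le> deg N m g"
    and "\<not> (sep m g i \<and> sep m g (Suc i)) \<Longrightarrow> deg N (act (U i) m) g = deg N m g"
proof -
  let ?X = "act (U i) m" and ?S = "{a, b, i, Suc i}"
  note mg = mate_act_U_other[OF g]
  have Xg: "?X g = m g" using g by (simp add: act_U_apply(5))
  let ?f = "\<lambda>x. between g (m g) x"
  have fi: "?f (Suc i) = ?f i" using g(3) mg by (intro between_Suc) auto
  have sX: "sep ?X g a = (?f a \<noteq> ?f b)" "sep ?X g b = (?f a \<noteq> ?f b)" "sep ?X g i = False" "sep ?X g (Suc i) = False"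
    using fi unfolding sep_def Xg act_U_apply(1-4) by auto
  have sm: "sep m g a = (?f a \<noteq> ?f i)" "sep m g b = (?f b \<noteq> ?f i)" "sep m g i = (?f a \<noteq> ?f i)" "sep m g (Suc i) = (?f b \<noteq> ?f i)"
    using fi unfolding sep_def a b nodes_act_U(3,4) by auto
  have rest: "(\<Sum>u\<in>{1..2 * N} - ?S. of_bool (sep ?X g u)) = (\<Sum>u\<in>{1..2 * N} - ?S. of_bool (sep m g u))"
    by (rule sum.cong[OF refl]) (simp add: sep_def Xg act_U_apply(5))
  have split: "deg N h g = of_bool (sep h g a) + of_bool (sep h g b) + of_bool (sep h g i) + of_bool (sep h g (Suc i))
      + (\<Sum>u\<in>{1..2 * N} - ?S. of_bool (sep h g u))" for h
    unfolding deg_def by (rule sum_split4[OF _ nodes_act_U(2,1)]) simp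
  show "deg N ?X g \<le> deg N m g" unfolding split rest sX sm by simp
  show "deg N ?X g = deg N m g" if "\<not> (sep m g i \<and> sep m g (Suc i))"
    using that unfolding split rest sX sm by auto
qed

text \<open>The merged edge can be drawn along the two old edges and the gap between the adjacent
  positions \<open>i\<close> and \<open>Suc i\<close>, where no other edge ends. So whatever crosses
  it crosses one of the old edges.\<close>

lemma deg_act_U_merged: "deg N (act (U i) m) a \<le> deg N m i + deg N m (Suc i)"
proof -
  let ?X = "act (U i) m"
  note d = nodes_act_U(1)
  have iff: "between p q u \<longleftrightarrow> (p < u) \<noteq> (q < u)" if "u \<noteq> p" "u \<noteq> q" for p q u :: nat
    using that by (auto simp: between_def)
  have imp: "sep m i u \<or> sep m (Suc i) u" if u: "1 \<le> u" "u \<le> 2 * N" and s: "sep ?X a u" for u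
  proof (cases "u \<in> {a, b, i, Suc i}")
    case True
    have e: "between a b (Suc i) \<longleftrightarrow> between a b i"
      using d by (intro between_Suc) auto
    have "sep ?X a a = False" "sep ?X a b = False" "sep ?X a i = False" "sep ?X a (Suc i) = False"
      unfolding sep_def act_U_apply(1-4) e by (simp_all add: between_def)
    then show ?thesis using s True by blast
  next
    case False
    note mu = mate_act_U_other[OF u False]
    have split: "between a b x \<longleftrightarrow> between i a x \<noteq> between (Suc i) b x" if "x \<notin> {a, b, i, Suc i}" for x
    proof -
      have "i < x \<longleftrightarrow> Suc i < x" using that by auto
      then show ?thesis using that by (auto simp: iff)
    qed
    have Xu: "?X u = m u" using False by (simp add: act_U_apply(5))
    show ?thesis
      using s unfolding sep_def act_U_apply(1) Xu a b split[OF False] split[OF mu] by auto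
  qed
  have "deg N ?X a \<le> (\<Sum>u\<in>{1..2 * N}. of_bool (sep m i u) + of_bool (sep m (Suc i) u))"
    unfolding deg_def by (rule sum_mono) (use imp in \<open>auto\<close>)
  then show ?thesis unfolding deg_def sum.distrib .
qed

text \<open>The constant 4 belongs to the new cup: nothing crosses an edge between adjacent
  positions, so each of its ends costs 2 for width 1.\<close>

lemma potential_act_U_split:
  shows "potential N (act (U i) m) = 2 * cost N (act (U i) m) a + 4
      + (\<Sum>g\<in>{1..2 * N} - {a, b, i, Suc i}. cost N (act (U i) m) g)"
    and "potential N m = 2 * cost N m i + 2 * cost N m (Suc i)
      + (\<Sum>g\<in>{1..2 * N} - {a, b, i, Suc i}. cost N m g)"
    and "g \<in> {1..2 * N} - {a, b, i, Suc i} \<Longrightarrow> width N (act (U i) m) g = width N m g"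
proof -
  let ?X = "act (U i) m"
  have X: "matching N ?X" using matching_act[OF m, of "U i"] i by simp
  have r: "1 \<le> i" "i \<le> 2 * N" "1 \<le> Suc i" "Suc i \<le> 2 * N" "1 \<le> a" "a \<le> 2 * N"
    using i nodes_act_U(2) by auto
  have split: "potential N h = cost N h a + cost N h b + cost N h i + cost N h (Suc i)
      + (\<Sum>u\<in>{1..2 * N} - {a, b, i, Suc i}. cost N h u)" for h
    unfolding potential_def by (rule sum_split4[OF _ nodes_act_U(2,1)]) simp
  have "deg N ?X i = 0"
    unfolding deg_def by (rule sum.neutral) (auto simp: sep_def act_U_apply between_def)
  moreover have "width N ?X i = 1"
    using i by (simp add: width_def act_U_apply col_def)
  ultimately have "cost N ?X i = 2" by (simp add: cost_def)
  then show "potential N ?X = 2 * cost N ?X a + 4 + (\<Sum>g\<in>{1..2 * N} - {a, b, i, Suc i}. cost N ?X g)"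
    using cost_mate(3)[OF X r(1,2)] cost_mate(3)[OF X r(5,6)] unfolding split act_U_apply by simp
  show "potential N m = 2 * cost N m i + 2 * cost N m (Suc i) + (\<Sum>g\<in>{1..2 * N} - {a, b, i, Suc i}. cost N m g)"
    using cost_mate(3)[OF m r(1,2)] cost_mate(3)[OF m r(3,4)] unfolding split a b by simp
  show "width N ?X g = width N m g" if "g \<in> {1..2 * N} - {a, b, i, Suc i}"
    using that by (simp add: width_def act_U_apply(5))
qed

text \<open>Joining \<open>a\<close> with \<open>b\<close> needs at most one extra unit of width for
  the gap between the columns \<open>i\<close> and \<open>Suc i\<close>, that is 2 at each end; the
  cup adds the other 4.\<close>

lemma potential_act_U_increase: "potential N (act (U i) m) \<le> potential N m + 8"
proof -
  let ?X = "act (U i) m"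
  have "(\<Sum>g\<in>{1..2 * N} - {a, b, i, Suc i}. cost N ?X g) \<le> (\<Sum>g\<in>{1..2 * N} - {a, b, i, Suc i}. cost N m g)"
  proof (rule sum_mono)
    fix g assume g: "g \<in> {1..2 * N} - {a, b, i, Suc i}"
    then have "deg N ?X g \<le> deg N m g" by (intro deg_act_U_other(1)) auto
    then show "cost N ?X g \<le> cost N m g" unfolding cost_def potential_act_U_split(3)[OF g] by linarith
  qed
  moreover have "cost N ?X a \<le> cost N m i + cost N m (Suc i) + 2"
  proof -
    have "width N ?X a = \<bar>int (col N a) - int (col N b)\<bar>"
      "width N m i = \<bar>int i - int (col N a)\<bar>" "width N m (Suc i) = \<bar>int i + 1 - int (col N b)\<bar>"
      using i unfolding width_def act_U_apply a b by (auto simp: col_def[of N i] col_def[of N "Suc i"])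
    then have "width N ?X a \<le> width N m i + width N m (Suc i) + 1" by linarith
    then show ?thesis using deg_act_U_merged unfolding cost_def by linarith
  qed
  ultimately show ?thesis unfolding potential_act_U_split by linarith
qed

text \<open>The case of equality: no crossing is lost, the width dominates in both old edges, and
  these lie on opposite sides of the gap, so that their widths add up. The greedy step applies it to
  the diagram in which the cup is undone.\<close>

lemma potential_act_U_drop:
  assumes sep: "\<And>g. 1 \<le> g \<Longrightarrow> g \<le> 2 * N \<Longrightarrow> g \<notin> {a, b, i, Suc i} \<Longrightarrow> \<not> (sep m g i \<and> sep m g (Suc i))"
    and deg: "deg N m i \<le> 2 * width N m i" "deg N m (Suc i) \<le> 2 * width N m (Suc i)"
    and cols: "col N a \<le> i" "Suc i \<le> col N b"
  shows "potential N m + 8 \<le> potential N (act (U i) m)"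
proof -
  let ?X = "act (U i) m"
  have "(\<Sum>g\<in>{1..2 * N} - {a, b, i, Suc i}. cost N ?X g) = (\<Sum>g\<in>{1..2 * N} - {a, b, i, Suc i}. cost N m g)"
  proof (rule sum.cong[OF refl])
    fix g assume g: "g \<in> {1..2 * N} - {a, b, i, Suc i}"
    then have "deg N ?X g = deg N m g" using sep by (intro deg_act_U_other(2)) auto
    then show "cost N ?X g = cost N m g" unfolding cost_def potential_act_U_split(3)[OF g] by linarith
  qed
  moreover have "width N ?X a = width N m i + width N m (Suc i) + 1"
    using i cols unfolding width_def act_U_apply a b by (auto simp: col_def[of N i] col_def[of N "Suc i"])
  then have "cost N m i + cost N m (Suc i) + 2 \<le> cost N ?X a"
    using deg unfolding cost_def by linarith
  ultimately show ?thesis unfolding potential_act_U_split by linarith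
qed

end

section \<open>The greedy step\<close>

text \<open>For a permutation diagram this forces the far end of \<open>i\<close> to lie right of
  the far end of \<open>Suc i\<close>, a descent in the usual sense. An edge joining
  \<open>i\<close> and \<open>Suc i\<close> qualifies as well.\<close>

definition descent :: "nat \<Rightarrow> (nat \<Rightarrow> nat) \<Rightarrow> nat \<Rightarrow> bool" where
  "descent N m i \<longleftrightarrow> i \<le> col N (m i) \<and> col N (m (Suc i)) \<le> Suc i \<and>
     \<not> (col N (m i) = i \<and> col N (m (Suc i)) = Suc i)"

text \<open>Node 1 cannot go left. If \<open>n\<close> does not go left and is no descent, then
  \<open>Suc n\<close> goes right or both are vertical, so \<open>Suc n\<close> does not go left
  either.\<close>

lemma col_mate_ge:
  assumes m: "matching N m" and nd: "\<And>j. 1 \<le> j \<Longrightarrow> j < i \<Longrightarrow> \<not> descent N m j"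
    and i: "i \<le> N" and c: "1 \<le> c" "c \<le> i"
  shows "c \<le> col N (m c)"
  using c
proof (induction c rule: nat_induct_at_least)
  case base
  have "1 \<le> m 1" "m 1 \<le> 2 * N" using matchingD[OF m, of 1] base i by auto
  then show ?case by (auto simp: col_def)
next
  case (Suc n)
  then show ?case using nd[of n] by (auto simp: descent_def)
qed

text \<open>An edge joining two nodes left of \<open>i\<close> would go left as seen from its right
  end, against \<open>col_mate_ge\<close>.\<close>

lemma mate_gt:
  assumes m: "matching N m" and nd: "\<And>j. 1 \<le> j \<Longrightarrow> j < i \<Longrightarrow> \<not> descent N m j"
    and i: "Suc i \<le> N" "m i = Suc i" and c: "1 \<le> c" "c < i"
  shows "Suc i < m c"
proof -
  have c': "1 \<le> c" "c \<le> 2 * N" using c i by auto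
  note C = matchingD[OF m c']
  have i': "1 \<le> i" "i \<le> 2 * N" using c i by auto
  have "m c \<noteq> i" "m c \<noteq> Suc i" using matching_eq_iff[OF m c' i'] i c C by auto
  moreover have "\<not> m c < i"
  proof
    assume l: "m c < i"
    then have "m c \<le> col N (m (m c))" using col_mate_ge[OF m nd, of i "m c"] C i by auto
    moreover have "c \<le> col N (m c)" using col_mate_ge[OF m nd, of i c] c i by auto
    ultimately show False using C l c i by (auto simp: col_def)
  qed
  ultimately show ?thesis by linarith
qed

text \<open>Nothing goes left, so node \<open>N\<close> is vertical; without descents verticality
  passes from \<open>Suc c\<close> to \<open>c\<close>. Hence the loop can only stop at the
  identity.\<close>

lemma no_descent_identity:
  assumes m: "matching N m" and nd: "\<And>j. 1 \<le> j \<Longrightarrow> j < N \<Longrightarrow> \<not> descent N m j"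
    and q: "1 \<le> q" "q \<le> 2 * N"
  shows "m q = 2 * N + 1 - q"
proof -
  have ge: "c \<le> col N (m c)" if "1 \<le> c" "c \<le> N" for c
    using col_mate_ge[OF m nd, of N c] that by simp
  have le: "col N p \<le> N" if "1 \<le> p" "p \<le> 2 * N" for p using that by (auto simp: col_def)
  have eq: "col N (m c) = c" if "1 \<le> c" "c \<le> N" for c
    using that
  proof (induction "N - c" arbitrary: c rule: less_induct)
    case less
    show ?case
    proof (cases "c = N")
      case True
      then show ?thesis using ge[of N] less.prems le[of "m N"] matchingD[OF m, of N] by auto
    next
      case False
      then have "col N (m (Suc c)) = Suc c" using less by auto
      then show ?thesis using nd[of c] less.prems False ge[of c] by (auto simp: descent_def)
    qed
  qed
  have up: "m c = 2 * N + 1 - c" if "1 \<le> c" "c \<le> N" for c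
    using eq[OF that] matchingD[OF m, of c] that by (auto simp: col_def split: if_splits)
  show ?thesis
  proof (cases "q \<le> N")
    case False
    then have "m (2 * N + 1 - q) = q" using up[of "2 * N + 1 - q"] q by auto
    then show ?thesis using matchingD(3)[OF m, of "2 * N + 1 - q"] q False by auto
  qed (use up q in auto)
qed

section \<open>Undoing a cup by rerouting one edge through the nodes i and i + 1\<close>

context
  fixes N i q v :: nat and x :: "nat \<Rightarrow> nat"
  assumes x: "matching N x" and i: "1 \<le> i" "Suc i \<le> N" and cup: "x i = Suc i"
    and left: "\<And>c. 1 \<le> c \<Longrightarrow> c < i \<Longrightarrow> Suc i < x c"
    and q: "Suc i < q" "q \<le> 2 * N" "Suc i < x q"
    and beyond: "\<And>p. q < p \<Longrightarrow> p \<le> 2 * N \<Longrightarrow> x p < i"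
    and v: "v \<le> x q" "\<And>c. 1 \<le> c \<Longrightarrow> c < i \<Longrightarrow> v \<le> x c"
    and v_cases: "v = x q \<or> (\<exists>c. 1 \<le> c \<and> c < i \<and> v = x c)"
begin

text \<open>\<open>q\<close> is the last position not joined to a node left of \<open>i\<close>, and
  \<open>v\<close> is the earliest far end among the edge of \<open>q\<close> and the edges from the
  left of \<open>i\<close>. The edge between \<open>x v\<close> and \<open>v\<close> is cut and its
  ends are attached to \<open>i\<close> and \<open>Suc i\<close>.\<close>

private abbreviation (input) "y \<equiv> repair i (x v) (Suc i) v x"

lemma uncup_nodes:
  shows "1 \<le> v" "v \<le> 2 * N" "Suc i < v" "v < q" "x (x v) = v" "distinct [i, x v, Suc i, v]"
    "x v = q \<and> v = x q \<or> 1 \<le> x v \<and> x v < i" "x q < q"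
    "1 \<le> x v" "x v \<le> 2 * N"
proof -
  have i': "1 \<le> i" "i \<le> 2 * N" using i by auto
  have q': "1 \<le> q" "q \<le> 2 * N" using q by auto
  note Q = matchingD[OF x q']
  \<comment> \<open>If \<open>x q\<close> came after \<open>q\<close>, then \<open>beyond\<close>
    would join it to a node left of \<open>i\<close>, but its mate is \<open>q\<close>.\<close>
  show xq: "x q < q" using beyond[of "x q"] Q q by force
  then show vq: "v < q" using v by linarith
  show vi: "Suc i < v" using v_cases q(3) left by auto
  show r: "1 \<le> v" "v \<le> 2 * N" using vi vq q by auto
  show V: "x (x v) = v" "1 \<le> x v" "x v \<le> 2 * N" using matchingD[OF x r] by auto
  have "x v \<noteq> i" using V cup vi by force
  moreover have "x v \<noteq> Suc i" using V cup vi matchingD(3)[OF x i'] by force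
  ultimately show "distinct [i, x v, Suc i, v]" using vi matchingD(4)[OF x r] by auto
  show "x v = q \<and> v = x q \<or> 1 \<le> x v \<and> x v < i"
    using v_cases Q matchingD(3)[OF x] i by auto
qed

lemma uncup_apply:
  shows "y i = x v" "y (x v) = i" "y (Suc i) = v" "y v = Suc i"
    "p \<notin> {i, x v, Suc i, v} \<Longrightarrow> y p = x p"
  by (rule repair_simps[OF uncup_nodes(6)]; assumption?)+

lemma matching_uncup: "matching N y"
proof (rule matching_repair[OF x uncup_nodes(6)])
  show "{i, x v, Suc i, v} \<subseteq> {1..2 * N}" using uncup_nodes i by auto
  have "x (Suc i) = i" using cup matchingD(3)[OF x, of i] i by simp
  then show "x ` {i, x v, Suc i, v} \<subseteq> {i, x v, Suc i, v}" using cup uncup_nodes(5) by auto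
qed

text \<open>The U-prime rejoins the two pieces and restores the cup, so \<open>y\<close> is what
  remains after splitting off \<open>U i\<close>.\<close>

lemma act_U_uncup: "act (U i) y = x"
proof -
  have "x (Suc i) = i" using cup matchingD(3)[OF x, of i] i by simp
  moreover have "act (U i) y = repair (x v) v i (Suc i) y"
    by (simp add: act.simps(2) uncup_apply)
  moreover have "repair (x v) v i (Suc i) y = x"
  proof
    fix p
    show "repair (x v) v i (Suc i) y p = x p"
      using uncup_nodes(5,6) cup calculation(1) by (auto simp: repair_def)
  qed
  ultimately show ?thesis by simp
qed

text \<open>The positions after \<open>q\<close> inject into the \<open>i - 1\<close> nodes left of
  \<open>i\<close>. Consequently \<open>q\<close> is a lower node in one of the first
  \<open>i\<close> columns.\<close>

lemma beyond_card: "2 * N - q < i"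
proof -
  have "inj_on x {q<..2 * N}"
    by (rule inj_on_inverseI[of _ x]) (use matchingD(3)[OF x] in auto)
  then have "card {q<..2 * N} = card (x ` {q<..2 * N})" by (simp add: card_image)
  also have "\<dots> \<le> card {1..<i}"
    by (rule card_mono) (use beyond matchingD[OF x] in auto)
  finally show ?thesis using i by simp
qed

text \<open>By minimality of \<open>v\<close>, no edge from the left of \<open>i\<close> ends before
  \<open>v\<close>. So an edge crossing the left piece joins a node left of \<open>i\<close> to a
  position after \<open>v\<close> and passes around the right piece.\<close>

lemma crossing_new_left:
  assumes p: "1 \<le> p" "p \<le> 2 * N" "p \<notin> {i, x v, Suc i, v}"
    and b: "between i (x v) p" "\<not> between i (x v) (x p)"
  shows "v < p \<and> 1 \<le> x p \<and> x p < i \<or> 1 \<le> p \<and> p < i \<and> v < x p"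
proof -
  note P = matchingD[OF x p(1,2)]
  have ne: "x p \<noteq> v" "x p \<noteq> x v" "x p \<noteq> i" using P p uncup_nodes(5) cup by auto
  show ?thesis
  proof (cases "x v < i")
    case True
    then have "p < i" using b by (auto simp: between_def)
    then show ?thesis using v(2)[OF p(1)] ne p by auto
  next
    case False
    then have xv: "x v = q" "v = x q" using uncup_nodes(7) by auto
    then have "i < p" "p < q" "x p < i \<or> q < x p"
      using b ne False by (auto simp: between_def)
    moreover have "\<not> q < x p" using beyond[of "x p"] P \<open>i < p\<close> by auto
    ultimately show ?thesis using v(2)[of "x p"] P p by auto
  qed
qed

text \<open>By \<open>crossing_new_left\<close>, both ends of an edge crossing the left piece lie
  outside the interval from \<open>Suc i\<close> to \<open>v\<close>.\<close>

lemma uncup_not_both: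
  assumes g: "1 \<le> g" "g \<le> 2 * N" "g \<notin> {i, x v, Suc i, v}"
  shows "\<not> (sep y g i \<and> sep y g (Suc i))"
proof
  assume s: "sep y g i \<and> sep y g (Suc i)"
  have yg: "y g = x g" using g by (simp add: uncup_apply(5))
  note G = matchingD[OF x g(1,2)]
  have xg: "x g \<notin> {i, x v, Suc i, v}"
    using g G uncup_nodes(5) cup matchingD(3)[OF x, of i] i by auto
  have "sep y i g" "sep y (Suc i) g"
    using s i sep_commute[OF matching_uncup g(1,2), of i] sep_commute[OF matching_uncup g(1,2), of "Suc i"]
    by simp_all
  then have b: "between i (x v) g \<noteq> between i (x v) (x g)" "between (Suc i) v g \<noteq> between (Suc i) v (x g)"
    unfolding sep_def uncup_apply(1,3) yg .
  have out: "\<not> between (Suc i) v p \<and> \<not> between (Suc i) v (x p)"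
    if "1 \<le> p" "p \<le> 2 * N" "p \<notin> {i, x v, Suc i, v}" "between i (x v) p" "\<not> between i (x v) (x p)" for p
    using crossing_new_left[OF that] uncup_nodes(3) by (auto simp: between_def)
  show False
  proof (cases "between i (x v) g")
    case True
    then show False using out[OF g] b by blast
  next
    case False
    then show False using out[OF G(1,2) xg] b unfolding G(3) by blast
  qed
qed

text \<open>Normal form for counting: an edge crossing one of the pieces is untouched by the
  rerouting, and \<open>p\<close> is its end inside the piece. The premise \<open>nb\<close> rules
  out the four re-paired nodes.\<close>

lemma sep_uncup_cases:
  assumes u: "1 \<le> u" "u \<le> 2 * N" and s: "sep y w u" and w: "w \<in> {i, x v, Suc i, v}"
    and nb: "\<And>p. p \<in> {i, x v, Suc i, v} \<Longrightarrow> between w (y w) p = between w (y w) (y p)"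
  obtains p where "p = u \<or> p = x u" "1 \<le> p" "p \<le> 2 * N" "p \<notin> {i, x v, Suc i, v}"
    "between w (y w) p" "\<not> between w (y w) (x p)" "y u = x u"
proof -
  note U = matchingD[OF x u]
  have nu: "u \<notin> {i, x v, Suc i, v}"
  proof
    assume "u \<in> {i, x v, Suc i, v}"
    then show False using s nb[of u] by (simp add: sep_def)
  qed
  then have xu: "x u \<notin> {i, x v, Suc i, v}"
    using U uncup_nodes(5) cup matchingD(3)[OF x, of i] i by auto
  have yu: "y u = x u" using nu by (simp add: uncup_apply(5))
  then have "between w (y w) u \<noteq> between w (y w) (x u)" using s by (simp add: sep_def)
  then show ?thesis using that[of u] that[of "x u"] u U nu xu yu by metis
qed

text \<open>If the piece joins two upper nodes, every crossing edge has an end strictly between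
  their columns. If it leads down to \<open>q\<close>, a crossing edge starts left of
  \<open>i\<close>, where the mates of the positions after \<open>q\<close> are already
  taken.\<close>

lemma deg_uncup_left: "deg N y i \<le> 2 * width N y i"
proof -
  note V = uncup_nodes
  have nb: "between i (y i) p = between i (y i) (y p)" if "p \<in> {i, x v, Suc i, v}" for p
  proof -
    have "between i (x v) (Suc i) = between i (x v) v"
      using V beyond_card i by (auto simp: between_def)
    then show ?thesis using that by (auto simp: uncup_apply(1-4)) (auto simp: between_def)
  qed
  have yi: "y i = x v" by (rule uncup_apply(1))
  show ?thesis
  proof (cases "x v < i")
    case True
    have "deg N y i \<le> 2 * int (card {x v<..<i})"
    proof (rule deg_le_card[OF matching_uncup])
      fix u assume u: "1 \<le> u" "u \<le> 2 * N" "sep y i u"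
      have i4: "i \<in> {i, x v, Suc i, v}" by simp
      obtain p where p: "p = u \<or> p = x u" "between i (y i) p" "y u = x u"
        using sep_uncup_cases[OF u i4 nb] by blast
      then have "p \<in> {x v<..<i}" using True by (auto simp: yi between_def)
      then show "u \<in> {x v<..<i} \<or> y u \<in> {x v<..<i}" using p by auto
    qed simp
    also have "\<dots> \<le> 2 * width N y i" using True i by (auto simp: width_def yi col_def)
    finally show ?thesis .
  next
    case False
    then have xv: "x v = q" "v = x q" using V(7) by auto
    \<comment> \<open>\<open>i - 1\<close> nodes minus \<open>2 * N - q\<close> mates; as
      \<open>q\<close> lies in column \<open>2 * N + 1 - q\<close>, the difference is the width of
      the piece.\<close>
    define A where "A = {1..<i} - x ` {q<..2 * N}"
    have d: "deg N y i \<le> 2 * int (card A)"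
    proof (rule deg_le_card[OF matching_uncup])
      fix u assume u: "1 \<le> u" "u \<le> 2 * N" "sep y i u"
      have i4: "i \<in> {i, x v, Suc i, v}" by simp
      obtain p where p: "p = u \<or> p = x u" "1 \<le> p" "p \<le> 2 * N" "p \<notin> {i, x v, Suc i, v}"
          "between i (y i) p" "\<not> between i (y i) (x p)" "y u = x u"
        using sep_uncup_cases[OF u i4 nb] by blast
      have "between i q p" by (rule p(5)[unfolded yi, unfolded xv(1)])
      then have b: "i < p" "p < q" using q(1) by (auto simp: between_def)
      have "x p < i" "1 \<le> x p"
        using crossing_new_left[OF p(2-4)] p(5,6) b by (auto simp: yi)
      moreover have "x p \<notin> x ` {q<..2 * N}"
        using b matching_eq_iff(1)[OF x p(2,3)] by (auto simp: image_iff)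
      ultimately have "x p \<in> A" by (simp add: A_def)
      moreover have "x p = u \<or> x p = y u" using p(1,7) matchingD(3)[OF x u(1,2)] by auto
      ultimately show "u \<in> A \<or> y u \<in> A" by auto
    qed (simp add: A_def)
    have cA: "card A = (i - 1) - (2 * N - q)"
    proof -
      have inj: "inj_on x {q<..2 * N}"
        by (rule inj_on_inverseI[of _ x]) (use matchingD(3)[OF x] in auto)
      have "x ` {q<..2 * N} \<subseteq> {1..<i}" using beyond matchingD[OF x] by auto
      then show ?thesis unfolding A_def using card_image[OF inj] by (subst card_Diff_subset) auto
    qed
    have "width N y i = \<bar>int (col N i) - int (col N (x v))\<bar>" by (simp only: width_def yi)
    also have "\<dots> = int (card A)"
      unfolding xv(1) cA using beyond_card i q by (auto simp: col_def)
    finally show ?thesis using d by linarith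
  qed
qed

text \<open>\<open>B\<close> reserves \<open>i\<close> positions after \<open>v\<close> whose edges
  cannot cross the right piece. If the edge of \<open>q\<close> is cut, these are the
  \<open>i - 1\<close> mates of the nodes left of \<open>i\<close>, and \<open>q\<close>. Otherwise
  \<open>v\<close> is one of these mates and is dropped, and both \<open>q\<close> and
  \<open>x q\<close> are added.\<close>

lemma lower_card:
  obtains B where "B \<subseteq> {v<..2 * N}" "card B = i" "\<And>r. r \<in> B \<Longrightarrow> x r < i \<or> r = q \<or> r = x q"
proof -
  note V = uncup_nodes
  have q': "1 \<le> q" "q \<le> 2 * N" using q by auto
  have inj: "inj_on x {1..<i}"
    by (rule inj_on_inverseI[of _ x]) (use matchingD(3)[OF x] i in auto)
  have sub: "x ` {1..<i} \<subseteq> {v..2 * N}" using v(2) matchingD[OF x] i by auto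
  have from_left: "x r < i" if "r \<in> x ` {1..<i}" for r using that matchingD(3)[OF x] i by auto
  have qn: "q \<notin> x ` {1..<i}" using from_left[of q] q by auto
  show thesis
  proof (cases "x v < i")
    case False
    then have xv: "x v = q" "v = x q" using V(7) by auto
    have "v \<notin> x ` {1..<i}" using from_left[of v] False by auto
    then have "x ` {1..<i} \<subseteq> {v..2 * N} - {v}" using sub by blast
    also have "\<dots> \<subseteq> {v<..2 * N}" by auto
    finally have "insert q (x ` {1..<i}) \<subseteq> {v<..2 * N}" using V(4) q(2) by simp
    moreover have "card (insert q (x ` {1..<i})) = i"
      using card_image[OF inj] qn i by simp
    ultimately show thesis by (rule that) (use xv from_left in auto)
  next
    case True
    define C where "C = x ` ({1..<i} - {x v})"
    have CB: "C \<subseteq> x ` {1..<i}" by (auto simp: C_def)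
    have "v \<notin> C" using V matching_eq_iff(2)[OF x] i by (auto simp: C_def matchingD(3)[OF x])
    then have "C \<subseteq> {v..2 * N} - {v}" using sub CB by blast
    also have "\<dots> \<subseteq> {v<..2 * N}" by auto
    finally have C: "C \<subseteq> {v<..2 * N}" .
    have "x q \<noteq> v" using True V(5) q matchingD(3)[OF x q'] by auto
    then have xq: "v < x q" using v(1) by simp
    have nx: "x q \<notin> C" using from_left[of "x q"] CB q matchingD(3)[OF x q'] by auto
    have "card C = i - 2"
      unfolding C_def using card_image[OF inj_on_subset[OF inj, of "{1..<i} - {x v}"]] True V(9) by auto
    then have "card (insert q (insert (x q) C)) = i"
      using nx qn CB V(8) True V(9) finite_subset[OF C] by (auto simp: card_insert_if)
    moreover have "insert q (insert (x q) C) \<subseteq> {v<..2 * N}"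
      using C xq V(4) q matchingD[OF x q'] by auto
    ultimately show thesis by (intro that[of "insert q (insert (x q) C)"]) (use from_left CB in auto)
  qed
qed

text \<open>At least \<open>i\<close> positions follow \<open>v\<close>, so a lower \<open>v\<close>
  lies right of column \<open>i\<close>; an upper \<open>v\<close> exceeds \<open>Suc i\<close>
  anyway.\<close>

lemma col_v: "Suc i \<le> col N v"
proof -
  obtain B where B: "B \<subseteq> {v<..2 * N}" "card B = i" by (rule lower_card)
  then have "i \<le> 2 * N - v" using card_mono[OF _ B(1)] by simp
  then show ?thesis using uncup_nodes(3) i by (auto simp: col_def)
qed

text \<open>For an upper \<open>v\<close> the nodes strictly between bound the crossings. For a
  lower \<open>v\<close>, minimality of \<open>v\<close> prevents an edge with an end inside the
  piece from leading left of \<open>i\<close>. Its other end comes after \<open>v\<close> and avoids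
  \<open>B\<close>, which leaves \<open>2 * N - v - i\<close> positions, the width of the
  piece.\<close>

lemma deg_uncup_right: "deg N y (Suc i) \<le> 2 * width N y (Suc i)"
proof -
  note V = uncup_nodes
  have yi: "y (Suc i) = v" by (rule uncup_apply(3))
  have nb: "between (Suc i) (y (Suc i)) p = between (Suc i) (y (Suc i)) (y p)" if "p \<in> {i, x v, Suc i, v}" for p
    using that V by (auto simp: uncup_apply(1-4)) (auto simp: between_def)
  have i4: "Suc i \<in> {i, x v, Suc i, v}" by simp
  show ?thesis
  proof (cases "v \<le> N")
    case True
    have "deg N y (Suc i) \<le> 2 * int (card {Suc i<..<v})"
    proof (rule deg_le_card[OF matching_uncup])
      fix u assume u: "1 \<le> u" "u \<le> 2 * N" "sep y (Suc i) u"
      obtain p where p: "p = u \<or> p = x u" "between (Suc i) (y (Suc i)) p" "y u = x u"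
        using sep_uncup_cases[OF u i4 nb] by blast
      then have "p \<in> {Suc i<..<v}" using V(3) by (auto simp: yi between_def)
      then show "u \<in> {Suc i<..<v} \<or> y u \<in> {Suc i<..<v}" using p by auto
    qed simp
    also have "\<dots> \<le> 2 * width N y (Suc i)" using True V(3) i by (auto simp: width_def yi col_def)
    finally show ?thesis .
  next
    case False
    obtain B where B: "B \<subseteq> {v<..2 * N}" "card B = i" "\<And>r. r \<in> B \<Longrightarrow> x r < i \<or> r = q \<or> r = x q"
      by (rule lower_card) blast
    define A where "A = {v<..2 * N} - B"
    have "deg N y (Suc i) \<le> 2 * int (card A)"
    proof (rule deg_le_card[OF matching_uncup])
      fix u assume u: "1 \<le> u" "u \<le> 2 * N" "sep y (Suc i) u"
      obtain p where p: "p = u \<or> p = x u" "1 \<le> p" "p \<le> 2 * N" "p \<notin> {i, x v, Suc i, v}"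
          "between (Suc i) (y (Suc i)) p" "\<not> between (Suc i) (y (Suc i)) (x p)" "y u = x u"
        using sep_uncup_cases[OF u i4 nb] by blast
      note P = matchingD[OF x p(2,3)]
      have b: "Suc i < p" "p < v" using p(5) V(3) by (auto simp: yi between_def)
      have "x p \<noteq> i" "x p \<noteq> Suc i" "x p \<noteq> v"
        using p(4) P cup V(5) matchingD(3)[OF x, of i] i by auto
      then have "x p < i \<or> v < x p" using p(6) by (auto simp: yi between_def)
      moreover have "\<not> x p < i" using v(2)[of "x p"] P b by auto
      ultimately have "v < x p" by blast
      moreover have "x p \<notin> B"
      proof
        assume "x p \<in> B"
        then have "p < i \<or> p = x q \<or> p = q" using B(3)[of "x p"] P matchingD(3)[OF x, of q] q by auto
        then show False using b v(1) V(4) by auto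
      qed
      ultimately have "x p \<in> A" using P by (simp add: A_def)
      moreover have "x p = u \<or> x p = y u" using p(1,7) matchingD(3)[OF x u(1,2)] by auto
      ultimately show "u \<in> A \<or> y u \<in> A" by auto
    qed (simp add: A_def)
    moreover have "card A = 2 * N - v - i"
      unfolding A_def using B(1,2) finite_subset[OF B(1)] by (subst card_Diff_subset) auto
    ultimately show ?thesis
      using col_v False i by (auto simp: width_def yi col_def)
  qed
qed

lemma potential_uncup: "potential N y + 8 \<le> potential N x"
proof -
  have "potential N y + 8 \<le> potential N (act (U i) y)"
  proof (rule potential_act_U_drop[OF matching_uncup i uncup_apply(1,3)])
    show "x v \<noteq> Suc i" using uncup_nodes(6) by auto
    show "\<not> (sep y g i \<and> sep y g (Suc i))" if "1 \<le> g" "g \<le> 2 * N" "g \<notin> {x v, v, i, Suc i}" for g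
      using uncup_not_both[of g] that by blast
    show "col N (x v) \<le> i"
      using uncup_nodes(7) beyond_card q i by (auto simp: col_def)
  qed (rule deg_uncup_left deg_uncup_right col_v)+
  then show ?thesis unfolding act_U_uncup .
qed

end

section \<open>Composition of tangles\<close>

definition node_at :: "nat \<Rightarrow> nat \<Rightarrow> node" where
  "node_at N q = (if q \<le> N then Upper q else Lower (2 * N + 1 - q))"

definition edge_at :: "nat \<Rightarrow> (nat \<Rightarrow> nat) \<Rightarrow> nat \<Rightarrow> node set" where
  "edge_at N m q = {node_at N q, node_at N (m q)}"

definition tangle_of :: "nat \<Rightarrow> (nat \<Rightarrow> nat) \<Rightarrow> tangle" where
  "tangle_of N m = edge_at N m ` {1..2 * N}"

lemma node_at_in: "1 \<le> q \<Longrightarrow> q \<le> 2 * N \<Longrightarrow> node_at N q \<in> nodes N"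
  by (auto simp: node_at_def nodes_def image_iff)

lemma pos_node_at: "1 \<le> q \<Longrightarrow> q \<le> 2 * N \<Longrightarrow> pos N (node_at N q) = q"
  by (auto simp: node_at_def)

lemma node_at_pos: "u \<in> nodes N \<Longrightarrow> node_at N (pos N u) = u \<and> 1 \<le> pos N u \<and> pos N u \<le> 2 * N"
  by (auto simp: node_at_def nodes_def)

lemma node_at_inj:
  assumes "1 \<le> p" "p \<le> 2 * N" "1 \<le> q" "q \<le> 2 * N"
  shows "node_at N p = node_at N q \<longleftrightarrow> p = q"
  using assms pos_node_at by metis

lemma edge_at_mate: "matching N m \<Longrightarrow> 1 \<le> q \<Longrightarrow> q \<le> 2 * N \<Longrightarrow> edge_at N m (m q) = edge_at N m q"
  by (auto simp: edge_at_def matchingD(3))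

lemma in_tangle_of:
  assumes "matching N m"
  shows "{u, v} \<in> tangle_of N m \<longleftrightarrow> (\<exists>q. 1 \<le> q \<and> q \<le> 2 * N \<and> u = node_at N q \<and> v = node_at N (m q))"
proof
  assume "{u, v} \<in> tangle_of N m"
  then obtain q where q: "1 \<le> q" "q \<le> 2 * N" "{u, v} = {node_at N q, node_at N (m q)}"
    by (auto simp: tangle_of_def edge_at_def)
  then consider "u = node_at N q" "v = node_at N (m q)" | "u = node_at N (m q)" "v = node_at N q"
    by (auto simp: doubleton_eq_iff)
  then show "\<exists>q. 1 \<le> q \<and> q \<le> 2 * N \<and> u = node_at N q \<and> v = node_at N (m q)"
  proof cases
    case 1
    then show ?thesis using q by blast
  next
    case 2
    then show ?thesis using matchingD[OF assms q(1,2)] by (intro exI[of _ "m q"]) simp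
  qed
qed (auto simp: tangle_of_def edge_at_def)

lemma tangle_of_inj:
  assumes m: "matching N m" and m': "matching N m'" and eq: "tangle_of N m = tangle_of N m'"
    and q: "1 \<le> q" "q \<le> 2 * N"
  shows "m' q = m q"
proof -
  have "{node_at N q, node_at N (m q)} \<in> tangle_of N m"
    unfolding in_tangle_of[OF m] using q by blast
  then obtain p where p: "1 \<le> p" "p \<le> 2 * N" "node_at N q = node_at N p" "node_at N (m q) = node_at N (m' p)"
    unfolding eq in_tangle_of[OF m'] by blast
  then have "p = q" using node_at_inj q by simp
  then show ?thesis using p(4) node_at_inj matchingD[OF m q] matchingD[OF m' q] by simp
qed

lemma tangle_of_cong:
  assumes "\<And>q. 1 \<le> q \<Longrightarrow> q \<le> 2 * N \<Longrightarrow> m' q = m q"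
  shows "tangle_of N m' = tangle_of N m"
  using assms by (auto simp: tangle_of_def edge_at_def intro!: image_cong)

lemma tangle_of_identity: "tangle_of N (\<lambda>q. 2 * N + 1 - q) = id_tangle N"
proof -
  have "edge_at N (\<lambda>q. 2 * N + 1 - q) q = {Upper (col N q), Lower (col N q)}" if "1 \<le> q" "q \<le> 2 * N" for q
    using that by (auto simp: edge_at_def node_at_def col_def)
  then have "tangle_of N (\<lambda>q. 2 * N + 1 - q) = (\<lambda>q. {Upper (col N q), Lower (col N q)}) ` {1..2 * N}"
    unfolding tangle_of_def by (intro image_cong) auto
  also have "\<dots> = (\<lambda>j. {Upper j, Lower j}) ` (col N ` {1..2 * N})" by (simp add: image_image)
  also have "col N ` {1..2 * N} = {1..N}"
  proof
    show "{1..N} \<subseteq> col N ` {1..2 * N}"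
      by (rule subsetI, rule image_eqI[of _ "col N"]) (auto simp: col_def)
  qed (auto simp: col_def)
  finally show ?thesis by (auto simp: id_tangle_def)
qed

lemma matching_identity: "matching N (\<lambda>q. 2 * N + 1 - q)"
  by (auto simp: matching_def) presburger

lemma is_tangle_matching:
  assumes X: "is_tangle N X"
  defines "m \<equiv> \<lambda>q. pos N (partner X (node_at N q))"
  shows "matching N m" "tangle_of N m = X" "\<And>u. u \<in> nodes N \<Longrightarrow> partner X u \<in> nodes N"
proof -
  \<comment> \<open>Edges have two elements, so uniqueness of the edge at \<open>u\<close> becomes
    uniqueness of its other end, as the definite description in \<open>partner\<close>
    requires.\<close>
  have ex: "\<exists>!v. {u, v} \<in> X" and ne: "\<And>v. {u, v} \<in> X \<Longrightarrow> v \<in> nodes N \<and> v \<noteq> u" if u: "u \<in> nodes N" for u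
  proof -
    have "\<exists>!e. e \<in> X \<and> u \<in> e" using X u by (simp add: is_tangle_def)
    then obtain e where e: "e \<in> X" "u \<in> e" and uniq: "\<And>f. f \<in> X \<Longrightarrow> u \<in> f \<Longrightarrow> f = e"
      by (elim ex1E) blast
    have "e \<subseteq> nodes N" "card e = 2" using X e unfolding is_tangle_def by auto
    then obtain v where v: "e = {u, v}" "v \<noteq> u" using e(2) by (auto simp: card_2_iff)
    show "\<exists>!v. {u, v} \<in> X"
    proof
      show "{u, v} \<in> X" using e v by simp
      show "w = v" if "{u, w} \<in> X" for w using uniq[OF that] v by (auto simp: doubleton_eq_iff)
    qed
    show "w \<in> nodes N \<and> w \<noteq> u" if "{u, w} \<in> X" for w
      using uniq[OF that] v \<open>e \<subseteq> nodes N\<close> by (auto simp: doubleton_eq_iff)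
  qed
  have part: "{u, partner X u} \<in> X" if "u \<in> nodes N" for u
    unfolding partner_def by (rule theI'[OF ex[OF that]])
  have part_eq: "partner X u = v" if "u \<in> nodes N" "{u, v} \<in> X" for u v
    using ex[OF that(1)] part[OF that(1)] that(2) by blast
  show pn: "partner X u \<in> nodes N" if "u \<in> nodes N" for u
    using ne[OF that part[OF that]] by simp
  have pp: "partner X (partner X u) = u" if "u \<in> nodes N" for u
    using part_eq[OF pn[OF that], of u] part[OF that] by (simp add: insert_commute)
  have na: "node_at N (m q) = partner X (node_at N q)" if "1 \<le> q" "q \<le> 2 * N" for q
    using node_at_pos pn node_at_in[OF that] by (simp add: m_def)
  show "matching N m"
    unfolding matching_def
  proof (intro ballI conjI)
    fix q assume "q \<in> {1..2 * N}"
    then have q: "1 \<le> q" "q \<le> 2 * N" by auto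
    note n = node_at_in[OF q]
    show "m q \<in> {1..2 * N}" using node_at_pos[OF pn[OF n]] by (simp add: m_def)
    have "m (m q) = pos N (partner X (node_at N (m q)))" by (simp only: m_def)
    then show "m (m q) = q" unfolding na[OF q] pp[OF n] pos_node_at[OF q] .
    show "m q \<noteq> q"
    proof
      assume "m q = q"
      then have "partner X (node_at N q) = node_at N q" using na[OF q] by simp
      then show False using ne[OF n part[OF n]] by simp
    qed
  qed
  show "tangle_of N m = X"
  proof
    show "tangle_of N m \<subseteq> X"
      using part node_at_in by (auto simp: tangle_of_def edge_at_def na)
    show "X \<subseteq> tangle_of N m"
    proof
      fix e assume e: "e \<in> X"
      then have s: "e \<subseteq> nodes N" "card e = 2" using X unfolding is_tangle_def by auto
      then obtain u v where uv: "e = {u, v}" by (auto simp: card_2_iff)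
      then have u: "u \<in> nodes N" using s by simp
      then have "v = partner X u" using part_eq e uv by simp
      then have "e = edge_at N m (pos N u)" using node_at_pos[OF u] na by (simp add: edge_at_def uv)
      then show "e \<in> tangle_of N m" using node_at_pos[OF u] by (simp add: tangle_of_def)
    qed
  qed
qed

lemma stacked_linkI1: "{u, v} \<in> X \<Longrightarrow> (place 0 1 u, place 0 1 v) \<in> stacked_links X Y"
  unfolding stacked_links_def by blast

lemma stacked_linkI2: "{u, v} \<in> Y \<Longrightarrow> (place 1 2 u, place 1 2 v) \<in> stacked_links X Y"
  unfolding stacked_links_def by blast

lemma stacked_links_cases:
  assumes "(p, r) \<in> stacked_links X Y"
  obtains u v where "p = place 0 1 u" "r = place 0 1 v" "{u, v} \<in> X"
    | u v where "p = place 1 2 u" "r = place 1 2 v" "{u, v} \<in> Y"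
  using assms unfolding stacked_links_def by blast

lemma stacked_links_sym:
  assumes "(p, r) \<in> stacked_links X Y"
  shows "(r, p) \<in> stacked_links X Y"
  using assms
proof (cases rule: stacked_links_cases)
  case (1 u v)
  then show ?thesis using stacked_linkI1[of v u X] by (simp add: insert_commute)
next
  case (2 u v)
  then show ?thesis using stacked_linkI2[of v u Y] by (simp add: insert_commute)
qed

lemma stacked_path_sym: "(p, r) \<in> (stacked_links X Y)\<^sup>* \<Longrightarrow> (r, p) \<in> (stacked_links X Y)\<^sup>*"
  by (metis (no_types, lifting) stacked_links_sym sym_def sym_rtrancl)

lemma place_eq_place:
  "place 0 1 u = place 0 2 v \<Longrightarrow> u = v" "place 1 2 u = place 0 2 v \<Longrightarrow> u = v"
  by (cases u; cases v; auto)+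

text \<open>
  A labelling of the points of the stacked diagram that is constant along links separates the
  paths, so it suffices to connect the ends of every edge of the claimed result.
\<close>

lemma compose_eqI:
  assumes m: "matching N m"
    and nodes: "\<And>u v. {u, v} \<in> X \<union> Y \<Longrightarrow> u \<in> nodes N"
    and const: "\<And>p r. (p, r) \<in> stacked_links X Y \<Longrightarrow> cl p = cl r"
    and outer: "\<And>q. 1 \<le> q \<Longrightarrow> q \<le> 2 * N \<Longrightarrow> cl (place 0 2 (node_at N q)) = edge_at N m q"
    and conn: "\<And>q. 1 \<le> q \<Longrightarrow> q \<le> 2 * N \<Longrightarrow>
      (place 0 2 (node_at N q), place 0 2 (node_at N (m q))) \<in> (stacked_links X Y)\<^sup>*"
  shows "compose X Y = tangle_of N m"
proof
  let ?L = "stacked_links X Y"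
  have start: "u \<in> nodes N" if "(place 0 2 u, p) \<in> ?L" for u p
    using that
  proof (cases rule: stacked_links_cases)
    case (1 w v)
    then show ?thesis using place_eq_place(1)[of w u] nodes[of w v] by simp
  next
    case (2 w v)
    then show ?thesis using place_eq_place(2)[of w u] nodes[of w v] by simp
  qed
  have cl_path: "cl p = cl r" if "(p, r) \<in> ?L\<^sup>*" for p r
    using that by (induction rule: rtrancl_induct) (auto dest: const)
  show "compose X Y \<subseteq> tangle_of N m"
  proof
    fix e assume "e \<in> compose X Y"
    then obtain u v where e: "e = {u, v}" "u \<noteq> v" and path: "(place 0 2 u, place 0 2 v) \<in> ?L\<^sup>*"
      unfolding compose_def by blast
    have "place 0 2 u \<noteq> place 0 2 v" using e(2) by (cases u; cases v) auto
    then have "u \<in> nodes N" "v \<in> nodes N"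
      using path stacked_path_sym[OF path] start by (metis converse_rtranclE)+
    then obtain p r where p: "u = node_at N p" "1 \<le> p" "p \<le> 2 * N" and r: "v = node_at N r" "1 \<le> r" "r \<le> 2 * N"
      using node_at_pos by metis
    have "edge_at N m p = edge_at N m r" using cl_path[OF path] outer p r by simp
    then have "v \<in> edge_at N m p" "u \<in> edge_at N m p" using p r by (auto simp: edge_at_def)
    then have "e = edge_at N m p" using e by (auto simp: edge_at_def)
    then show "e \<in> tangle_of N m" using p by (simp add: tangle_of_def)
  qed
  show "tangle_of N m \<subseteq> compose X Y"
  proof
    fix e assume "e \<in> tangle_of N m"
    then obtain q where q: "1 \<le> q" "q \<le> 2 * N" "e = {node_at N q, node_at N (m q)}"
      by (auto simp: tangle_of_def edge_at_def)
    moreover have "node_at N q \<noteq> node_at N (m q)"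
      using node_at_inj q matchingD[OF m q(1,2)] by metis
    ultimately show "e \<in> compose X Y" unfolding compose_def using conn[OF q(1,2)] by blast
  qed
qed

text \<open>Written as a permutation diagram, the prime needs no separate treatment of its two
  crossing edges.\<close>

lemma prime_tangle_T:
  assumes "1 \<le> i" "Suc i \<le> N"
  shows "prime_tangle N (T i) = {{Upper j, Lower (transpose i (Suc i) j)} | j. 1 \<le> j \<and> j \<le> N}"
proof
  show "prime_tangle N (T i) \<subseteq> {{Upper j, Lower (transpose i (Suc i) j)} | j. 1 \<le> j \<and> j \<le> N}"
  proof
    fix e assume "e \<in> prime_tangle N (T i)"
    then consider j where "e = {Upper j, Lower j}" "1 \<le> j" "j \<le> N" "j \<noteq> i" "j \<noteq> Suc i"
      | "e = {Upper i, Lower (Suc i)}" | "e = {Upper (Suc i), Lower i}"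
      by (auto simp: id_tangle_def)
    then show "e \<in> {{Upper j, Lower (transpose i (Suc i) j)} | j. 1 \<le> j \<and> j \<le> N}"
    proof cases
      case (1 j)
      then have "e = {Upper j, Lower (transpose i (Suc i) j)}" by simp
      then show ?thesis using 1 by blast
    next
      case 2
      then have "e = {Upper i, Lower (transpose i (Suc i) i)}" by simp
      moreover have "1 \<le> i \<and> i \<le> N" using assms by simp
      ultimately show ?thesis by blast
    next
      case 3
      then have "e = {Upper (Suc i), Lower (transpose i (Suc i) (Suc i))}" by simp
      moreover have "1 \<le> Suc i \<and> Suc i \<le> N" using assms by simp
      ultimately show ?thesis by blast
    qed
  qed
  show "{{Upper j, Lower (transpose i (Suc i) j)} | j. 1 \<le> j \<and> j \<le> N} \<subseteq> prime_tangle N (T i)"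
  proof
    fix e assume "e \<in> {{Upper j, Lower (transpose i (Suc i) j)} | j. 1 \<le> j \<and> j \<le> N}"
    then obtain j where j: "e = {Upper j, Lower (transpose i (Suc i) j)}" "1 \<le> j" "j \<le> N" by blast
    consider "j = i" | "j = Suc i" | "j \<noteq> i" "j \<noteq> Suc i" by blast
    then show "e \<in> prime_tangle N (T i)"
    proof cases
      case 3
      then have "e = {Upper j, Lower j}" using j by simp
      then show ?thesis using 3 j by (auto simp: id_tangle_def doubleton_eq_iff)
    qed (use j in simp_all)
  qed
qed

lemma prime_tangle_U:
  assumes "1 \<le> i" "Suc i \<le> N"
  shows "prime_tangle N (U i) = {{Upper j, Lower j} | j. 1 \<le> j \<and> j \<le> N \<and> j \<notin> {i, Suc i}}
    \<union> {{Upper i, Upper (Suc i)}, {Lower i, Lower (Suc i)}}"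
  by (auto simp: id_tangle_def doubleton_eq_iff)

lemma in_nodes_tangle_of:
  assumes "matching N m" "{u, v} \<in> tangle_of N m"
  shows "u \<in> nodes N"
  using assms node_at_in unfolding in_tangle_of[OF assms(1)] by blast

lemma compose_T:
  assumes m: "matching N m" and i: "1 \<le> i" "Suc i \<le> N"
  shows "compose (prime_tangle N (T i)) (tangle_of N m) = tangle_of N (act (T i) m)"
proof -
  let ?t = "transpose i (Suc i)" and ?y = "act (T i) m"
  let ?L = "stacked_links (prime_tangle N (T i)) (tangle_of N m)"
  \<comment> \<open>Each point gets the edge of the result on whose path it lies: row 0 by its own
    position, row 1 through the upper node linked to it by the transposition, row 2 by the lower
    position \<open>2 * N + 1 - j\<close>.\<close>
  define cl where "cl = (\<lambda>(r, j). edge_at N ?y (if r = (0::nat) then j else if r = 1 then ?t j else 2 * N + 1 - j))"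
  have y: "matching N ?y" using matching_act[OF m, of "T i"] i by simp
  have i2: "Suc i \<le> 2 * N" using i by simp
  have t_range: "1 \<le> ?t q" "?t q \<le> 2 * N" if "1 \<le> q" "q \<le> 2 * N" for q
    using transpose_Suc_range[OF i(1) i2, of q] that by auto
  have yt: "?y (?t q) = ?t (m q)" for q by simp
  have low: "?t q = q" if "N < q" for q using that i by (auto simp: transpose_def)
  have cl_mid: "cl (place 1 2 (node_at N q)) = edge_at N ?y (?t q)" if "1 \<le> q" "q \<le> 2 * N" for q
    using that low[of q] by (auto simp: cl_def node_at_def)
  have path: "(place 0 2 (node_at N q), place 1 2 (node_at N (?t q))) \<in> ?L\<^sup>*" if q: "1 \<le> q" "q \<le> 2 * N" for q
  proof (cases "q \<le> N")
    case True
    then have "?t q \<le> N" using i by (auto simp: transpose_def)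
    moreover have "{Upper q, Lower (?t q)} \<in> prime_tangle N (T i)"
      unfolding prime_tangle_T[OF i] using q True by blast
    from stacked_linkI1[OF this] have "((0, q), (1, ?t q)) \<in> ?L" by (simp del: prime_tangle.simps)
    ultimately show ?thesis using True by (simp add: node_at_def r_into_rtrancl del: prime_tangle.simps)
  next
    case False
    then have "place 0 2 (node_at N q) = place 1 2 (node_at N (?t q))"
      using low[of q] by (simp add: node_at_def)
    then show ?thesis by simp
  qed
  show ?thesis
  proof (rule compose_eqI[OF y, where cl = cl])
    fix u v assume "{u, v} \<in> prime_tangle N (T i) \<union> tangle_of N m"
    then show "u \<in> nodes N"
    proof
      assume "{u, v} \<in> prime_tangle N (T i)"
      then obtain j where "1 \<le> j" "j \<le> N" "{u, v} = {Upper j, Lower (?t j)}"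
        unfolding prime_tangle_T[OF i] by blast
      moreover from this have "1 \<le> ?t j" "?t j \<le> N" using transpose_Suc_range[OF i, of j] by auto
      ultimately show ?thesis by (auto simp: nodes_def doubleton_eq_iff)
    qed (rule in_nodes_tangle_of[OF m])
  next
    fix p r assume "(p, r) \<in> ?L"
    then show "cl p = cl r"
    proof (cases rule: stacked_links_cases)
      case (1 u v)
      then obtain j where "{u, v} = {Upper j, Lower (?t j)}"
        unfolding prime_tangle_T[OF i] by blast
      then show ?thesis using 1(1,2) by (auto simp: doubleton_eq_iff cl_def)
    next
      case (2 u v)
      then obtain q where q: "1 \<le> q" "q \<le> 2 * N" "u = node_at N q" "v = node_at N (m q)"
        unfolding in_tangle_of[OF m] by blast
      have "edge_at N ?y (?t (m q)) = edge_at N ?y (?t q)"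
        using edge_at_mate[OF y t_range[OF q(1,2)]] unfolding yt .
      then show ?thesis using 2(1,2) q cl_mid matchingD[OF m q(1,2)] by simp
    qed
  next
    fix q assume q: "1 \<le> q" "q \<le> 2 * N"
    show "cl (place 0 2 (node_at N q)) = edge_at N ?y q"
      using q by (auto simp: cl_def node_at_def)
    have "(place 1 2 (node_at N (?t q)), place 1 2 (node_at N (m (?t q)))) \<in> ?L"
      by (rule stacked_linkI2) (use t_range[OF q] in \<open>auto simp: in_tangle_of[OF m]\<close>)
    moreover have "(place 1 2 (node_at N (m (?t q))), place 0 2 (node_at N (?y q))) \<in> ?L\<^sup>*"
    proof -
      have "1 \<le> ?y q" "?y q \<le> 2 * N" using matchingD[OF y q] by auto
      from stacked_path_sym[OF path[OF this]] show ?thesis by simp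
    qed
    ultimately show "(place 0 2 (node_at N q), place 0 2 (node_at N (?y q))) \<in> ?L\<^sup>*"
      using path[OF q] by (meson converse_rtrancl_into_rtrancl rtrancl_trans)
  qed
qed

lemma compose_U:
  assumes m: "matching N m" and i: "1 \<le> i" "Suc i \<le> N"
  shows "compose (prime_tangle N (U i)) (tangle_of N m) = tangle_of N (act (U i) m)"
proof -
  let ?y = "act (U i) m"
  let ?L = "stacked_links (prime_tangle N (U i)) (tangle_of N m)"
  define a b where "a = m i" and "b = m (Suc i)"
  \<comment> \<open>Label of the points \<open>i\<close> and \<open>Suc i\<close> of row 1. The path
    through them joins \<open>a\<close> and \<open>b\<close>; if \<open>a = Suc i\<close> they form
    an internal loop, for which any constant label will do.\<close>
  define C where "C = {node_at N a, node_at N b}"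
  define cl where "cl = (\<lambda>(r, j). if r = (1::nat) \<and> j \<in> {i, Suc i} then C
      else edge_at N ?y (if r = 2 then 2 * N + 1 - j else j))"
  have y: "matching N ?y" using matching_act[OF m, of "U i"] i by simp
  have r: "1 \<le> i" "i \<le> 2 * N" "1 \<le> Suc i" "Suc i \<le> 2 * N" using i by auto
  note I = matchingD[OF m r(1,2), folded a_def] and J = matchingD[OF m r(3,4), folded b_def]
  have yd: "?y = repair a b i (Suc i) m" by (simp add: a_def b_def act.simps(2))
  have yi: "?y i = Suc i" "?y (Suc i) = i" by (auto simp: yd repair_def)
  have yo: "?y q = m q" if "q \<notin> {a, b, i, Suc i}" for q using that by (auto simp: yd repair_def)
  have aS: "a = Suc i \<longleftrightarrow> b = i" using I J a_def b_def by auto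
  have yab: "?y a = b" "?y b = a" "a \<notin> {i, Suc i}" "b \<notin> {i, Suc i}" "a \<noteq> b" if "a \<noteq> Suc i"
    using that aS I J by (auto simp: yd repair_def)
  have cl_mid: "cl (place 1 2 (node_at N q)) = edge_at N ?y q" if "1 \<le> q" "q \<le> 2 * N" "q \<notin> {i, Suc i}" for q
    using that by (auto simp: cl_def node_at_def)
  have cl_cup: "cl (place 1 2 (node_at N q)) = C" if "q \<in> {i, Suc i}" for q
    using that i by (auto simp: cl_def node_at_def)
  have C: "edge_at N ?y a = C" "edge_at N ?y b = C" if "a \<noteq> Suc i"
    using yab[OF that] by (auto simp: edge_at_def C_def)
  have path: "(place 0 2 (node_at N q), place 1 2 (node_at N q)) \<in> ?L\<^sup>*"
    if q: "1 \<le> q" "q \<le> 2 * N" "q \<notin> {i, Suc i}" for q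
  proof (cases "q \<le> N")
    case True
    have "{Upper q, Lower q} \<in> prime_tangle N (U i)"
      unfolding prime_tangle_U[OF i] using q True by blast
    from stacked_linkI1[OF this] have "((0, q), (1, q)) \<in> ?L" by (simp del: prime_tangle.simps)
    then show ?thesis using True by (simp add: node_at_def r_into_rtrancl del: prime_tangle.simps)
  qed (simp add: node_at_def)
  have mid: "(place 1 2 (node_at N q), place 1 2 (node_at N (m q))) \<in> ?L" if "1 \<le> q" "q \<le> 2 * N" for q
    by (rule stacked_linkI2) (use that in \<open>auto simp: in_tangle_of[OF m]\<close>)
  have cup: "(place 0 2 (node_at N i), place 0 2 (node_at N (Suc i))) \<in> ?L"
      "(place 1 2 (node_at N i), place 1 2 (node_at N (Suc i))) \<in> ?L"
  proof -
    have "{Upper i, Upper (Suc i)} \<in> prime_tangle N (U i)" "{Lower i, Lower (Suc i)} \<in> prime_tangle N (U i)"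
      by auto
    from this[THEN stacked_linkI1[where Y = "tangle_of N m"]]
    show "(place 0 2 (node_at N i), place 0 2 (node_at N (Suc i))) \<in> ?L"
      "(place 1 2 (node_at N i), place 1 2 (node_at N (Suc i))) \<in> ?L"
      using i by (simp_all add: node_at_def del: prime_tangle.simps)
  qed
  show ?thesis
  proof (rule compose_eqI[OF y, where cl = cl])
    fix u v assume "{u, v} \<in> prime_tangle N (U i) \<union> tangle_of N m"
    then show "u \<in> nodes N"
    proof
      assume "{u, v} \<in> prime_tangle N (U i)"
      then show ?thesis using i unfolding prime_tangle_U[OF i] by (auto simp: nodes_def doubleton_eq_iff)
    qed (rule in_nodes_tangle_of[OF m])
  next
    fix p r assume "(p, r) \<in> ?L"
    then show "cl p = cl r"
    proof (cases rule: stacked_links_cases)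
      case (1 u v)
      from 1(3) consider j where "{u, v} = {Upper j, Lower j}" "j \<notin> {i, Suc i}"
        | "{u, v} = {Upper i, Upper (Suc i)}" | "{u, v} = {Lower i, Lower (Suc i)}"
        unfolding prime_tangle_U[OF i] by blast
      moreover have "edge_at N ?y i = edge_at N ?y (Suc i)" using yi by (auto simp: edge_at_def)
      ultimately show ?thesis
        using 1(1,2) by cases (auto simp: doubleton_eq_iff cl_def simp del: act.simps)
    next
      case (2 u v)
      then obtain q where q: "1 \<le> q" "q \<le> 2 * N" and uv: "u = node_at N q" "v = node_at N (m q)"
        unfolding in_tangle_of[OF m] by blast
      note Q = matchingD[OF m q]
      have sym: "cl (place 1 2 (node_at N p)) = cl (place 1 2 (node_at N (m p)))" if p: "p \<in> {i, Suc i}" for p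
      proof (cases "a = Suc i")
        case True
        then have "m p \<in> {i, Suc i}" using aS p unfolding a_def b_def by auto
        then show ?thesis using cl_cup p by simp
      next
        case False
        note F = yab[OF False]
        have "m p = a \<or> m p = b" using p by (auto simp: a_def b_def)
        then have "cl (place 1 2 (node_at N (m p))) = C"
          using cl_mid[OF I(1,2) F(3)] cl_mid[OF J(1,2) F(4)] C[OF False] by auto
        then show ?thesis using cl_cup[OF p] by simp
      qed
      show ?thesis
      proof (cases "q \<in> {i, Suc i} \<or> m q \<in> {i, Suc i}")
        case True
        then show ?thesis using sym[of q] sym[of "m q"] Q(3) 2(1,2) uv by auto
      next
        case False
        then have "q \<notin> {a, b, i, Suc i}" using I(3) J(3) by auto
        then have "edge_at N ?y (m q) = edge_at N ?y q"
          using edge_at_mate[OF y q] yo[of q] by simp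
        then show ?thesis using cl_mid q Q False 2(1,2) uv by simp
      qed
    qed
  next
    fix q assume q: "1 \<le> q" "q \<le> 2 * N"
    note Q = matchingD[OF m q]
    show "cl (place 0 2 (node_at N q)) = edge_at N ?y q"
      using q by (auto simp: cl_def node_at_def)
    \<comment> \<open>Go from \<open>p\<close> to the tangle below, connect to \<open>s\<close>
      there, follow the edge of \<open>s\<close>, and return to the outer points.\<close>
    have through: "(place 0 2 (node_at N p), place 0 2 (node_at N (m s))) \<in> ?L\<^sup>*"
      if "(place 1 2 (node_at N p), place 1 2 (node_at N s)) \<in> ?L\<^sup>*" "p \<notin> {i, Suc i}" "m s \<notin> {i, Suc i}"
        "1 \<le> p" "p \<le> 2 * N" "1 \<le> s" "s \<le> 2 * N" for p s
      using path[of p] mid[of s] stacked_path_sym[OF path[of "m s"]] that matchingD[OF m, of s]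
      by (meson rtrancl.rtrancl_into_rtrancl rtrancl_trans)
    show "(place 0 2 (node_at N q), place 0 2 (node_at N (?y q))) \<in> ?L\<^sup>*"
    proof (cases "q \<in> {i, Suc i}")
      case True
      then show ?thesis using cup(1) stacked_links_sym[OF cup(1)] yi by auto
    next
      case out: False
      show ?thesis
      proof (cases "q \<in> {a, b}")
        case False
        then have "m q \<notin> {i, Suc i}" using Q(3) by (auto simp: a_def b_def)
        then show ?thesis using through[of q q] out q yo[of q] False by simp
      next
        case True
        have ne: "a \<noteq> Suc i"
        proof
          assume "a = Suc i"
          then have "b = i" using aS by simp
          then show False using True out \<open>a = Suc i\<close> by auto
        qed
        note F = yab[OF ne]
        have ma: "m a = i" "m b = Suc i" using I(3) J(3) by auto
        show ?thesis
        proof (cases "q = a")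
          case True
          have "(place 1 2 (node_at N a), place 1 2 (node_at N (Suc i))) \<in> ?L\<^sup>*"
            using mid[OF I(1,2)] cup(2) unfolding ma by (meson r_into_rtrancl rtrancl.rtrancl_into_rtrancl)
          from through[OF this F(3)] F(4) I J r show ?thesis
            by (simp add: True F(1) b_def[symmetric] del: act.simps)
        next
          case False
          then have qb: "q = b" using True by simp
          have "(place 1 2 (node_at N b), place 1 2 (node_at N i)) \<in> ?L\<^sup>*"
            using mid[OF J(1,2)] stacked_links_sym[OF cup(2)] unfolding ma by (meson r_into_rtrancl rtrancl.rtrancl_into_rtrancl)
          from through[OF this F(4)] F(3) I J r show ?thesis
            by (simp add: qb F(2) a_def[symmetric] del: act.simps)
        qed
      qed
    qed
  qed
qed

section \<open>Lower bound on the length of a factorization\<close>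

lemma potential_act_le:
  assumes m: "matching N m" and p: "1 \<le> index p" "index p + 1 \<le> N"
  shows "potential N (act p m) \<le> potential N m + 8"
proof (cases p)
  case (T i)
  then show ?thesis using potential_act_T_le[OF m, of i] p by simp
next
  case (U i)
  then have i: "1 \<le> i" "Suc i \<le> N" using p by auto
  show ?thesis
  proof (cases "m i = Suc i")
    case True
    then have "m (Suc i) = i" using matchingD(3)[OF m, of i] i by simp
    then have "act (U i) m = m" using True by (auto simp: act.simps(2) repair_def)
    then show ?thesis using U by simp
  next
    case False
    then show ?thesis using potential_act_U_increase[OF m i refl refl] U by simp
  qed
qed

lemma potential_identity: "potential N (\<lambda>q. 2 * N + 1 - q) = 0"
proof -
  have "cost N (\<lambda>q. 2 * N + 1 - q) v = 0" if v: "v \<in> {1..2 * N}" for v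
  proof -
    have "\<not> sep (\<lambda>q. 2 * N + 1 - q) v u" if "u \<in> {1..2 * N}" for u
      using v that unfolding sep_def between_def by auto
    then have "deg N (\<lambda>q. 2 * N + 1 - q) v = 0" by (simp add: deg_def)
    moreover have "width N (\<lambda>q. 2 * N + 1 - q) v = 0"
      using v by (auto simp: width_def col_def)
    ultimately show ?thesis by (simp add: cost_def)
  qed
  then show ?thesis by (simp add: potential_def)
qed

lemma potential_nonneg: "0 \<le> potential N m"
  unfolding potential_def by (rule sum_nonneg) simp

text \<open>There are \<open>2 * N\<close> positions of cost at most \<open>2 * N\<close> each. With
  a drop of 8 per letter this makes the number of steps quadratic.\<close>

lemma potential_le:
  assumes m: "matching N m"
  shows "potential N m \<le> 4 * int N ^ 2"
proof -
  have "cost N m v \<le> 2 * int N" if "v \<in> {1..2 * N}" for v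
  proof -
    have "col N p \<le> N" if "1 \<le> p" "p \<le> 2 * N" for p using that by (auto simp: col_def)
    then have "col N v \<le> N" "col N (m v) \<le> N" using matchingD[OF m, of v] that by auto
    then have "width N m v \<le> int N" by (auto simp: width_def)
    moreover have "deg N m v \<le> (\<Sum>u\<in>{1..2 * N}. 1)" unfolding deg_def by (rule sum_mono) simp
    ultimately show ?thesis by (simp add: cost_def)
  qed
  then have "potential N m \<le> of_nat (card {1..2 * N}) * (2 * int N)"
    unfolding potential_def by (rule sum_bounded_above)
  then show ?thesis by (simp add: power2_eq_square)
qed

text \<open>\<open>word_tangle\<close> over an arbitrary bottom tangle: the emitted word on top of
  what remains to be factorized, which the loop keeps equal to the input tangle.\<close>

definition stack :: "nat \<Rightarrow> prime list \<Rightarrow> tangle \<Rightarrow> tangle" where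
  "stack N w X = foldr (\<lambda>p X. compose (prime_tangle N p) X) w X"

lemma stack_snoc: "stack N (w @ [p]) X = stack N w (compose (prime_tangle N p) X)"
  by (simp add: stack_def)

lemma compose_prime_tangle:
  assumes m: "matching N m" and p: "1 \<le> index p" "index p + 1 \<le> N"
  shows "compose (prime_tangle N p) (tangle_of N m) = tangle_of N (act p m)"
  using p compose_T[OF m] compose_U[OF m] by (cases p) auto

text \<open>The letters are stacked from the right onto the identity, whose potential is 0, and each
  adds at most 8.\<close>

lemma word_tangle_matching:
  assumes "is_word N w"
  shows "\<exists>m. matching N m \<and> word_tangle N w = tangle_of N m \<and> potential N m \<le> 8 * int (length w)"
  using assms
proof (induction w)
  case Nil
  show ?case
    using matching_identity[of N] tangle_of_identity[of N] potential_identity[of N]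
    by (intro exI[of _ "\<lambda>q. 2 * N + 1 - q"]) (simp add: word_tangle_def)
next
  case (Cons p w)
  then obtain m where m: "matching N m" "word_tangle N w = tangle_of N m" "potential N m \<le> 8 * int (length w)"
    by (auto simp: is_word_def)
  have p: "1 \<le> index p" "index p + 1 \<le> N" using Cons.prems by (auto simp: is_word_def)
  have "word_tangle N (p # w) = compose (prime_tangle N p) (word_tangle N w)"
    by (simp add: word_tangle_def)
  also have "\<dots> = tangle_of N (act p m)" unfolding m(2) by (rule compose_prime_tangle[OF m(1) p])
  finally show ?case
    using matching_act[OF m(1) p] potential_act_le[OF m(1) p] m(3) by (intro exI[of _ "act p m"]) simp
qed

lemma potential_le_length:
  assumes m: "matching N m" and w: "factorization N w (tangle_of N m)"
  shows "potential N m \<le> 8 * int (length w)"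
proof -
  obtain m' where m': "matching N m'" "word_tangle N w = tangle_of N m'" "potential N m' \<le> 8 * int (length w)"
    using word_tangle_matching w unfolding factorization_def by blast
  then have "tangle_of N m' = tangle_of N m" using w by (simp add: factorization_def)
  then have "potential N m = potential N m'"
    by (intro potential_cong[OF m'(1)] tangle_of_inj[OF m'(1) m])
  then show ?thesis using m'(3) by simp
qed

lemma minimal_factorizationI:
  assumes m: "matching N m" and w: "factorization N w (tangle_of N m)" "8 * int (length w) \<le> potential N m"
  shows "minimal_factorization N w (tangle_of N m)"
  unfolding minimal_factorization_def
proof (intro conjI allI impI w(1))
  fix w' assume "factorization N w' (tangle_of N m)"
  then show "length w \<le> length w'" using potential_le_length[OF m] w(2) by fastforce
qed

section \<open>One splitting step in the form carried out by the program\<close>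

lemma ex_right_edge:
  assumes x: "matching N x" and i: "1 \<le> i" "Suc i \<le> N" and cup: "x i = Suc i"
  shows "\<exists>q. Suc i < q \<and> q \<le> 2 * N \<and> Suc i < x q"
proof (rule ccontr)
  assume no_edge: "\<not> ?thesis"
  have no: "x p \<le> Suc i" if "Suc i < p" "p \<le> 2 * N" for p
    using no_edge that not_le_imp_less by blast
  have xS: "x (Suc i) = i" using cup matchingD(3)[OF x, of i] i by simp
  have lt: "1 \<le> x p" "x p < i" if p: "Suc i < p" "p \<le> 2 * N" for p
  proof -
    have P: "1 \<le> p" "p \<le> 2 * N" using p by auto
    note P' = matchingD[OF x P]
    show "1 \<le> x p" by (rule P')
    have "x p \<noteq> i" "x p \<noteq> Suc i" using P' cup xS p by auto
    then show "x p < i" using no[OF p] by linarith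
  qed
  \<comment> \<open>Pigeonhole: the \<open>2 * N - i - 1\<close> positions after
    \<open>Suc i\<close> do not fit into the \<open>i - 1\<close> nodes left of
    \<open>i\<close>.\<close>
  have "inj_on x {Suc i<..2 * N}"
    by (rule inj_on_inverseI[of _ x]) (use matchingD(3)[OF x] in auto)
  then have "card {Suc i<..2 * N} = card (x ` {Suc i<..2 * N})" by (simp add: card_image)
  also have "\<dots> \<le> card {1..<i}" by (rule card_mono) (use lt in auto)
  finally show False using i by simp
qed

text \<open>As a \<open>repair\<close>, the T-split needs the same array writes as the U-split. It
  agrees with conjugation by the transposition on the positions, which suffices for tangle and
  potential; the prime is its own inverse.\<close>

lemma descent_step_T:
  assumes m: "matching N m" and i: "1 \<le> i" "Suc i \<le> N" and d: "descent N m i" and ne: "m i \<noteq> Suc i"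
  defines "y \<equiv> repair i (m (Suc i)) (Suc i) (m i) m"
  shows "matching N y" "tangle_of N m = compose (prime_tangle N (T i)) (tangle_of N y)"
    "potential N y + 8 \<le> potential N m"
proof -
  have r: "1 \<le> i" "i \<le> 2 * N" "1 \<le> Suc i" "Suc i \<le> 2 * N" using i by auto
  note I = matchingD[OF m r(1,2)] and J = matchingD[OF m r(3,4)]
  let ?z = "act (T i) m"
  have z: "matching N ?z" using matching_act[OF m, of "T i"] i by simp
  have mi: "m (Suc i) \<noteq> i" "m i \<noteq> m (Suc i)" using ne I J by force+
  have yz: "y q = ?z q" if q: "1 \<le> q" "q \<le> 2 * N" for q
  proof (cases "q \<in> {i, Suc i, m i, m (Suc i)}")
    case True
    then show ?thesis using I J ne mi by (auto simp: y_def repair_def transpose_def)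
  next
    case False
    then have "m q \<notin> {i, Suc i}" using matchingD(3)[OF m q] by auto
    then show ?thesis using False by (simp add: y_def repair_def)
  qed
  show "matching N y" using z yz unfolding matching_def by simp
  have ty: "tangle_of N y = tangle_of N ?z" using yz by (rule tangle_of_cong)
  have "act (T i) ?z = m" by (auto simp: fun_eq_iff)
  then show "tangle_of N m = compose (prime_tangle N (T i)) (tangle_of N y)"
    using compose_T[OF z i] unfolding ty by simp
  have "potential N y = potential N ?z" using yz by (rule potential_cong[OF z])
  then show "potential N y + 8 \<le> potential N m"
    using potential_act_T_drop[OF m i ne] d unfolding descent_def by simp
qed

lemma descent_step_U:
  assumes x: "matching N x" and i: "1 \<le> i" "Suc i \<le> N" and cup: "x i = Suc i"
    and nd: "\<And>j. 1 \<le> j \<Longrightarrow> j < i \<Longrightarrow> \<not> descent N x j"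
    and q: "Suc i < q" "q \<le> 2 * N" "Suc i < x q"
    and beyond: "\<And>p. q < p \<Longrightarrow> p \<le> 2 * N \<Longrightarrow> x p < i"
    and v: "v \<le> x q" "\<And>c. 1 \<le> c \<Longrightarrow> c < i \<Longrightarrow> v \<le> x c"
    and v_cases: "v = x q \<or> (\<exists>c. 1 \<le> c \<and> c < i \<and> v = x c)"
  defines "y \<equiv> repair i (x v) (Suc i) v x"
  shows "matching N y" "tangle_of N x = compose (prime_tangle N (U i)) (tangle_of N y)"
    "potential N y + 8 \<le> potential N x"
proof -
  have left: "Suc i < x c" if "1 \<le> c" "c < i" for c using mate_gt[OF x nd i(2) cup that] by simp
  note A = x i cup left q beyond v v_cases
  show y: "matching N y" unfolding y_def by (rule matching_uncup[OF A])
  show "tangle_of N x = compose (prime_tangle N (U i)) (tangle_of N y)"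
    using compose_U[OF y i] act_U_uncup[OF A] unfolding y_def by simp
  show "potential N y + 8 \<le> potential N x" unfolding y_def by (rule potential_uncup[OF A])
qed

section \<open>Running time of programs\<close>

text \<open>A total-correctness judgement with a time budget. The budget is only an upper bound, so
  branches of different length can share one.\<close>

definition ends :: "com \<Rightarrow> state \<Rightarrow> nat \<Rightarrow> (state \<Rightarrow> bool) \<Rightarrow> bool" where
  "ends c s B P \<longleftrightarrow> (\<exists>t s'. run c s t s' \<and> t \<le> B \<and> P s')"

lemma ends_mono:
  assumes "ends c s B P" "B \<le> B'" "\<And>s'. P s' \<Longrightarrow> Q s'"
  shows "ends c s B' Q"
  using assms unfolding ends_def by (meson le_trans)

lemma ends_Seq:
  assumes "ends c s B P" "\<And>s'. P s' \<Longrightarrow> ends d s' B' Q" "B + B' \<le> B''"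
  shows "ends (Seq c d) s B'' Q"
proof -
  obtain t s' where 1: "run c s t s'" "t \<le> B" "P s'" using assms(1) by (auto simp: ends_def)
  obtain t' s'' where 2: "run d s' t' s''" "t' \<le> B'" "Q s''" using assms(2)[OF 1(3)] by (auto simp: ends_def)
  show ?thesis
    unfolding ends_def using run.Seq[OF 1(1) 2(1)] 1(2) 2(2,3) assms(3)
    by (intro exI[of _ "t + t'"] exI[of _ s''] conjI) auto
qed

lemma ends_Cond:
  assumes "test_val b s \<Longrightarrow> ends c s B P" "\<not> test_val b s \<Longrightarrow> ends d s B P" "test_time b + B \<le> B'"
  shows "ends (Cond b c d) s B' P"
proof (cases "test_val b s")
  case True
  then obtain t s' where "run c s t s'" "t \<le> B" "P s'" using assms(1) by (auto simp: ends_def)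
  then show ?thesis unfolding ends_def using run.Cond_True[OF True] assms(3)
    by (intro exI[of _ "test_time b + t"] exI[of _ s']) auto
next
  case False
  then obtain t s' where "run d s t s'" "t \<le> B" "P s'" using assms(2) by (auto simp: ends_def)
  then show ?thesis unfolding ends_def using run.Cond_False[OF False] assms(3)
    by (intro exI[of _ "test_time b + t"] exI[of _ s']) auto
qed

text \<open>\<open>\<mu>\<close> bounds the number of rounds; each pays for one test and one body,
  and the failing test at the end is paid separately.\<close>

lemma ends_While:
  fixes \<mu> :: "state \<Rightarrow> nat"
  assumes body: "\<And>s. I s \<Longrightarrow> test_val b s \<Longrightarrow> ends c s B (\<lambda>s'. I s' \<and> \<mu> s' < \<mu> s)"
    and leave: "\<And>s. I s \<Longrightarrow> \<not> test_val b s \<Longrightarrow> P s"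
    and init: "I s" and bound: "\<mu> s * (test_time b + B) + test_time b \<le> B'"
  shows "ends (While b c) s B' P"
proof -
  have "ends (While b c) s (\<mu> s * (test_time b + B) + test_time b) P"
    using init
  proof (induction "\<mu> s" arbitrary: s rule: less_induct)
    case less
    show ?case
    proof (cases "test_val b s")
      case True
      obtain t s' where 1: "run c s t s'" "t \<le> B" "I s'" "\<mu> s' < \<mu> s"
        using body[OF less.prems True] by (auto simp: ends_def)
      obtain t' s'' where 2: "run (While b c) s' t' s''" "t' \<le> \<mu> s' * (test_time b + B) + test_time b" "P s''"
        using less.hyps[OF 1(4,3)] by (auto simp: ends_def)
      have "Suc (\<mu> s') * (test_time b + B) \<le> \<mu> s * (test_time b + B)"
        using 1(4) by (intro mult_right_mono) auto
      then have "test_time b + t + t' \<le> \<mu> s * (test_time b + B) + test_time b"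
        using 1(2) 2(2) by simp
      then show ?thesis
        unfolding ends_def using run.While_True[OF True 1(1) 2(1)] 2(3) by blast
    next
      case False
      then show ?thesis
        unfolding ends_def using run.While_False[OF False] leave[OF less.prems False]
        by (intro exI conjI) auto
    qed
  qed
  then show ?thesis using bound by (rule ends_mono) simp
qed

text \<open>Loop-free code needs no invariant: its final state and worst-case time are computed by
  simplification, which leaves only the loops to reason about.\<close>

fun straight :: "com \<Rightarrow> bool" where
  "straight (Seq c d) \<longleftrightarrow> straight c \<and> straight d"
| "straight (Cond b c d) \<longleftrightarrow> straight c \<and> straight d"
| "straight (While b c) \<longleftrightarrow> False"
| "straight c \<longleftrightarrow> True"

fun final :: "com \<Rightarrow> state \<Rightarrow> state" where
  "final (Assign x e) s = set_scalar x (exp_val e s) s"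
| "final (Write a e f) s = set_arr a (exp_val e s) (exp_val f s) s"
| "final (Seq c d) s = final d (final c s)"
| "final (Cond b c d) s = (if test_val b s then final c s else final d s)"
| "final c s = s"

fun max_time :: "com \<Rightarrow> nat" where
  "max_time (Assign x e) = exp_time e + 1"
| "max_time (Write a e f) = exp_time e + exp_time f + 1"
| "max_time (Seq c d) = max_time c + max_time d"
| "max_time (Cond b c d) = test_time b + max (max_time c) (max_time d)"
| "max_time c = 1"

lemma ends_final: "straight c \<Longrightarrow> ends c s (max_time c) (\<lambda>s'. s' = final c s)"
proof (induction c arbitrary: s)
  case Skip
  show ?case using run.Skip by (auto simp: ends_def intro!: exI)
next
  case (Assign x e)
  show ?case using run.Assign[of x e s] by (auto simp: ends_def)
next
  case (Write a e f)
  show ?case using run.Write[of a e f s] by (auto simp: ends_def)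
next
  case (Seq c d)
  then show ?case by (auto intro!: ends_Seq)
next
  case (Cond b c d)
  then have "straight c" "straight d" by auto
  then show ?case
    by (intro ends_Cond[where B = "max (max_time c) (max_time d)"])
      (auto intro: ends_mono[OF Cond.IH(1)] ends_mono[OF Cond.IH(2)])
qed simp

lemma ends_straight:
  assumes "straight c" "max_time c \<le> B" "P (final c s)"
  shows "ends c s B P"
  using ends_mono[OF ends_final[OF assms(1), of s] assms(2), of P] assms(3) by simp

lemma state_simps [simp]:
  "scalar (set_scalar x n s) = (scalar s)(x := n)" "arr (set_scalar x n s) = arr s"
  "scalar (set_arr a k n s) = scalar s" "arr (set_arr a k n s) = (arr s)(a := (arr s a)(k := n))"
  by (simp_all add: set_scalar_def set_arr_def)

definition agree :: "string list \<Rightarrow> state \<Rightarrow> state \<Rightarrow> bool" where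
  "agree xs s s' \<longleftrightarrow> arr s' = arr s \<and> (\<forall>x. x \<notin> set xs \<longrightarrow> scalar s' x = scalar s x)"

definition find_far :: com where
  "find_far = While (Less (Read ''m'' (Var ''q'')) (Var ''i'')) (Assign ''q'' (Pred (Var ''q'')))"

text \<open>\<open>q0\<close> is a witness at which the search has to stop; the program does not
  know it. A round costs 4 for the test and 3 for the body.\<close>

lemma find_far_ends:
  assumes q0: "q0 \<le> scalar s ''q''" "scalar s ''i'' \<le> arr s ''m'' q0"
    and B: "7 * scalar s ''q'' + 4 \<le> B"
  shows "ends find_far s B (\<lambda>s'. agree [''q''] s s' \<and> q0 \<le> scalar s' ''q'' \<and> scalar s' ''q'' \<le> scalar s ''q'' \<and>
    scalar s ''i'' \<le> arr s ''m'' (scalar s' ''q'') \<and>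
    (\<forall>p. scalar s' ''q'' < p \<longrightarrow> p \<le> scalar s ''q'' \<longrightarrow> arr s ''m'' p < scalar s ''i''))"
  unfolding find_far_def
proof (rule ends_While[where \<mu> = "\<lambda>s'. scalar s' ''q''" and B = 3 and
      I = "\<lambda>s'. agree [''q''] s s' \<and> q0 \<le> scalar s' ''q'' \<and> scalar s' ''q'' \<le> scalar s ''q'' \<and>
    (\<forall>p. scalar s' ''q'' < p \<longrightarrow> p \<le> scalar s ''q'' \<longrightarrow> arr s ''m'' p < scalar s ''i'')"], goal_cases)
  case (1 t)
  then have low: "arr s ''m'' (scalar t ''q'') < scalar s ''i''" by (simp add: agree_def)
  then have "q0 < scalar t ''q''" using 1 q0(2) by (metis le_neq_implies_less leD)
  moreover have "arr s ''m'' p < scalar s ''i''" if "scalar t ''q'' - 1 < p" "p \<le> scalar s ''q''" for p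
    using 1 low that by (cases "p = scalar t ''q''") auto
  ultimately show ?case
    using 1 by (intro ends_straight) (auto simp: agree_def)
next
  case (2 t)
  then show ?case by (simp add: agree_def)
next
  case 3
  then show ?case using q0 by (simp add: agree_def)
next
  case 4
  then show ?case using B by simp
qed

definition find_min :: com where
  "find_min = While (Less (Var ''c'') (Var ''i''))
     (Seq (Cond (Less (Read ''m'' (Var ''c'')) (Var ''v'')) (Assign ''v'' (Read ''m'' (Var ''c''))) Skip)
          (Assign ''c'' (Succ (Var ''c''))))"

text \<open>The scan improves on the value already stored in \<open>v\<close>. In its use this is
  the mate of \<open>q\<close>, so that the minimum covers all candidate edges. A round costs 3 for
  the test and at most 10 for the body.\<close>

lemma find_min_ends:
  assumes c: "scalar s ''c'' = 1" and i: "1 \<le> scalar s ''i''" and B: "13 * scalar s ''i'' + 3 \<le> B"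
  shows "ends find_min s B (\<lambda>s'. agree [''v'', ''c''] s s' \<and> scalar s' ''v'' \<le> scalar s ''v'' \<and>
    (\<forall>r. 1 \<le> r \<longrightarrow> r < scalar s ''i'' \<longrightarrow> scalar s' ''v'' \<le> arr s ''m'' r) \<and>
    (scalar s' ''v'' = scalar s ''v'' \<or> (\<exists>r. 1 \<le> r \<and> r < scalar s ''i'' \<and> scalar s' ''v'' = arr s ''m'' r)))"
  unfolding find_min_def
proof (rule ends_While[where \<mu> = "\<lambda>s'. scalar s ''i'' - scalar s' ''c''" and B = 10 and
      I = "\<lambda>s'. agree [''v'', ''c''] s s' \<and> 1 \<le> scalar s' ''c'' \<and> scalar s' ''c'' \<le> scalar s ''i'' \<and>
    scalar s' ''v'' \<le> scalar s ''v'' \<and>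
    (\<forall>r. 1 \<le> r \<longrightarrow> r < scalar s' ''c'' \<longrightarrow> scalar s' ''v'' \<le> arr s ''m'' r) \<and>
    (scalar s' ''v'' = scalar s ''v'' \<or> (\<exists>r. 1 \<le> r \<and> r < scalar s' ''c'' \<and> scalar s' ''v'' = arr s ''m'' r))"], goal_cases)
  case (1 t)
  then have A: "arr t = arr s" "scalar t ''i'' = scalar s ''i''" and lt: "scalar t ''c'' < scalar s ''i''"
    by (auto simp: agree_def)
  let ?body = "Seq (Cond (Less (Read ''m'' (Var ''c'')) (Var ''v'')) (Assign ''v'' (Read ''m'' (Var ''c''))) Skip)
          (Assign ''c'' (Succ (Var ''c'')))"
  define c v x where "c = scalar t ''c''" and "v = scalar t ''v''" and "x = arr s ''m''"
  define w where "w = (if x c < v then x c else v)"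
  have fin: "arr (final ?body t) = arr s" "scalar (final ?body t) = (scalar t)(''v'' := w, ''c'' := Suc c)"
    using A by (auto simp: w_def c_def v_def x_def fun_eq_iff)
  have t: "agree [''v'', ''c''] s t" "1 \<le> c" "v \<le> scalar s ''v''" "\<And>r. 1 \<le> r \<Longrightarrow> r < c \<Longrightarrow> v \<le> x r"
    "v = scalar s ''v'' \<or> (\<exists>r. 1 \<le> r \<and> r < c \<and> v = x r)" "c < scalar s ''i''"
    using 1 lt by (auto simp: c_def v_def x_def)
  have "w \<le> v" "w \<le> x c" by (auto simp: w_def)
  then have all: "w \<le> x r" if "1 \<le> r" "r < Suc c" for r
    using t(4)[of r] that by (cases "r = c") auto
  have ex: "w = scalar s ''v'' \<or> (\<exists>r. 1 \<le> r \<and> r < Suc c \<and> w = x r)"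
    using t(2,5) unfolding w_def by (metis less_Suc_eq)
  show ?case
  proof (rule ends_straight)
    show "max_time ?body \<le> 10" by simp
    have "agree [''v'', ''c''] s (final ?body t)" using t(1) fin by (simp add: agree_def)
    then show "(agree [''v'', ''c''] s (final ?body t) \<and> 1 \<le> scalar (final ?body t) ''c'' \<and>
      scalar (final ?body t) ''c'' \<le> scalar s ''i'' \<and> scalar (final ?body t) ''v'' \<le> scalar s ''v'' \<and>
      (\<forall>r. 1 \<le> r \<longrightarrow> r < scalar (final ?body t) ''c'' \<longrightarrow> scalar (final ?body t) ''v'' \<le> arr s ''m'' r) \<and>
      (scalar (final ?body t) ''v'' = scalar s ''v'' \<or>
        (\<exists>r. 1 \<le> r \<and> r < scalar (final ?body t) ''c'' \<and> scalar (final ?body t) ''v'' = arr s ''m'' r))) \<and>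
      scalar s ''i'' - scalar (final ?body t) ''c'' < scalar s ''i'' - scalar t ''c''"
      unfolding fin using all ex t(2,3,6) \<open>w \<le> v\<close> by (simp add: x_def[symmetric] c_def[symmetric])
  qed simp
next
  case (2 t)
  then have "scalar t ''c'' = scalar s ''i''" by (auto simp: agree_def)
  then show ?case using 2 by auto
next
  case 3
  then show ?case using c i by (auto simp: agree_def)
next
  case 4
  then show ?case using B c by simp
qed

definition mates_cup :: com where
  "mates_cup = Seq (Assign ''q'' (Var ''M'')) (Seq find_far (Seq (Assign ''v'' (Read ''m'' (Var ''q'')))
     (Seq (Assign ''c'' (Const 1)) (Seq find_min
     (Seq (Assign ''a'' (Read ''m'' (Var ''v''))) (Assign ''u'' (Const 1)))))))"

lemma mates_cup_ends:
  assumes M: "scalar s ''M'' = n" and i: "scalar s ''i'' = i" "1 \<le> i" and x: "arr s ''m'' = x"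
    and q0: "q0 \<le> n" "i \<le> x q0" and B: "7 * n + 13 * i + 19 \<le> B"
  shows "ends mates_cup s B (\<lambda>s'. agree [''q'', ''v'', ''c'', ''a'', ''u''] s s' \<and> scalar s' ''u'' = 1 \<and>
    scalar s' ''a'' = x (scalar s' ''v'') \<and>
    (\<exists>q. q0 \<le> q \<and> q \<le> n \<and> i \<le> x q \<and> (\<forall>p. q < p \<longrightarrow> p \<le> n \<longrightarrow> x p < i) \<and>
      scalar s' ''v'' \<le> x q \<and> (\<forall>r. 1 \<le> r \<longrightarrow> r < i \<longrightarrow> scalar s' ''v'' \<le> x r) \<and>
      (scalar s' ''v'' = x q \<or> (\<exists>r. 1 \<le> r \<and> r < i \<and> scalar s' ''v'' = x r))))"
    (is "ends _ s B ?post")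
proof -
  let ?s1 = "set_scalar ''q'' n s"
  define P2 where "P2 = (\<lambda>t. agree [''q''] s t \<and> q0 \<le> scalar t ''q'' \<and> scalar t ''q'' \<le> n \<and>
    i \<le> x (scalar t ''q'') \<and> (\<forall>p. scalar t ''q'' < p \<longrightarrow> p \<le> n \<longrightarrow> x p < i))"
  have 2: "ends find_far ?s1 (7 * n + 4) P2"
    by (rule ends_mono[OF find_far_ends[where ?q0.0 = q0]]) (use i x q0 in \<open>auto simp: P2_def agree_def\<close>)
  define P3 where "P3 = (\<lambda>t. agree [''q'', ''v'', ''c''] s t \<and>
    (\<exists>q. q0 \<le> q \<and> q \<le> n \<and> i \<le> x q \<and> (\<forall>p. q < p \<longrightarrow> p \<le> n \<longrightarrow> x p < i) \<and>
      scalar t ''v'' \<le> x q \<and> (\<forall>r. 1 \<le> r \<longrightarrow> r < i \<longrightarrow> scalar t ''v'' \<le> x r) \<and>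
      (scalar t ''v'' = x q \<or> (\<exists>r. 1 \<le> r \<and> r < i \<and> scalar t ''v'' = x r))))"
  have 3: "ends find_min (set_scalar ''c'' 1 (set_scalar ''v'' (arr t ''m'' (scalar t ''q'')) t)) (13 * i + 3) P3"
    if t: "P2 t" for t
  proof (rule ends_mono[OF find_min_ends], goal_cases)
    case (5 t')
    let ?q = "scalar t ''q''"
    have "agree [''q'', ''v'', ''c''] s t'" using 5 t by (simp add: P2_def agree_def)
    moreover have "q0 \<le> ?q \<and> ?q \<le> n \<and> i \<le> x ?q \<and> (\<forall>p. ?q < p \<longrightarrow> p \<le> n \<longrightarrow> x p < i) \<and>
      scalar t' ''v'' \<le> x ?q \<and> (\<forall>r. 1 \<le> r \<longrightarrow> r < i \<longrightarrow> scalar t' ''v'' \<le> x r) \<and>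
      (scalar t' ''v'' = x ?q \<or> (\<exists>r. 1 \<le> r \<and> r < i \<and> scalar t' ''v'' = x r))"
      using 5 t i x by (simp add: P2_def agree_def)
    ultimately show ?case unfolding P3_def by blast
  qed (use t i in \<open>auto simp: P2_def agree_def\<close>)
  show ?thesis
    unfolding mates_cup_def
  proof (rule ends_Seq[where P = "\<lambda>t. t = ?s1" and B = 2])
    show "ends (Assign ''q'' (Var ''M'')) s 2 (\<lambda>t. t = ?s1)" by (rule ends_straight) (auto simp: M)
    show "2 + (7 * n + 13 * i + 17) \<le> B" using B by simp
    fix t assume "t = ?s1"
    then have "ends find_far t (7 * n + 4) P2" using 2 by simp
    then show "ends (Seq find_far (Seq (Assign ''v'' (Read ''m'' (Var ''q'')))
     (Seq (Assign ''c'' (Const 1)) (Seq find_min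
     (Seq (Assign ''a'' (Read ''m'' (Var ''v''))) (Assign ''u'' (Const 1))))))) t (7 * n + 13 * i + 17) ?post"
    proof (rule ends_Seq[where B' = "13 * i + 13"])
      fix t assume t: "P2 t"
      show "ends (Seq (Assign ''v'' (Read ''m'' (Var ''q''))) (Seq (Assign ''c'' (Const 1)) (Seq find_min
     (Seq (Assign ''a'' (Read ''m'' (Var ''v''))) (Assign ''u'' (Const 1)))))) t (13 * i + 13) ?post"
      proof (rule ends_Seq[where B = 3 and B' = "13 * i + 10"])
        show "ends (Assign ''v'' (Read ''m'' (Var ''q''))) t 3 (\<lambda>t'. t' = set_scalar ''v'' (arr t ''m'' (scalar t ''q'')) t)"
          by (rule ends_straight) auto
        fix t' assume t': "t' = set_scalar ''v'' (arr t ''m'' (scalar t ''q'')) t"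
        show "ends (Seq (Assign ''c'' (Const 1)) (Seq find_min
     (Seq (Assign ''a'' (Read ''m'' (Var ''v''))) (Assign ''u'' (Const 1))))) t' (13 * i + 10) ?post"
        proof (rule ends_Seq[where B = 2 and B' = "13 * i + 8"])
          show "ends (Assign ''c'' (Const 1)) t' 2 (\<lambda>t''. t'' = set_scalar ''c'' 1 t')"
            by (rule ends_straight) auto
          fix t'' assume "t'' = set_scalar ''c'' 1 t'"
          then have "ends find_min t'' (13 * i + 3) P3" using 3[OF t] t' by simp
          then show "ends (Seq find_min (Seq (Assign ''a'' (Read ''m'' (Var ''v''))) (Assign ''u'' (Const 1))))
              t'' (13 * i + 8) ?post"
          proof (rule ends_Seq[where B' = 5])
            fix r assume r: "P3 r"
            show "ends (Seq (Assign ''a'' (Read ''m'' (Var ''v''))) (Assign ''u'' (Const 1))) r 5 ?post"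
              by (rule ends_straight) (use r x in \<open>auto simp: P3_def agree_def\<close>)
          qed simp
        qed simp
      qed simp
    qed simp
  qed
qed

section \<open>The program\<close>

definition mates_swap :: com where
  "mates_swap = Seq (Assign ''a'' (Read ''m'' (Succ (Var ''i''))))
     (Seq (Assign ''v'' (Read ''m'' (Var ''i''))) (Assign ''u'' (Const 0)))"

text \<open>Common end of both kinds of step: \<open>u\<close> is the kind of the prime, and
  \<open>a\<close> and \<open>v\<close> are the new partners of \<open>i\<close> and
  \<open>Suc i\<close>. With \<open>i\<close> reset to 1, the claim that no descent precedes
  \<open>i\<close> holds trivially.\<close>

definition emit :: com where
  "emit = Seq (Write ''kind'' (Var ''length'') (Var ''u''))
     (Seq (Write ''index'' (Var ''length'') (Var ''i''))
     (Seq (Assign ''length'' (Succ (Var ''length'')))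
     (Seq (Write ''m'' (Var ''i'') (Var ''a''))
     (Seq (Write ''m'' (Var ''a'') (Var ''i''))
     (Seq (Write ''m'' (Succ (Var ''i'')) (Var ''v''))
     (Seq (Write ''m'' (Var ''v'') (Succ (Var ''i'')))
       (Assign ''i'' (Const 1))))))))"

text \<open>Columns are read from a table, because \<open>2 * N + 1 - q\<close> is not an operation
  of the machine.\<close>

definition descent_test :: test where
  "descent_test = Conj (Neg (Less (Read ''col'' (Read ''m'' (Var ''i''))) (Var ''i'')))
     (Conj (Neg (Less (Succ (Var ''i'')) (Read ''col'' (Read ''m'' (Succ (Var ''i''))))))
     (Neg (Conj (Equal (Read ''col'' (Read ''m'' (Var ''i''))) (Var ''i''))
        (Equal (Read ''col'' (Read ''m'' (Succ (Var ''i'')))) (Succ (Var ''i''))))))"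

definition factor_step :: com where
  "factor_step = Seq (Cond (Equal (Read ''m'' (Var ''i'')) (Succ (Var ''i''))) mates_cup mates_swap) emit"

definition factor_loop :: com where
  "factor_loop = While (Less (Var ''i'') (Var ''N'')) (Cond descent_test factor_step (Assign ''i'' (Succ (Var ''i''))))"

text \<open>\<open>K\<close> will be the potential of the input. Every letter is paid with 8 units
  of it, so the final word satisfies \<open>8 * length w <= K\<close>, which meets the lower
  bound.\<close>

definition progress :: "nat \<Rightarrow> tangle \<Rightarrow> int \<Rightarrow> state \<Rightarrow> bool" where
  "progress N X K s \<longleftrightarrow> scalar s ''N'' = N \<and> scalar s ''M'' = 2 * N \<and>
     (\<forall>q. 1 \<le> q \<longrightarrow> q \<le> 2 * N \<longrightarrow> arr s ''col'' q = col N q) \<and> matching N (arr s ''m'') \<and>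
     (\<exists>w. outputs s w \<and> is_word N w \<and> stack N w (tangle_of N (arr s ''m'')) = X \<and>
        8 * int (length w) + potential N (arr s ''m'') \<le> K)"

lemma progress_cong:
  assumes "progress N X K s" "arr s' = arr s"
    "scalar s' ''N'' = scalar s ''N''" "scalar s' ''M'' = scalar s ''M''" "scalar s' ''length'' = scalar s ''length''"
  shows "progress N X K s'"
  using assms unfolding progress_def outputs_def by simp

lemma progress_emit:
  assumes s: "progress N X K s" and i: "scalar s ''i'' = i" "1 \<le> i" "Suc i \<le> N"
    and p: "scalar s ''u'' = 0 \<and> p = T i \<or> scalar s ''u'' = 1 \<and> p = U i"
    and y: "y = repair i (scalar s ''a'') (Suc i) (scalar s ''v'') (arr s ''m'')"
    and step: "matching N y" "tangle_of N (arr s ''m'') = compose (prime_tangle N p) (tangle_of N y)"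
      "potential N y + 8 \<le> potential N (arr s ''m'')"
  shows "progress N X K (final emit s)" "scalar (final emit s) ''i'' = 1" "arr (final emit s) ''m'' = y"
proof -
  obtain w where w: "outputs s w" "is_word N w" "stack N w (tangle_of N (arr s ''m'')) = X"
      "8 * int (length w) + potential N (arr s ''m'') \<le> K"
    using s unfolding progress_def by blast
  define s' where "s' = final emit s"
  have fin: "scalar s' = (scalar s)(''length'' := Suc (scalar s ''length''), ''i'' := 1)"
     "arr s' ''m'' = y" "arr s' ''col'' = arr s ''col''"
     "arr s' ''kind'' = (arr s ''kind'')(scalar s ''length'' := scalar s ''u'')"
     "arr s' ''index'' = (arr s ''index'')(scalar s ''length'' := i)"
    using i(1) by (simp_all add: s'_def emit_def y repair_def)
  have "outputs s' (w @ [p])"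
    using w(1) p unfolding outputs_def fin by (auto simp: nth_append less_Suc_eq)
  moreover have "is_word N (w @ [p])" using w(2) p i by (auto simp: is_word_def)
  moreover have "stack N (w @ [p]) (tangle_of N y) = X" using w(3) step(2) by (simp add: stack_snoc)
  moreover have "8 * int (length (w @ [p])) + potential N y \<le> K" using w(4) step(3) by simp
  ultimately have "progress N X K s'"
    using s step(1) unfolding progress_def fin by auto
  then show "progress N X K (final emit s)" by (simp add: s'_def)
  show "scalar (final emit s) ''i'' = 1" "arr (final emit s) ''m'' = y"
    using fin by (simp_all add: s'_def[symmetric])
qed

lemma descent_test_val:
  assumes s: "progress N X K s" and i: "1 \<le> scalar s ''i''" "Suc (scalar s ''i'') \<le> N"
  shows "test_val descent_test s \<longleftrightarrow> descent N (arr s ''m'') (scalar s ''i'')"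
proof -
  have m: "matching N (arr s ''m'')" and c: "\<And>q. 1 \<le> q \<Longrightarrow> q \<le> 2 * N \<Longrightarrow> arr s ''col'' q = col N q"
    using s unfolding progress_def by blast+
  have "arr s ''col'' (arr s ''m'' q) = col N (arr s ''m'' q)" if "1 \<le> q" "q \<le> N" for q
    using c matchingD[OF m, of q] that by simp
  from this[of "scalar s ''i''"] this[of "Suc (scalar s ''i'')"] show ?thesis
    using i by (auto simp: descent_test_def descent_def)
qed

text \<open>The factor is 27 = 7 * 2 + 13: the downward search covers at most \<open>2 * N\<close>
  positions, the minimum fewer than \<open>N\<close> nodes.\<close>

lemma factor_step_ends:
  assumes s: "progress N X K s" and i: "scalar s ''i'' = i" "1 \<le> i" "Suc i \<le> N"
    and d: "descent N (arr s ''m'') i" and nd: "\<And>j. 1 \<le> j \<Longrightarrow> j < i \<Longrightarrow> \<not> descent N (arr s ''m'') j"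
  shows "ends factor_step s (27 * N + 60) (\<lambda>s'. progress N X K s' \<and> scalar s' ''i'' = 1 \<and>
    potential N (arr s' ''m'') + 8 \<le> potential N (arr s ''m''))"
proof -
  define x where "x = arr s ''m''"
  have m: "matching N x" and M: "scalar s ''M'' = 2 * N" using s by (auto simp: progress_def x_def)
  \<comment> \<open>\<open>R\<close> hides the branch taken: the scalars describe some prime
    together with a valid remaining tangle.\<close>
  define R where "R = (\<lambda>t. agree [''q'', ''v'', ''c'', ''a'', ''u''] s t \<and>
    (\<exists>p y. (scalar t ''u'' = 0 \<and> p = T i \<or> scalar t ''u'' = 1 \<and> p = U i) \<and>
      y = repair i (scalar t ''a'') (Suc i) (scalar t ''v'') x \<and> matching N y \<and>
      tangle_of N x = compose (prime_tangle N p) (tangle_of N y) \<and> potential N y + 8 \<le> potential N x))"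
  have "ends (Cond (Equal (Read ''m'' (Var ''i'')) (Succ (Var ''i''))) mates_cup mates_swap) s (27 * N + 24) R"
  proof (rule ends_Cond[where B = "27 * N + 19"])
    assume "test_val (Equal (Read ''m'' (Var ''i'')) (Succ (Var ''i''))) s"
    then have cup: "x i = Suc i" using i by (simp add: x_def)
    obtain q0 where q0: "Suc i < q0" "q0 \<le> 2 * N" "Suc i < x q0"
      using ex_right_edge[OF m i(2,3) cup] by blast
    show "ends mates_cup s (27 * N + 19) R"
    proof (rule ends_mono[OF mates_cup_ends[where ?q0.0 = q0 and n = "2 * N" and i = i and x = x]], goal_cases)
      case (9 t)
      define v where "v = scalar t ''v''"
      have a: "scalar t ''a'' = x v" "scalar t ''u'' = 1" "agree [''q'', ''v'', ''c'', ''a'', ''u''] s t"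
        using 9 by (auto simp: v_def)
      from 9 obtain q where q: "q0 \<le> q" "q \<le> 2 * N" "i \<le> x q" "\<And>p. q < p \<Longrightarrow> p \<le> 2 * N \<Longrightarrow> x p < i"
          "v \<le> x q" "\<And>r. 1 \<le> r \<Longrightarrow> r < i \<Longrightarrow> v \<le> x r"
          "v = x q \<or> (\<exists>r. 1 \<le> r \<and> r < i \<and> v = x r)"
        unfolding v_def by blast
      \<comment> \<open>The search yields only \<open>i <= x q\<close>; the values \<open>i\<close>
        and \<open>Suc i\<close> are impossible since these two nodes are joined to each
        other.\<close>
      have "x q \<noteq> i" "x q \<noteq> Suc i"
        using q(1,2) q0(1) cup matchingD(3)[OF m, of q] matchingD(3)[OF m, of i] i by auto
      then have xq: "Suc i < x q" using q(3) by simp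
      have q1: "Suc i < q" using q(1) q0(1) by simp
      note step = descent_step_U[OF m i(2,3) cup nd[folded x_def] q1 q(2) xq q(4-7)]
      show ?case unfolding R_def
        using a step by (intro conjI exI[of _ "U i"] exI[of _ "repair i (x v) (Suc i) v x"]) (simp_all add: v_def)
    qed (use M i q0 x_def in auto)
  next
    assume "\<not> test_val (Equal (Read ''m'' (Var ''i'')) (Succ (Var ''i''))) s"
    then have ne: "x i \<noteq> Suc i" using i by (simp add: x_def)
    note step = descent_step_T[OF m i(2,3) d[folded x_def] ne]
    show "ends mates_swap s (27 * N + 19) R"
    proof (rule ends_straight)
      define t where "t = final mates_swap s"
      have t: "agree [''q'', ''v'', ''c'', ''a'', ''u''] s t" "scalar t ''u'' = 0" "scalar t ''a'' = x (Suc i)" "scalar t ''v'' = x i"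
        using i by (simp_all add: t_def mates_swap_def agree_def x_def)
      show "R (final mates_swap s)" unfolding R_def t_def[symmetric]
        using t step by (intro conjI exI[of _ "T i"] exI[of _ "repair i (x (Suc i)) (Suc i) (x i) x"]) simp_all
    qed (simp_all add: mates_swap_def)
  qed simp
  then show ?thesis unfolding factor_step_def
  proof (rule ends_Seq[where B' = 30])
    fix t assume t: "R t"
    then have A: "arr t = arr s" "scalar t ''i'' = i" "progress N X K t"
      using i progress_cong[OF s] by (auto simp: R_def agree_def)
    from t obtain p y where py: "scalar t ''u'' = 0 \<and> p = T i \<or> scalar t ''u'' = 1 \<and> p = U i"
      "y = repair i (scalar t ''a'') (Suc i) (scalar t ''v'') (arr t ''m'')" "matching N y"
      "tangle_of N (arr t ''m'') = compose (prime_tangle N p) (tangle_of N y)" "potential N y + 8 \<le> potential N (arr t ''m'')"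
      unfolding R_def A x_def by blast
    note E = progress_emit[OF A(3,2) i(2,3) py]
    show "ends emit t 30 (\<lambda>s'. progress N X K s' \<and> scalar s' ''i'' = 1 \<and>
        potential N (arr s' ''m'') + 8 \<le> potential N (arr s ''m''))"
    proof (rule ends_straight)
      show "progress N X K (final emit t) \<and> scalar (final emit t) ''i'' = 1 \<and>
        potential N (arr (final emit t) ''m'') + 8 \<le> potential N (arr s ''m'')"
        unfolding E(3) using E(1,2) py(5) A(1) by simp
    qed (simp_all add: emit_def)
  qed simp
qed

text \<open>A lexicographic order folded into one number: thanks to the factor \<open>N\<close>, a
  drop of the potential outweighs the reset of \<open>i\<close>. There are at most about
  \<open>4 * N ^ 3\<close> rounds, and charging each with linear time gives the fourth
  power.\<close>

lemma factor_loop_ends: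
  assumes s: "progress N X K s" and i: "scalar s ''i'' = 1"
    and B: "(nat (potential N (arr s ''m'')) * N + N) * (27 * N + 110) + 3 \<le> B"
  shows "ends factor_loop s B (\<lambda>s'. progress N X K s' \<and> (\<forall>j. 1 \<le> j \<longrightarrow> j < N \<longrightarrow> \<not> descent N (arr s' ''m'') j))"
  unfolding factor_loop_def
proof (rule ends_While[where \<mu> = "\<lambda>t. nat (potential N (arr t ''m'')) * N + (N - scalar t ''i'')" and B = "27 * N + 100" and
    I = "\<lambda>t. progress N X K t \<and> 1 \<le> scalar t ''i'' \<and> (\<forall>j. 1 \<le> j \<longrightarrow> j < scalar t ''i'' \<longrightarrow> \<not> descent N (arr t ''m'') j)"], goal_cases)
  case (1 t)
  define j where "j = scalar t ''i''"
  have t: "progress N X K t" "1 \<le> j" "\<And>r. 1 \<le> r \<Longrightarrow> r < j \<Longrightarrow> \<not> descent N (arr t ''m'') r"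
    and jN: "Suc j \<le> N"
    using 1 by (auto simp: j_def progress_def)
  have dt: "test_val descent_test t \<longleftrightarrow> descent N (arr t ''m'') j"
    using descent_test_val[OF t(1)] t(2) jN by (simp add: j_def)
  show ?case
  proof (rule ends_Cond[where B = "27 * N + 60"])
    assume "test_val descent_test t"
    then have "descent N (arr t ''m'') j" using dt by simp
    then have "ends factor_step t (27 * N + 60) (\<lambda>s'. progress N X K s' \<and> scalar s' ''i'' = 1 \<and>
        potential N (arr s' ''m'') + 8 \<le> potential N (arr t ''m''))"
      by (rule factor_step_ends[OF t(1) j_def[symmetric] t(2) jN]) (rule t(3))
    then show "ends factor_step t (27 * N + 60) (\<lambda>s'. (progress N X K s' \<and> 1 \<le> scalar s' ''i'' \<and>
        (\<forall>j. 1 \<le> j \<longrightarrow> j < scalar s' ''i'' \<longrightarrow> \<not> descent N (arr s' ''m'') j)) \<and>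
        nat (potential N (arr s' ''m'')) * N + (N - scalar s' ''i'') < nat (potential N (arr t ''m'')) * N + (N - scalar t ''i''))"
    proof (rule ends_mono)
      fix t' assume t': "progress N X K t' \<and> scalar t' ''i'' = 1 \<and> potential N (arr t' ''m'') + 8 \<le> potential N (arr t ''m'')"
      have "Suc (nat (potential N (arr t' ''m''))) * N \<le> nat (potential N (arr t ''m'')) * N"
        using t' potential_nonneg[of N "arr t' ''m''"] by (intro mult_right_mono) auto
      then show "(progress N X K t' \<and> 1 \<le> scalar t' ''i'' \<and>
        (\<forall>j. 1 \<le> j \<longrightarrow> j < scalar t' ''i'' \<longrightarrow> \<not> descent N (arr t' ''m'') j)) \<and>
        nat (potential N (arr t' ''m'')) * N + (N - scalar t' ''i'') < nat (potential N (arr t ''m'')) * N + (N - scalar t ''i'')"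
        using t' jN t(2) by (simp add: j_def)
    qed (rule order_refl)
  next
    assume "\<not> test_val descent_test t"
    then have nd: "\<not> descent N (arr t ''m'') j" using dt by simp
    define t' where "t' = final (Assign ''i'' (Succ (Var ''i''))) t"
    have t': "progress N X K t'" "arr t' = arr t" "scalar t' ''i'' = Suc j"
      using progress_cong[OF t(1), of t'] by (simp_all add: t'_def j_def)
    show "ends (Assign ''i'' (Succ (Var ''i''))) t (27 * N + 60) (\<lambda>s'. (progress N X K s' \<and> 1 \<le> scalar s' ''i'' \<and>
        (\<forall>j. 1 \<le> j \<longrightarrow> j < scalar s' ''i'' \<longrightarrow> \<not> descent N (arr s' ''m'') j)) \<and>
        nat (potential N (arr s' ''m'')) * N + (N - scalar s' ''i'') < nat (potential N (arr t ''m'')) * N + (N - scalar t ''i''))"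
    proof (rule ends_straight; (unfold t'_def[symmetric])?)
      show "(progress N X K t' \<and> 1 \<le> scalar t' ''i'' \<and>
        (\<forall>j. 1 \<le> j \<longrightarrow> j < scalar t' ''i'' \<longrightarrow> \<not> descent N (arr t' ''m'') j)) \<and>
        nat (potential N (arr t' ''m'')) * N + (N - scalar t' ''i'') < nat (potential N (arr t ''m'')) * N + (N - scalar t ''i'')"
        using t' nd t(3) jN by (auto simp: less_Suc_eq j_def[symmetric])
    qed simp_all
  qed (simp add: descent_test_def)
next
  case (2 t)
  then show ?case by (auto simp: progress_def)
next
  case 3
  then show ?case using s i by simp
next
  case 4
  have "(nat (potential N (arr s ''m'')) * N + (N - scalar s ''i'')) * (27 * N + 103)
      \<le> (nat (potential N (arr s ''m'')) * N + N) * (27 * N + 110)"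
    by (intro mult_mono) auto
  then show ?case using B by (simp add: add.commute)
qed

section \<open>Preparation of the tables from the input labels\<close>

definition double_N :: com where
  "double_N = Seq (Assign ''p'' (Var ''N''))
     (Seq (While (Less (Var ''k'') (Var ''N'')) (Seq (Assign ''p'' (Succ (Var ''p''))) (Assign ''k'' (Succ (Var ''k'')))))
       (Assign ''M'' (Var ''p'')))"

text \<open>The label \<open>N + k\<close> and the position \<open>2 * N + 1 - k\<close> are kept in
  the ascending counter \<open>j\<close> and the descending counter \<open>p\<close>, as the machine
  cannot compute them directly.\<close>

definition fill_tables :: com where
  "fill_tables = While (Neg (Less (Var ''N'') (Var ''k'')))
     (Seq (Write ''pos'' (Var ''k'') (Var ''k''))
     (Seq (Write ''col'' (Var ''k'') (Var ''k''))
     (Seq (Write ''pos'' (Var ''j'') (Var ''p''))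
     (Seq (Write ''col'' (Var ''p'') (Var ''k''))
     (Seq (Assign ''k'' (Succ (Var ''k'')))
     (Seq (Assign ''j'' (Succ (Var ''j'')))
       (Assign ''p'' (Pred (Var ''p'')))))))))"

definition translate_mates :: com where
  "translate_mates = While (Neg (Less (Var ''M'') (Var ''k'')))
     (Seq (Write ''m'' (Read ''pos'' (Var ''k'')) (Read ''pos'' (Read ''mate'' (Var ''k''))))
       (Assign ''k'' (Succ (Var ''k''))))"

definition prepare :: com where
  "prepare = Seq double_N
     (Seq (Seq (Assign ''k'' (Const 1)) (Assign ''j'' (Succ (Var ''N''))))
     (Seq fill_tables
     (Seq (Assign ''k'' (Const 1))
     (Seq translate_mates (Assign ''i'' (Const 1))))))"

definition factorize :: com where
  "factorize = Seq prepare factor_loop"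

text \<open>A lower node with label \<open>N + i\<close> has position \<open>2 * N + 1 - i\<close>;
  hence the constant \<open>3 * N + 1\<close>.\<close>

definition label_pos :: "nat \<Rightarrow> nat \<Rightarrow> nat" where
  "label_pos N r = (if r \<le> N then r else 3 * N + 1 - r)"

lemma label_pos_inj:
  "1 \<le> r \<Longrightarrow> r \<le> 2 * N \<Longrightarrow> 1 \<le> r' \<Longrightarrow> r' \<le> 2 * N \<Longrightarrow> label_pos N r = label_pos N r' \<longleftrightarrow> r = r'"
  by (auto simp: label_pos_def)

lemma label_node:
  assumes "u \<in> nodes N"
  shows "1 \<le> label N u \<and> label N u \<le> 2 * N" "node_of N (label N u) = u" "label_pos N (label N u) = pos N u"
  using assms by (auto simp: nodes_def node_of_def label_pos_def)

lemma double_N_ends: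
  assumes k: "scalar s ''k'' = 0" and N: "scalar s ''N'' = N"
  shows "ends double_N s (9 * N + 7) (\<lambda>t. agree [''p'', ''k'', ''M''] s t \<and> scalar t ''p'' = 2 * N \<and> scalar t ''M'' = 2 * N)"
proof -
  define I where "I = (\<lambda>t. agree [''p'', ''k''] s t \<and> scalar t ''k'' \<le> N \<and> scalar t ''p'' = N + scalar t ''k'')"
  let ?b = "Less (Var ''k'') (Var ''N'')"
  let ?c = "Seq (Assign ''p'' (Succ (Var ''p''))) (Assign ''k'' (Succ (Var ''k'')))"
  let ?post = "\<lambda>t. agree [''p'', ''k'', ''M''] s t \<and> scalar t ''p'' = 2 * N \<and> scalar t ''M'' = 2 * N"
  have loop: "ends (While ?b ?c) t (9 * N + 3) (\<lambda>t. I t \<and> scalar t ''k'' = N)" if t: "I t" "scalar t ''k'' = 0" for t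
  proof (rule ends_While[where I = I and \<mu> = "\<lambda>t. N - scalar t ''k''" and B = 6], goal_cases)
    case (1 t)
    show ?case by (rule ends_straight) (use 1 N in \<open>auto simp: I_def agree_def\<close>)
  qed (use t N in \<open>auto simp: I_def agree_def\<close>)
  show ?thesis unfolding double_N_def
  proof (rule ends_Seq[where B = 2 and B' = "9 * N + 5"])
    show "ends (Assign ''p'' (Var ''N'')) s 2 (\<lambda>t. I t \<and> scalar t ''k'' = 0)"
      by (rule ends_straight) (use k N in \<open>auto simp: I_def agree_def\<close>)
    fix t assume t: "I t \<and> scalar t ''k'' = 0"
    show "ends (Seq (While ?b ?c) (Assign ''M'' (Var ''p''))) t (9 * N + 5) ?post"
    proof (rule ends_Seq[OF loop, where B' = 2])
      fix r assume r: "I r \<and> scalar r ''k'' = N"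
      show "ends (Assign ''M'' (Var ''p'')) r 2 ?post"
        by (rule ends_straight) (use r in \<open>auto simp: I_def agree_def\<close>)
    qed (use t in auto)
  qed simp
qed

definition tables_ok :: "nat \<Rightarrow> state \<Rightarrow> state \<Rightarrow> bool" where
  "tables_ok N s t \<longleftrightarrow> scalar t ''N'' = N \<and> scalar t ''M'' = 2 * N \<and> scalar t ''length'' = 0 \<and>
     arr t ''mate'' = arr s ''mate''"

lemma fill_tables_ends:
  assumes ok: "tables_ok N s s" and k: "scalar s ''k'' = 1" and j: "scalar s ''j'' = N + 1" and p: "scalar s ''p'' = 2 * N"
  shows "ends fill_tables s (40 * N + 4) (\<lambda>t. tables_ok N s t \<and>
    (\<forall>r. 1 \<le> r \<longrightarrow> r \<le> 2 * N \<longrightarrow> arr t ''pos'' r = label_pos N r \<and> arr t ''col'' r = col N r))"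
  unfolding fill_tables_def
proof (rule ends_While[where \<mu> = "\<lambda>t. N + 1 - scalar t ''k''" and B = 30 and
    I = "\<lambda>t. tables_ok N s t \<and> 1 \<le> scalar t ''k'' \<and> scalar t ''k'' \<le> N + 1 \<and> scalar t ''j'' = N + scalar t ''k'' \<and>
      scalar t ''p'' = 2 * N + 1 - scalar t ''k'' \<and>
      (\<forall>r. 1 \<le> r \<longrightarrow> r < scalar t ''k'' \<longrightarrow> arr t ''pos'' r = r \<and> arr t ''col'' r = r \<and>
        arr t ''pos'' (N + r) = 2 * N + 1 - r \<and> arr t ''col'' (2 * N + 1 - r) = r)"], goal_cases)
  case (1 t)
  define k where "k = scalar t ''k''"
  have t: "tables_ok N s t" "1 \<le> k" "k \<le> N" "scalar t ''j'' = N + k" "scalar t ''p'' = 2 * N + 1 - k"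
      "\<And>r. 1 \<le> r \<Longrightarrow> r < k \<Longrightarrow> arr t ''pos'' r = r \<and> arr t ''col'' r = r \<and>
        arr t ''pos'' (N + r) = 2 * N + 1 - r \<and> arr t ''col'' (2 * N + 1 - r) = r"
    using 1 by (auto simp: k_def tables_ok_def)
  let ?c = "(Seq (Write ''pos'' (Var ''k'') (Var ''k''))
     (Seq (Write ''col'' (Var ''k'') (Var ''k''))
     (Seq (Write ''pos'' (Var ''j'') (Var ''p''))
     (Seq (Write ''col'' (Var ''p'') (Var ''k''))
     (Seq (Assign ''k'' (Succ (Var ''k'')))
     (Seq (Assign ''j'' (Succ (Var ''j'')))
       (Assign ''p'' (Pred (Var ''p'')))))))))"
  define t' where "t' = final ?c t"
  have fin: "scalar t' ''k'' = Suc k" "scalar t' ''j'' = Suc (N + k)" "scalar t' ''p'' = 2 * N - k"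
      "scalar t' ''N'' = scalar t ''N''" "scalar t' ''M'' = scalar t ''M''" "scalar t' ''length'' = scalar t ''length''"
      "arr t' ''mate'' = arr t ''mate''"
      "arr t' ''pos'' = (arr t ''pos'')(k := k, N + k := 2 * N + 1 - k)"
      "arr t' ''col'' = (arr t ''col'')(k := k, 2 * N + 1 - k := k)"
    using t(4,5) by (simp_all add: t'_def k_def[symmetric])
  have ok: "tables_ok N s t'" using t(1) by (simp add: tables_ok_def fin)
  \<comment> \<open>The cells written for \<open>k\<close> differ from those of every
    \<open>r < k\<close>, because \<open>k <= N\<close>.\<close>
  have tab: "arr t' ''pos'' r = r \<and> arr t' ''col'' r = r \<and>
        arr t' ''pos'' (N + r) = 2 * N + 1 - r \<and> arr t' ''col'' (2 * N + 1 - r) = r" if "1 \<le> r" "r < Suc k" for r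
  proof (cases "r = k")
    case True
    then show ?thesis using t(2,3) unfolding fin by auto
  next
    case False
    then have "r < k" using that by simp
    then show ?thesis using t(6)[OF that(1)] t(2,3) that(1) unfolding fin by auto
  qed
  show ?case
    by (rule ends_straight; (unfold t'_def[symmetric])?)
      (use ok tab t(2,3) in \<open>simp_all add: fin k_def[symmetric]\<close>)
next
  case (2 t)
  then have k: "scalar t ''k'' = N + 1" by (auto simp: tables_ok_def)
  have tab: "arr t ''pos'' r = r \<and> arr t ''col'' r = r \<and>
        arr t ''pos'' (N + r) = 2 * N + 1 - r \<and> arr t ''col'' (2 * N + 1 - r) = r" if "1 \<le> r" "r \<le> N" for r
    using 2 that unfolding k by simp
  have "arr t ''pos'' r = label_pos N r \<and> arr t ''col'' r = col N r" if r: "1 \<le> r" "r \<le> 2 * N" for r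
  proof (cases "r \<le> N")
    case True
    then show ?thesis using tab[of r] r by (simp add: label_pos_def col_def)
  next
    case False
    then have "1 \<le> r - N" "r - N \<le> N" "1 \<le> 2 * N + 1 - r" "2 * N + 1 - r \<le> N" using r by auto
    from tab[OF this(1,2)] tab[OF this(3,4)] show ?thesis using False r by (auto simp: label_pos_def col_def)
  qed
  then show ?case using 2 by simp
next
  case 3
  then show ?case using ok k j p by simp
next
  case 4
  then show ?case using k by simp
qed

text \<open>The table is rewritten from labels to positions on both sides; injectivity of
  \<open>label_pos\<close> protects the entries written earlier.\<close>

lemma translate_mates_ends:
  assumes ok: "tables_ok N s s" and k: "scalar s ''k'' = 1"
    and tab: "\<And>r. 1 \<le> r \<Longrightarrow> r \<le> 2 * N \<Longrightarrow> arr s ''pos'' r = label_pos N r \<and> arr s ''col'' r = col N r"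
    and mate: "\<And>r. 1 \<le> r \<Longrightarrow> r \<le> 2 * N \<Longrightarrow> 1 \<le> arr s ''mate'' r \<and> arr s ''mate'' r \<le> 2 * N"
  shows "ends translate_mates s (40 * N + 4) (\<lambda>t. tables_ok N s t \<and>
    (\<forall>r. 1 \<le> r \<longrightarrow> r \<le> 2 * N \<longrightarrow> arr t ''col'' r = col N r \<and>
      arr t ''m'' (label_pos N r) = label_pos N (arr s ''mate'' r)))"
  unfolding translate_mates_def
proof (rule ends_While[where \<mu> = "\<lambda>t. 2 * N + 1 - scalar t ''k''" and B = 12 and
    I = "\<lambda>t. tables_ok N s t \<and> 1 \<le> scalar t ''k'' \<and> scalar t ''k'' \<le> 2 * N + 1 \<and>
      arr t ''pos'' = arr s ''pos'' \<and> arr t ''col'' = arr s ''col'' \<and>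
      (\<forall>r. 1 \<le> r \<longrightarrow> r < scalar t ''k'' \<longrightarrow> arr t ''m'' (label_pos N r) = label_pos N (arr s ''mate'' r))"], goal_cases)
  case (1 t)
  define k where "k = scalar t ''k''"
  have t: "tables_ok N s t" "1 \<le> k" "k \<le> 2 * N" "arr t ''pos'' = arr s ''pos''" "arr t ''col'' = arr s ''col''"
      "\<And>r. 1 \<le> r \<Longrightarrow> r < k \<Longrightarrow> arr t ''m'' (label_pos N r) = label_pos N (arr s ''mate'' r)"
    using 1 by (auto simp: k_def tables_ok_def)
  let ?c = "Seq (Write ''m'' (Read ''pos'' (Var ''k'')) (Read ''pos'' (Read ''mate'' (Var ''k''))))
       (Assign ''k'' (Succ (Var ''k'')))"
  define t' where "t' = final ?c t"
  have mt: "arr t ''mate'' = arr s ''mate''" using t(1) by (simp add: tables_ok_def)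
  have "arr s ''pos'' k = label_pos N k" "arr s ''pos'' (arr s ''mate'' k) = label_pos N (arr s ''mate'' k)"
    using tab t(2,3) mate by auto
  then have fin: "scalar t' = (scalar t)(''k'' := Suc k)"
      "arr t' ''m'' = (arr t ''m'')(label_pos N k := label_pos N (arr s ''mate'' k))"
      "arr t' ''pos'' = arr s ''pos''" "arr t' ''col'' = arr s ''col''" "arr t' ''mate'' = arr t ''mate''"
    using t(4,5) mt by (simp_all add: t'_def k_def[symmetric])
  have ok: "tables_ok N s t'" using t(1) by (simp add: tables_ok_def fin)
  have ext: "arr t' ''m'' (label_pos N r) = label_pos N (arr s ''mate'' r)" if "1 \<le> r" "r < Suc k" for r
    using t(6)[of r] that t(2,3) label_pos_inj[of r N k] by (cases "r = k") (simp_all add: fin)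
  show ?case
    by (rule ends_straight; (unfold t'_def[symmetric])?)
      (use ok ext t(2,3) in \<open>simp_all add: fin k_def[symmetric] del: fun_upd_apply\<close>, (simp add: fin)?)
next
  case (2 t)
  then have "scalar t ''k'' = 2 * N + 1" by (auto simp: tables_ok_def)
  then show ?case using 2 tab by simp
next
  case 3
  then show ?case using ok k by simp
next
  case 4
  then show ?case using k by simp
qed

lemma prepare_ends:
  assumes X: "is_tangle N X"
  defines "m0 \<equiv> \<lambda>q. pos N (partner X (node_at N q))"
  shows "ends prepare (input_state N X) (89 * N + 24) (\<lambda>t. progress N X (potential N m0) t \<and>
    scalar t ''i'' = 1 \<and> potential N (arr t ''m'') = potential N m0)"
    (is "ends _ ?s _ ?post")
proof -
  note M = is_tangle_matching[OF X, folded m0_def]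
  have mate: "arr ?s ''mate'' r = label N (partner X (node_of N r))" if "1 \<le> r" "r \<le> 2 * N" for r
    using that by (simp add: input_state_def)
  have node_of_in: "node_of N r \<in> nodes N" if "1 \<le> r" "r \<le> 2 * N" for r
    using that by (auto simp: node_of_def nodes_def image_iff)
  have mate_range: "1 \<le> arr ?s ''mate'' r \<and> arr ?s ''mate'' r \<le> 2 * N" if "1 \<le> r" "r \<le> 2 * N" for r
    using label_node(1)[OF M(3)[OF node_of_in[OF that]]] mate[OF that] by simp
  \<comment> \<open>The table is filled label by label but used position by position: the label of
    the node at \<open>q\<close> translates back to \<open>q\<close>.\<close>
  have m0: "arr t ''m'' q = m0 q" if q: "1 \<le> q" "q \<le> 2 * N"
    and t: "\<And>r. 1 \<le> r \<Longrightarrow> r \<le> 2 * N \<Longrightarrow> arr t ''m'' (label_pos N r) = label_pos N (arr ?s ''mate'' r)" for t q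
  proof -
    note u = node_at_in[OF q]
    define r where "r = label N (node_at N q)"
    have r: "1 \<le> r" "r \<le> 2 * N" "node_of N r = node_at N q" "label_pos N r = q"
      using label_node[OF u] pos_node_at[OF q] by (simp_all add: r_def)
    show ?thesis
      using t[OF r(1,2)] label_node(3)[OF M(3)[OF u]] mate[OF r(1,2)] r(3,4) by (simp add: m0_def)
  qed
  define I1 where "I1 = (\<lambda>t. tables_ok N ?s t \<and> scalar t ''p'' = 2 * N)"
  define I2 where "I2 = (\<lambda>t. tables_ok N ?s t \<and>
    (\<forall>r. 1 \<le> r \<longrightarrow> r \<le> 2 * N \<longrightarrow> arr t ''pos'' r = label_pos N r \<and> arr t ''col'' r = col N r))"
  define I3 where "I3 = (\<lambda>t. tables_ok N ?s t \<and> (\<forall>r. 1 \<le> r \<longrightarrow> r \<le> 2 * N \<longrightarrow> arr t ''col'' r = col N r \<and>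
      arr t ''m'' (label_pos N r) = label_pos N (arr ?s ''mate'' r)))"
  have shift: "tables_ok N ?s t \<Longrightarrow> tables_ok N t t'\<Longrightarrow> tables_ok N ?s t'" for t t'
    by (simp add: tables_ok_def)
  show ?thesis unfolding prepare_def
  proof (rule ends_Seq[where P = I1 and B = "9 * N + 7" and B' = "80 * N + 17"])
    show "ends double_N ?s (9 * N + 7) I1"
      by (rule ends_mono[OF double_N_ends[where N = N]])
        (auto simp: I1_def tables_ok_def agree_def input_state_def)
    fix t1 assume t1: "I1 t1"
    define t2 where "t2 = final (Seq (Assign ''k'' (Const 1)) (Assign ''j'' (Succ (Var ''N'')))) t1"
    have t2: "tables_ok N ?s t2" "tables_ok N t2 t2" "scalar t2 ''k'' = 1" "scalar t2 ''j'' = N + 1" "scalar t2 ''p'' = 2 * N"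
      using t1 by (auto simp: t2_def I1_def tables_ok_def)
    show "ends (Seq (Seq (Assign ''k'' (Const 1)) (Assign ''j'' (Succ (Var ''N''))))
        (Seq fill_tables (Seq (Assign ''k'' (Const 1)) (Seq translate_mates (Assign ''i'' (Const 1)))))) t1 (80 * N + 17) ?post"
    proof (rule ends_Seq[where P = "\<lambda>t. t = t2" and B = 5 and B' = "80 * N + 12"])
      show "ends (Seq (Assign ''k'' (Const 1)) (Assign ''j'' (Succ (Var ''N'')))) t1 5 (\<lambda>t. t = t2)"
        by (rule ends_straight) (simp_all add: t2_def)
      fix t assume "t = t2"
      then have "ends fill_tables t (40 * N + 4) I2"
        using ends_mono[OF fill_tables_ends[OF t2(2-5)] order_refl, of I2] shift[OF t2(1)] by (simp add: I2_def)
      then show "ends (Seq fill_tables (Seq (Assign ''k'' (Const 1)) (Seq translate_mates (Assign ''i'' (Const 1)))))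
          t (80 * N + 12) ?post"
      proof (rule ends_Seq[where B' = "40 * N + 8"])
        fix t3 assume t3: "I2 t3"
        define t4 where "t4 = final (Assign ''k'' (Const 1)) t3"
        have t4: "tables_ok N ?s t4" "tables_ok N t4 t4" "scalar t4 ''k'' = 1" "arr t4 = arr t3"
          using t3 by (auto simp: t4_def I2_def tables_ok_def)
        have t4m: "arr t4 ''mate'' = arr ?s ''mate''" using t4(1) by (simp add: tables_ok_def)
        show "ends (Seq (Assign ''k'' (Const 1)) (Seq translate_mates (Assign ''i'' (Const 1)))) t3 (40 * N + 8) ?post"
        proof (rule ends_Seq[where P = "\<lambda>t. t = t4" and B = 2 and B' = "40 * N + 6"])
          show "ends (Assign ''k'' (Const 1)) t3 2 (\<lambda>t. t = t4)"
            by (rule ends_straight) (simp_all add: t4_def)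
          fix t assume t: "t = t4"
          have "ends translate_mates t4 (40 * N + 4) I3"
          proof (rule ends_mono[OF translate_mates_ends[OF t4(2,3)] order_refl])
            show "arr t4 ''pos'' r = label_pos N r \<and> arr t4 ''col'' r = col N r" if "1 \<le> r" "r \<le> 2 * N" for r
              using t3 that unfolding I2_def t4(4) by blast
            show "1 \<le> arr t4 ''mate'' r \<and> arr t4 ''mate'' r \<le> 2 * N" if "1 \<le> r" "r \<le> 2 * N" for r
              using mate_range[OF that] unfolding t4m .
            show "I3 t'" if "tables_ok N t4 t' \<and> (\<forall>r. 1 \<le> r \<longrightarrow> r \<le> 2 * N \<longrightarrow> arr t' ''col'' r = col N r \<and>
                arr t' ''m'' (label_pos N r) = label_pos N (arr t4 ''mate'' r))" for t'
              using that shift[OF t4(1)] unfolding I3_def t4m by blast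
          qed
          then show "ends (Seq translate_mates (Assign ''i'' (Const 1))) t (40 * N + 6) ?post"
            unfolding t
          proof (rule ends_Seq[where B' = 2])
            fix t5 assume t5: "I3 t5"
            define t6 where "t6 = final (Assign ''i'' (Const 1)) t5"
            have t6: "arr t6 = arr t5" "scalar t6 = (scalar t5)(''i'' := 1)" by (simp_all add: t6_def)
            have eq: "arr t5 ''m'' q = m0 q" if "1 \<le> q" "q \<le> 2 * N" for q
              using m0[OF that] t5 unfolding I3_def by blast
            have pot: "potential N (arr t5 ''m'') = potential N m0" using eq by (rule potential_cong[OF M(1)])
            have "matching N (arr t5 ''m'')" using M(1) eq unfolding matching_def by simp
            moreover have "tangle_of N (arr t5 ''m'') = X" unfolding M(2)[symmetric] using eq by (rule tangle_of_cong)
            moreover have "outputs t6 []" using t5 by (simp add: outputs_def t6 I3_def tables_ok_def)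
            ultimately have "progress N X (potential N m0) t6"
              using t5 pot unfolding progress_def t6 I3_def tables_ok_def
              by (intro conjI exI[of _ "[]"]) (simp_all add: is_word_def stack_def)
            then show "ends (Assign ''i'' (Const 1)) t5 2 ?post"
              by (intro ends_straight) (simp_all add: t6_def[symmetric] t6 pot del: final.simps, simp_all add: t6 pot t6_def)
          qed simp
        qed simp
      qed simp
    qed simp
  qed simp
qed

lemma factorize_ends:
  assumes X: "is_tangle N X"
  shows "ends factorize (input_state N X) (800 * N ^ 4 + 30)
    (\<lambda>s. \<exists>w. outputs s w \<and> minimal_factorization N w X)"
proof -
  define m0 where "m0 = (\<lambda>q. pos N (partner X (node_at N q)))"
  note M = is_tangle_matching[OF X, folded m0_def]
  let ?B = "(4 * N ^ 2 * N + N) * (27 * N + 110) + 3"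
  have pot: "nat (potential N m0) \<le> 4 * N ^ 2"
    using potential_le[OF M(1)] by (simp add: nat_le_iff)
  show ?thesis unfolding factorize_def
  proof (rule ends_Seq[OF prepare_ends[OF X, folded m0_def], where B' = ?B])
    fix t assume t: "progress N X (potential N m0) t \<and> scalar t ''i'' = 1 \<and>
        potential N (arr t ''m'') = potential N m0"
    have "(nat (potential N (arr t ''m'')) * N + N) * (27 * N + 110) + 3 \<le> ?B"
      using t pot by (intro add_mono mult_mono) auto
    with t have "ends factor_loop t ?B (\<lambda>s'. progress N X (potential N m0) s' \<and>
        (\<forall>j. 1 \<le> j \<longrightarrow> j < N \<longrightarrow> \<not> descent N (arr s' ''m'') j))"
      by (intro factor_loop_ends) auto
    then show "ends factor_loop t ?B (\<lambda>s. \<exists>w. outputs s w \<and> minimal_factorization N w X)"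
    proof (rule ends_mono[OF _ order_refl])
      fix s assume s: "progress N X (potential N m0) s \<and> (\<forall>j. 1 \<le> j \<longrightarrow> j < N \<longrightarrow> \<not> descent N (arr s ''m'') j)"
      then obtain w where w: "outputs s w" "is_word N w" "stack N w (tangle_of N (arr s ''m'')) = X"
          "8 * int (length w) + potential N (arr s ''m'') \<le> potential N m0" and m: "matching N (arr s ''m'')"
        unfolding progress_def by blast
      \<comment> \<open>Without a descent the remainder is the identity, so the emitted word alone
        composes to \<open>X\<close>.\<close>
      have "tangle_of N (arr s ''m'') = tangle_of N (\<lambda>q. 2 * N + 1 - q)"
        by (rule tangle_of_cong) (rule no_descent_identity[OF m]; use s in blast)
      then have "tangle_of N (arr s ''m'') = id_tangle N" unfolding tangle_of_identity .
      then have "factorization N w X"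
        using w(2,3) by (simp add: factorization_def word_tangle_def stack_def)
      moreover have "8 * int (length w) \<le> potential N m0"
        using w(4) potential_nonneg[of N "arr s ''m''"] by linarith
      ultimately have "minimal_factorization N w X"
        using minimal_factorizationI[OF M(1)] unfolding M(2) by blast
      then show "\<exists>w. outputs s w \<and> minimal_factorization N w X" using w(1) by blast
    qed
  next
    \<comment> \<open>Positive exponents make this true for \<open>N = 0\<close> too.\<close>
    have "N ^ k \<le> N ^ 4" if "1 \<le> k" "k \<le> 4" for k
      using that by (cases "N = 0") (auto intro: power_increasing)
    from this[of 1] this[of 2] this[of 3]
    have "N \<le> N ^ 4" "N ^ 2 \<le> N ^ 4" "N ^ 3 \<le> N ^ 4" by simp_all
    moreover have "?B = 108 * N ^ 4 + 440 * N ^ 3 + 27 * N ^ 2 + 110 * N + 3"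
      by (simp add: algebra_simps power2_eq_square power3_eq_cube power4_eq_xxxx)
    \<comment> \<open>The coefficients add up to 108 + 440 + 27 + 110 + 89 = 774, and the constants
      to 24 + 3.\<close>
    ultimately show "89 * N + 24 + ?B \<le> 800 * N ^ 4 + 30" by linarith
  qed
qed

theorem mainTheorem1:
  assumes assumption1:
    "\<And>N w. is_word N w \<Longrightarrow>
       \<exists>w'. rewrite_step\<^sup>*\<^sup>* w w' \<and> minimal_factorization N w' (word_tangle N w)"
  assumes assumption2:
    "\<And>N X. is_tangle N X \<Longrightarrow>
       (\<exists>w. minimal_factorization N w X \<and> num_T w = crossings N X) \<and>
       (\<forall>w. factorization N w X \<longrightarrow> crossings N X \<le> num_T w)"
  shows
    "\<exists>(algorithm :: com) (time_bound :: nat \<Rightarrow> nat).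
       (\<lambda>N. real (time_bound N)) \<in> O(\<lambda>N. real N ^ 4) \<and>
       (\<forall>N X. is_tangle N X \<longrightarrow>
          (\<exists>t s w. run algorithm (input_state N X) t s \<and> t \<le> time_bound N \<and>
                   outputs s w \<and> minimal_factorization N w X))"
proof (rule exI[of _ factorize], rule exI[of _ "\<lambda>N. 800 * N ^ 4 + 30"], intro conjI allI impI)
  show "(\<lambda>N. real (800 * N ^ 4 + 30)) \<in> O(\<lambda>N. real N ^ 4)"
  proof (rule bigoI)
    show "\<forall>\<^sub>F N in at_top. norm (real (800 * N ^ 4 + 30)) \<le> 830 * norm (real N ^ 4)"
      \<comment> \<open>830 = 800 + 30: from \<open>N = 1\<close> on the constant is absorbed into
        the fourth power.\<close>
      using eventually_ge_at_top[of 1]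
    proof eventually_elim
      case (elim N)
      then have "1 \<le> real N ^ 4" by simp
      then show ?case by simp
    qed
  qed
  show "\<exists>t s w. run factorize (input_state N X) t s \<and> t \<le> 800 * N ^ 4 + 30 \<and>
      outputs s w \<and> minimal_factorization N w X" if "is_tangle N X" for N X
    using factorize_ends[OF that] unfolding ends_def by blast
qed

end
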